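(* Let $k$ be a field of characteristic zero and let $(P,[\,,],\rhd)$ be a complete filtered post-Lie algebra over $k$ with all quotients $P/P^p$ finite-dimensional. Let $\Delta_\sharp:\mathrm{Sym}(Q)\to\mathrm{Sym}(Q)\otimes\mathrm{Sym}(Q)$ be the homomorphism of coordinate rings corresponding to the product $$\sharp:P\times P\to P,\qquad a\,\sharp\,b=\log^\bullet\bigl(\exp^\bullet(a)*\exp^\bullet(b)\bigr).$$ Via the isomorphism $\psi_\bullet:\mathrm{Sym}(Q)\to U^c(Q)$, the coproduct $\Delta_\sharp$ corresponds to the coproduct $$\Delta_*:U^c(Q)\to U^c(Q)\otimes U^c(Q)$$ which is the dual of the product $*$ on $U(P)$; that is, $(\psi_\bullet\otimes\psi_\bullet)\circ\Delta_\sharp=\Delta_*\circ\psi_\bullet$.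
   Context: A post-Lie algebra is a Lie algebra $(P,[\,,])$ with a bilinear map $\rhd$ such that $x\rhd[y,z]=[x\rhd y,z]+[y,x\rhd z]$ and $[x,y]\rhd z=a(x,y,z)-a(y,x,z)$, where $a(x,y,z)=x\rhd(y\rhd z)-(x\rhd y)\rhd z$. Filtered: there is a decreasing filtration $P=P^1\supseteq P^2\supseteq\cdots$ by subspaces with $[P^p,P^q]\subseteq P^{p+q}$, $P^p\rhd P^q\subseteq P^{p+q}$; complete: $P=\varprojlim_pP/P^p$. $U(P)$ is the enveloping algebra of $(P,[\,,])$, with product $\bullet$ and coproduct $\Delta(A)=\sum A_{(1)}\otimes A_{(2)}$ (elements of $P$ primitive). $\rhd$ extends uniquely to $U(P)$ by $1\rhd A=A$, $A\rhd1=\epsilon(A)1$, $(x\bullet A)\rhd y=x\rhd(A\rhd y)-(x\rhd A)\rhd y$, $A\rhd(B\bullet C)=\sum(A_{(1)}\rhd B)\bullet(A_{(2)}\rhd C)$ for $x,y\in P$, $A,B,C\in U(P)$. The second associative product is $A*B=\sum A_{(1)}\bullet(A_{(2)}\rhd B)$. $U(P)$ is filtered by ideals $F^0=U(P)$ and $F^p$ = the span of products $x_1\bullet\cdots\bullet x_n$, $n\ge1$, $x_r\in P^{i_r}$, $\sum i_r\ge p$ (similarly for the quotients $P_p=P/P^{p+1}$). $\hat U(P)=\varprojlim_pU(P)/F^p$, to which $\bullet$ and $*$ extend; $\exp^\bullet,\log^\bullet$ are the series computed with $\bullet$ in $\hat U(P)$, giving inverse bijections between $P$ and the grouplike elements.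 $Q=\varinjlim_p\mathrm{Hom}_k(P/P^p,k)$, so $P=\mathrm{Hom}_k(Q,k)$, and elements of $\mathrm{Sym}(Q)$ are polynomial functions on $P$ by evaluation: $\mathrm{Sym}(Q)$ is the coordinate ring of the affine variety $P$. The product $\sharp$ is given by polynomial expressions on each quotient of $P$, and $\Delta_\sharp$ is the algebra homomorphism with $(\Delta_\sharp f)(a,b)=f(a\,\sharp\,b)$. $U^c(Q)=\varinjlim_{j,p}\bigl(U(P_p)/F^{j+1}U(P_p)\bigr)^*$, so $\mathrm{Hom}_k(U^c(Q),k)\cong\hat U(P)$. It is a commutative algebra under the shuffle product: viewing elements as functionals on $U(P_p)$, $(fg)(u)=\sum f(u_{(1)})g(u_{(2)})$. It has two coproducts $\Delta_\bullet$ and $\Delta_*$, dual to (the completions of) the products $\bullet$ and $*$. With $\Delta_\bullet$ and the shuffle product it is a Hopf algebra with unit $\eta$ and counit $\epsilon$; let $\star$ be the corresponding convolution on linear endomorphisms of $U^c(Q)$, $J=\mathbf 1-\eta\circ\epsilon$, and $e=J-J^{\star2}/2+J^{\star3}/3-\cdots$. The natural projection $U^c(Q)\to Q$ (restricting functionals to $P_p$) restricts to an isomorphism $\operatorname{im}e\to Q$; its inverse gives $Q\hookrightarrow U^c(Q)$, which extends to the algebra isomorphism $\psi_\bullet:\mathrm{Sym}(Q)\to U^c(Q)$. *)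

theory Defs
  imports
    Complex_Main
    "HOL-Library.Poly_Mapping"
    "HOL-Library.Product_Plus"
    "HOL-Library.Set_Algebras"
    "HOL-Library.Multiset"
    "HOL-Algebra.Module"
begin

section \<open>Linear algebra over a field type\<close>

text \<open>
  \<^typ>\<open>'x \<Rightarrow>\<^sub>0 'k\<close> is the \<^typ>\<open>'k\<close>-vector space with basis \<^typ>\<open>'x\<close>, and it is the monoid algebra
  when \<^typ>\<open>'x\<close> is an additive monoid.
\<close>

definition pscale :: "'k::field \<Rightarrow> ('x \<Rightarrow>\<^sub>0 'k) \<Rightarrow> ('x \<Rightarrow>\<^sub>0 'k)" where
  "pscale c t = Poly_Mapping.map ((*) c) t"

abbreviation basis :: "'x \<Rightarrow> ('x \<Rightarrow>\<^sub>0 'k::field)" where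
  "basis x \<equiv> Poly_Mapping.single x 1"

abbreviation pspan :: "('x \<Rightarrow>\<^sub>0 'k::field) set \<Rightarrow> ('x \<Rightarrow>\<^sub>0 'k) set" where
  "pspan \<equiv> Modules.module.span pscale"

text \<open>Linear extension of a map given on the basis; \<open>s\<close> is the scalar multiplication of the target.\<close>

definition lext :: "('k::field \<Rightarrow> 'v \<Rightarrow> 'v::comm_monoid_add) \<Rightarrow> ('x \<Rightarrow> 'v) \<Rightarrow> ('x \<Rightarrow>\<^sub>0 'k) \<Rightarrow> 'v" where
  "lext s \<phi> t = (\<Sum>x\<in>Poly_Mapping.keys t. s (Poly_Mapping.lookup t x) (\<phi> x))"

text \<open>
  Elements of a quotient \<open>V/N\<close> are the cosets \<open>v +o N\<close>. Every map on a quotient below is computed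
  on a representative of the coset.
\<close>

definition rep :: "'a set \<Rightarrow> 'a" where
  "rep X = (SOME x. x \<in> X)"

text \<open>
  A \<^typ>\<open>'k\<close>-algebra is an \<^typ>\<open>('k, 'v) module\<close> record, with scalars the whole type \<^typ>\<open>'k\<close>.
\<close>

definition alg_hom :: "('k, 'v) module \<Rightarrow> ('k, 'w) module \<Rightarrow> ('v \<Rightarrow> 'w) \<Rightarrow> bool" where
  "alg_hom A B \<phi> \<longleftrightarrow> \<phi> \<in> ring_hom A B \<and>
     (\<forall>c. \<forall>x\<in>carrier A. \<phi> (c \<odot>\<^bsub>A\<^esub> x) = c \<odot>\<^bsub>B\<^esub> \<phi> x)"

text \<open>The tensor product: the vector space on pairs modulo bilinearity, multiplied factorwise.\<close>

definition tensor_rel ::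
    "('k::field, 'v) module \<Rightarrow> ('k, 'w) module \<Rightarrow> ('v \<times> 'w \<Rightarrow>\<^sub>0 'k) set" where
  "tensor_rel V W = pspan (
     {basis (v \<oplus>\<^bsub>V\<^esub> v', w) - basis (v, w) - basis (v', w) | v v' w.
        v \<in> carrier V \<and> v' \<in> carrier V \<and> w \<in> carrier W} \<union>
     {basis (v, w \<oplus>\<^bsub>W\<^esub> w') - basis (v, w) - basis (v, w') | v w w'.
        v \<in> carrier V \<and> w \<in> carrier W \<and> w' \<in> carrier W} \<union>
     {basis (c \<odot>\<^bsub>V\<^esub> v, w) - pscale c (basis (v, w)) | c v w.
        v \<in> carrier V \<and> w \<in> carrier W} \<union>
     {basis (v, c \<odot>\<^bsub>W\<^esub> w) - pscale c (basis (v, w)) | c v w.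
        v \<in> carrier V \<and> w \<in> carrier W})"

definition tensor ::
    "('k::field, 'v) module \<Rightarrow> ('k, 'w) module \<Rightarrow> ('k, ('v \<times> 'w \<Rightarrow>\<^sub>0 'k) set) module" where
  "tensor V W = \<lparr>
     carrier = (\<lambda>t. t +o tensor_rel V W) ` {t. Poly_Mapping.keys t \<subseteq> carrier V \<times> carrier W},
     mult = (\<lambda>X Y. lext pscale (\<lambda>(v, w). lext pscale (\<lambda>(v', w').
              basis (v \<otimes>\<^bsub>V\<^esub> v', w \<otimes>\<^bsub>W\<^esub> w')) (rep Y)) (rep X) +o tensor_rel V W),
     one = basis (\<one>\<^bsub>V\<^esub>, \<one>\<^bsub>W\<^esub>) +o tensor_rel V W,
     zero = 0 +o tensor_rel V W,
     add = (\<lambda>X Y. (rep X + rep Y) +o tensor_rel V W),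
     smult = (\<lambda>c X. pscale c (rep X) +o tensor_rel V W)\<rparr>"

text \<open>\<open>\<phi> \<otimes> \<psi>\<close> for linear \<open>\<phi>\<close>, \<open>\<psi>\<close> with codomains \<open>V'\<close>, \<open>W'\<close>.\<close>

definition tensor_map :: "('k::field, 'v2) module \<Rightarrow> ('k, 'w2) module \<Rightarrow>
    ('v \<Rightarrow> 'v2) \<Rightarrow> ('w \<Rightarrow> 'w2) \<Rightarrow> ('v \<times> 'w \<Rightarrow>\<^sub>0 'k) set \<Rightarrow> ('v2 \<times> 'w2 \<Rightarrow>\<^sub>0 'k) set" where
  "tensor_map V' W' \<phi> \<psi> X = lext pscale (\<lambda>(v, w). basis (\<phi> v, \<psi> w)) (rep X) +o tensor_rel V' W'"

text \<open>The linear form on a tensor product induced by a bilinear form \<open>\<beta>\<close>.\<close>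

definition tensor_form :: "('v \<Rightarrow> 'w \<Rightarrow> 'k::field) \<Rightarrow> ('v \<times> 'w \<Rightarrow>\<^sub>0 'k) set \<Rightarrow> 'k" where
  "tensor_form \<beta> X = lext (*) (\<lambda>(v, w). \<beta> v w) (rep X)"


section \<open>Complete filtered post-Lie algebras\<close>

locale lie_algebra = vector_space scale
  for scale :: "'k::field_char_0 \<Rightarrow> 'p::ab_group_add \<Rightarrow> 'p" +
  fixes bracket :: "'p \<Rightarrow> 'p \<Rightarrow> 'p"
  assumes bracket_linear_left: "Vector_Spaces.linear scale scale (\<lambda>x. bracket x y)"
    and bracket_linear_right: "Vector_Spaces.linear scale scale (bracket x)"
    and bracket_self: "bracket x x = 0"
    and jacobi: "bracket x (bracket y z) + bracket y (bracket z x) + bracket z (bracket x y) = 0"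

locale post_lie_algebra = lie_algebra scale bracket
  for scale :: "'k::field_char_0 \<Rightarrow> 'p::ab_group_add \<Rightarrow> 'p" and bracket +
  fixes tri :: "'p \<Rightarrow> 'p \<Rightarrow> 'p"  (infixr \<open>\<rhd>\<close> 75)
  assumes tri_linear_left: "Vector_Spaces.linear scale scale (\<lambda>x. x \<rhd> y)"
    and tri_linear_right: "Vector_Spaces.linear scale scale (\<lambda>y. x \<rhd> y)"
    and tri_derivation: "x \<rhd> bracket y z = bracket (x \<rhd> y) z + bracket y (x \<rhd> z)"
    and tri_associator:
      "bracket x y \<rhd> z = (x \<rhd> (y \<rhd> z) - (x \<rhd> y) \<rhd> z) - (y \<rhd> (x \<rhd> z) - (y \<rhd> x) \<rhd> z)"

record ('k, 'p) filtered_post_lie =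
  scal :: "'k \<Rightarrow> 'p \<Rightarrow> 'p"
  brk :: "'p \<Rightarrow> 'p \<Rightarrow> 'p"
  tri :: "'p \<Rightarrow> 'p \<Rightarrow> 'p"
  Fil :: "nat \<Rightarrow> 'p set"

text \<open>
  The filtration is indexed from 1; the value \<open>Fil P 0\<close> is never used. The last two axioms are
  injectivity and surjectivity of the canonical map from \<open>P\<close> to the inverse limit of the \<open>P/P\<^sup>p\<close>.
\<close>

locale complete_filtered_post_lie_algebra =
  post_lie_algebra "scal P" "brk P" "tri P"
  for P :: "('k::field_char_0, 'p::ab_group_add) filtered_post_lie" +
  assumes Fil_1: "Fil P 1 = UNIV"
    and Fil_subspace: "p \<ge> 1 \<Longrightarrow> subspace (Fil P p)"
    and Fil_decreasing: "p \<ge> 1 \<Longrightarrow> Fil P (Suc p) \<subseteq> Fil P p"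
    and Fil_brk: "p \<ge> 1 \<Longrightarrow> q \<ge> 1 \<Longrightarrow> x \<in> Fil P p \<Longrightarrow> y \<in> Fil P q \<Longrightarrow> brk P x y \<in> Fil P (p + q)"
    and Fil_tri: "p \<ge> 1 \<Longrightarrow> q \<ge> 1 \<Longrightarrow> x \<in> Fil P p \<Longrightarrow> y \<in> Fil P q \<Longrightarrow> tri P x y \<in> Fil P (p + q)"
    and Fil_separated: "(\<Inter>p\<in>{1..}. Fil P p) = {0}"
    and Fil_complete:
      "(\<And>p. p \<ge> 1 \<Longrightarrow> s (Suc p) - s p \<in> Fil P p) \<Longrightarrow> \<exists>x. \<forall>p\<ge>1. x - s p \<in> Fil P p"

definition finite_dim_quotients ::
    "('k::field_char_0, 'p::ab_group_add) filtered_post_lie \<Rightarrow> bool" where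
  "finite_dim_quotients P \<longleftrightarrow>
     (\<forall>p\<ge>1. \<exists>B. finite B \<and> Modules.module.span (scal P) (B \<union> Fil P p) = UNIV)"


section \<open>Enveloping algebras\<close>

text \<open>Lists form the free monoid, so \<^typ>\<open>'p list \<Rightarrow>\<^sub>0 'k\<close> is the free associative algebra on \<^typ>\<open>'p\<close>.\<close>

instantiation list :: (type) monoid_add
begin

definition zero_list :: "'a list" where "zero_list = []"

definition plus_list :: "'a list \<Rightarrow> 'a list \<Rightarrow> 'a list" where "plus_list u v = u @ v"

instance by standard (simp_all add: zero_list_def plus_list_def)

end

text \<open>
  For a Lie ideal \<open>N\<close> of \<open>P\<close>, the algebra \<open>U(P/N)\<close> is presented by one generator for each
  \<open>x \<in> P\<close>, with the relations that make the generators linear in \<open>x\<close>, turn the bracket into the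
  commutator, and kill the elements of \<open>N\<close>. Thus \<open>U(P/N)\<close> is the free algebra on the set \<open>P\<close>
  modulo \<open>env_ideal P N\<close>, and \<open>U(P)\<close> is the case \<open>N = {0}\<close>. The class of a word
  \<open>[x\<^sub>1, ..., x\<^sub>n]\<close> is the product of the \<open>x\<^sub>i\<close>, and the multiplication of the free algebra
  induces the first product of \<open>U(P)\<close> (written as a bullet in comments below).
\<close>

definition env_rels :: "('k::field_char_0, 'p::ab_group_add) filtered_post_lie \<Rightarrow> 'p set
    \<Rightarrow> ('p list \<Rightarrow>\<^sub>0 'k) set" where
  "env_rels P N =
     {basis [x + y] - basis [x] - basis [y] | x y. True} \<union>
     {basis [scal P c x] - pscale c (basis [x]) | c x. True} \<union>
     {basis [x] * basis [y] - basis [y] * basis [x] - basis [brk P x y] | x y. True} \<union>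
     {basis [x] | x. x \<in> N}"

definition env_ideal :: "('k::field_char_0, 'p::ab_group_add) filtered_post_lie \<Rightarrow> 'p set
    \<Rightarrow> ('p list \<Rightarrow>\<^sub>0 'k) set" where
  "env_ideal P N = pspan {a * r * b | a r b. r \<in> env_rels P N}"

text \<open>
  The inverse image in the free algebra of \<open>F\<^sup>m U(P/N)\<close>. A generator whose class lies in
  \<open>(P/N)\<^sup>i\<close> agrees modulo \<open>env_ideal P N\<close> with one in \<open>P\<^sup>i\<close>. For \<open>m = 0\<close> every word,
  the empty one included, qualifies; for \<open>m \<ge> 1\<close> the empty word does not.
\<close>

definition env_fil :: "('k::field_char_0, 'p::ab_group_add) filtered_post_lie \<Rightarrow> 'p set \<Rightarrow> nat
    \<Rightarrow> ('p list \<Rightarrow>\<^sub>0 'k) set" where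
  "env_fil P N m = pspan (env_ideal P N \<union>
     {basis w | w. \<exists>is. list_all2 (\<lambda>x i. 1 \<le> i \<and> x \<in> Fil P i) w is \<and> m \<le> sum_list is})"

text \<open>
  The coproduct (the algebra homomorphism for which letters are primitive), with the tensor square
  of the free algebra taken on the basis of pairs of words, and the counit.
\<close>

definition coprod :: "('p list \<Rightarrow>\<^sub>0 'k::field) \<Rightarrow> ('p list \<times> 'p list \<Rightarrow>\<^sub>0 'k)" where
  "coprod = lext pscale (\<lambda>w. prod_list (map (\<lambda>x. basis ([x], []) + basis ([], [x])) w))"

definition counit :: "('p list \<Rightarrow>\<^sub>0 'k::field) \<Rightarrow> 'k" where
  "counit A = Poly_Mapping.lookup A []"

text \<open>
  The extension of \<open>\<rhd>\<close> to \<open>U(P)\<close>, on representatives. \<open>word_act\<close> is the action of a word on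
  an element of \<open>P\<close>: it is the rule \<open>(x \<bullet> A) \<rhd> y = x \<rhd> (A \<rhd> y) - (x \<rhd> A) \<rhd> y\<close>, in which
  \<open>x\<close> acts on the word \<open>A\<close> as a derivation because \<open>x\<close> is primitive. \<open>word_tri\<close> is the action of
  a word on a word: \<open>A \<rhd> 1 = \<epsilon>(A) 1\<close>, and
  \<open>A \<rhd> (y \<bullet> C) = \<Sum> (A\<^sub>1 \<rhd> y) \<bullet> (A\<^sub>2 \<rhd> C)\<close> for \<open>y \<in> P\<close>.
\<close>

function word_act :: "('p \<Rightarrow> 'p \<Rightarrow> 'p::ab_group_add) \<Rightarrow> 'p list \<Rightarrow> 'p \<Rightarrow> 'p" where
  "word_act tr [] y = y"
| "word_act tr (x # w) y =
     tr x (word_act tr w y) - (\<Sum>i<length w. word_act tr (w[i := tr x (w ! i)]) y)"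
  by pat_completeness auto
termination by (relation "measure (\<lambda>(tr, w, y). length w)") auto

fun word_tri :: "('p \<Rightarrow> 'p \<Rightarrow> 'p::ab_group_add) \<Rightarrow> 'p list \<Rightarrow> 'p list \<Rightarrow> ('p list \<Rightarrow>\<^sub>0 'k::field)" where
  "word_tri tr w [] = (if w = [] then 1 else 0)"
| "word_tri tr w (y # v) =
     lext pscale (\<lambda>(w1, w2). basis [word_act tr w1 y] * word_tri tr w2 v) (coprod (basis w))"

definition env_tri :: "('k::field_char_0, 'p::ab_group_add) filtered_post_lie
    \<Rightarrow> ('p list \<Rightarrow>\<^sub>0 'k) \<Rightarrow> ('p list \<Rightarrow>\<^sub>0 'k) \<Rightarrow> ('p list \<Rightarrow>\<^sub>0 'k)" where
  "env_tri P A B = lext pscale (\<lambda>w. lext pscale (\<lambda>v. word_tri (tri P) w v) B) A"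

text \<open>The second product \<open>A * B = \<Sum> A\<^sub>1 \<bullet> (A\<^sub>2 \<rhd> B)\<close>.\<close>

definition env_star :: "('k::field_char_0, 'p::ab_group_add) filtered_post_lie
    \<Rightarrow> ('p list \<Rightarrow>\<^sub>0 'k) \<Rightarrow> ('p list \<Rightarrow>\<^sub>0 'k) \<Rightarrow> ('p list \<Rightarrow>\<^sub>0 'k)" where
  "env_star P A B = lext pscale (\<lambda>(w1, w2). basis w1 * env_tri P (basis w2) B) (coprod A)"


section \<open>The completed enveloping algebra\<close>

text \<open>
  An element of the completion of \<open>U(P)\<close> is a compatible sequence \<open>s\<close> with
  \<open>s m \<in> U(P)/F\<^sup>m\<close>, a coset of \<open>env_fil P {0} m\<close>. The exponential is applied to elements of
  \<open>F\<^sup>1\<close> and the logarithm to elements of \<open>1 + F\<^sup>1\<close>, so that in \<open>U(P)/F\<^sup>m\<close> the terms of their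
  series with \<open>n \<ge> m\<close> vanish.
\<close>

definition hat_class :: "('k::field_char_0, 'p::ab_group_add) filtered_post_lie \<Rightarrow> nat
    \<Rightarrow> ('p list \<Rightarrow>\<^sub>0 'k) \<Rightarrow> ('p list \<Rightarrow>\<^sub>0 'k) set" where
  "hat_class P m A = A +o env_fil P {0} m"

definition hat_incl :: "('k::field_char_0, 'p::ab_group_add) filtered_post_lie \<Rightarrow> 'p
    \<Rightarrow> nat \<Rightarrow> ('p list \<Rightarrow>\<^sub>0 'k) set" where
  "hat_incl P x = (\<lambda>m. hat_class P m (basis [x]))"

definition hat_star :: "('k::field_char_0, 'p::ab_group_add) filtered_post_lie
    \<Rightarrow> (nat \<Rightarrow> ('p list \<Rightarrow>\<^sub>0 'k) set) \<Rightarrow> (nat \<Rightarrow> ('p list \<Rightarrow>\<^sub>0 'k) set)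
    \<Rightarrow> nat \<Rightarrow> ('p list \<Rightarrow>\<^sub>0 'k) set" where
  "hat_star P s t = (\<lambda>m. hat_class P m (env_star P (rep (s m)) (rep (t m))))"

definition hat_exp :: "('k::field_char_0, 'p::ab_group_add) filtered_post_lie
    \<Rightarrow> (nat \<Rightarrow> ('p list \<Rightarrow>\<^sub>0 'k) set) \<Rightarrow> nat \<Rightarrow> ('p list \<Rightarrow>\<^sub>0 'k) set" where
  "hat_exp P s = (\<lambda>m. hat_class P m (\<Sum>n<m. pscale (1 / fact n) (rep (s m) ^ n)))"

definition hat_log :: "('k::field_char_0, 'p::ab_group_add) filtered_post_lie
    \<Rightarrow> (nat \<Rightarrow> ('p list \<Rightarrow>\<^sub>0 'k) set) \<Rightarrow> nat \<Rightarrow> ('p list \<Rightarrow>\<^sub>0 'k) set" where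
  "hat_log P s = (\<lambda>m. hat_class P m
     (\<Sum>n\<in>{1..<m}. pscale ((- 1) ^ (n - 1) / of_nat n) ((rep (s m) - 1) ^ n)))"

text \<open>\<open>sh\<close> is the product \<open>a \<sharp> b = log (exp a * exp b)\<close>, with \<open>P\<close> inside the completion.\<close>

definition is_sharp :: "('k::field_char_0, 'p::ab_group_add) filtered_post_lie
    \<Rightarrow> ('p \<Rightarrow> 'p \<Rightarrow> 'p) \<Rightarrow> bool" where
  "is_sharp P sh \<longleftrightarrow> (\<forall>a b. hat_incl P (sh a b) =
     hat_log P (hat_star P (hat_exp P (hat_incl P a)) (hat_exp P (hat_incl P b))))"


section \<open>The symmetric algebra of the continuous dual\<close>

text \<open>\<open>Hom(P/P\<^sup>p, k)\<close> is identified with the linear forms on \<open>P\<close> that vanish on \<open>P\<^sup>p\<close>.\<close>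

definition Q_dual :: "('k::field_char_0, 'p::ab_group_add) filtered_post_lie \<Rightarrow> ('p \<Rightarrow> 'k) set" where
  "Q_dual P = {q. Vector_Spaces.linear (scal P) (*) q \<and> (\<exists>p\<ge>1. \<forall>x\<in>Fil P p. q x = 0)}"

text \<open>\<open>Sym(Q)\<close> is the polynomial algebra on the set \<open>Q\<close> modulo the linear relations.\<close>

definition sym_ideal :: "('k::field_char_0, 'p::ab_group_add) filtered_post_lie
    \<Rightarrow> (('p \<Rightarrow> 'k) multiset \<Rightarrow>\<^sub>0 'k) set" where
  "sym_ideal P = pspan {basis M * r | M r. set_mset M \<subseteq> Q_dual P \<and> r \<in>
     {basis {#\<lambda>x. q x + q' x#} - basis {#q#} - basis {#q'#} | q q'. q \<in> Q_dual P \<and> q' \<in> Q_dual P} \<union>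
     {basis {#\<lambda>x. c * q x#} - pscale c (basis {#q#}) | c q. q \<in> Q_dual P}}"

definition SymQ :: "('k::field_char_0, 'p::ab_group_add) filtered_post_lie
    \<Rightarrow> ('k, (('p \<Rightarrow> 'k) multiset \<Rightarrow>\<^sub>0 'k) set) module" where
  "SymQ P = \<lparr>
     carrier = (\<lambda>f. f +o sym_ideal P) ` {f. \<forall>M\<in>Poly_Mapping.keys f. set_mset M \<subseteq> Q_dual P},
     mult = (\<lambda>X Y. (rep X * rep Y) +o sym_ideal P),
     one = 1 +o sym_ideal P,
     zero = 0 +o sym_ideal P,
     add = (\<lambda>X Y. (rep X + rep Y) +o sym_ideal P),
     smult = (\<lambda>c X. pscale c (rep X) +o sym_ideal P)\<rparr>"

definition sym_gen :: "('k::field_char_0, 'p::ab_group_add) filtered_post_lie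
    \<Rightarrow> ('p \<Rightarrow> 'k) \<Rightarrow> (('p \<Rightarrow> 'k) multiset \<Rightarrow>\<^sub>0 'k) set" where
  "sym_gen P q = basis {#q#} +o sym_ideal P"

definition sym_eval :: "(('p \<Rightarrow> 'k::field) multiset \<Rightarrow>\<^sub>0 'k) set \<Rightarrow> 'p \<Rightarrow> 'k" where
  "sym_eval X a = lext (*) (\<lambda>M. \<Prod>q\<in>#M. q a) (rep X)"

definition is_Delta_sharp :: "('k::field_char_0, 'p::ab_group_add) filtered_post_lie
    \<Rightarrow> ('p \<Rightarrow> 'p \<Rightarrow> 'p)
    \<Rightarrow> ((('p \<Rightarrow> 'k) multiset \<Rightarrow>\<^sub>0 'k) set
        \<Rightarrow> ((('p \<Rightarrow> 'k) multiset \<Rightarrow>\<^sub>0 'k) set \<times> (('p \<Rightarrow> 'k) multiset \<Rightarrow>\<^sub>0 'k) set \<Rightarrow>\<^sub>0 'k) set)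
    \<Rightarrow> bool" where
  "is_Delta_sharp P sh D \<longleftrightarrow> alg_hom (SymQ P) (tensor (SymQ P) (SymQ P)) D \<and>
     (\<forall>f\<in>carrier (SymQ P). \<forall>a b.
        tensor_form (\<lambda>g h. sym_eval g a * sym_eval h b) (D f) = sym_eval f (sh a b))"


section \<open>The dual Hopf algebra\<close>

text \<open>
  Elements of \<open>U\<^sup>c(Q)\<close> are linear forms on \<open>U(P\<^sub>p)/F\<^sup>j\<^sup>+\<^sup>1 U(P\<^sub>p)\<close> for some \<open>j\<close>, \<open>p\<close>, where
  \<open>P\<^sub>p = P/P\<^sup>p\<^sup>+\<^sup>1\<close>, that is, linear forms on the free algebra that vanish on
  \<open>env_fil P (Fil P (p + 1)) (j + 1)\<close>. The transition maps of the direct system are pullbacks along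
  surjections, so that the direct limit is the union.
\<close>

definition Uc :: "('k::field_char_0, 'p::ab_group_add) filtered_post_lie
    \<Rightarrow> ('k, ('p list \<Rightarrow>\<^sub>0 'k) \<Rightarrow> 'k) module" where
  "Uc P = \<lparr>
     carrier = {f. Vector_Spaces.linear pscale (*) f \<and>
                   (\<exists>j p. \<forall>u\<in>env_fil P (Fil P (p + 1)) (j + 1). f u = 0)},
     mult = (\<lambda>f g u. lext (*) (\<lambda>(u1, u2). f (basis u1) * g (basis u2)) (coprod u)),
     one = counit,
     zero = (\<lambda>u. 0),
     add = (\<lambda>f g u. f u + g u),
     smult = (\<lambda>c f u. c * f u)\<rparr>"

text \<open>The coproduct dual to a product \<open>m\<close>: \<open>\<langle>\<Delta> f, u \<otimes> v\<rangle> = f (m u v)\<close>.\<close>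

definition dual_coprod :: "('k::field_char_0, 'p::ab_group_add) filtered_post_lie
    \<Rightarrow> (('p list \<Rightarrow>\<^sub>0 'k) \<Rightarrow> ('p list \<Rightarrow>\<^sub>0 'k) \<Rightarrow> ('p list \<Rightarrow>\<^sub>0 'k))
    \<Rightarrow> (('p list \<Rightarrow>\<^sub>0 'k) \<Rightarrow> 'k)
    \<Rightarrow> ((('p list \<Rightarrow>\<^sub>0 'k) \<Rightarrow> 'k) \<times> (('p list \<Rightarrow>\<^sub>0 'k) \<Rightarrow> 'k) \<Rightarrow>\<^sub>0 'k) set" where
  "dual_coprod P m f = (THE t. t \<in> carrier (tensor (Uc P) (Uc P)) \<and>
     (\<forall>u v. tensor_form (\<lambda>g h. g u * h v) t = f (m u v)))"

definition Delta_bullet where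
  "Delta_bullet P = dual_coprod P (*)"

definition Delta_star where
  "Delta_star P = dual_coprod P (env_star P)"

text \<open>\<open>m \<circ> (\<alpha> \<otimes> \<beta>) \<circ> \<Delta>\<close> with \<open>\<Delta>\<close> dual to the first product and \<open>m\<close> the shuffle product.\<close>

definition convolve :: "('k::field_char_0, 'p::ab_group_add) filtered_post_lie
    \<Rightarrow> ((('p list \<Rightarrow>\<^sub>0 'k) \<Rightarrow> 'k) \<Rightarrow> (('p list \<Rightarrow>\<^sub>0 'k) \<Rightarrow> 'k))
    \<Rightarrow> ((('p list \<Rightarrow>\<^sub>0 'k) \<Rightarrow> 'k) \<Rightarrow> (('p list \<Rightarrow>\<^sub>0 'k) \<Rightarrow> 'k))
    \<Rightarrow> (('p list \<Rightarrow>\<^sub>0 'k) \<Rightarrow> 'k) \<Rightarrow> (('p list \<Rightarrow>\<^sub>0 'k) \<Rightarrow> 'k)" where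
  "convolve P \<alpha> \<beta> f = (\<lambda>u. tensor_form (\<lambda>g h. (g \<otimes>\<^bsub>Uc P\<^esub> h) u)
     (tensor_map (Uc P) (Uc P) \<alpha> \<beta> (Delta_bullet P f)))"

text \<open>The counit of \<open>U\<^sup>c(Q)\<close> is evaluation at \<open>1 \<in> U(P)\<close>; its unit element is \<^const>\<open>counit\<close>.\<close>

definition eta_eps :: "(('p list \<Rightarrow>\<^sub>0 'k::field) \<Rightarrow> 'k) \<Rightarrow> (('p list \<Rightarrow>\<^sub>0 'k) \<Rightarrow> 'k)" where
  "eta_eps f = (\<lambda>u. f 1 * counit u)"

definition J_map :: "(('p list \<Rightarrow>\<^sub>0 'k::field) \<Rightarrow> 'k) \<Rightarrow> (('p list \<Rightarrow>\<^sub>0 'k) \<Rightarrow> 'k)" where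
  "J_map f = (\<lambda>u. f u - eta_eps f u)"

primrec J_pow :: "('k::field_char_0, 'p::ab_group_add) filtered_post_lie \<Rightarrow> nat
    \<Rightarrow> (('p list \<Rightarrow>\<^sub>0 'k) \<Rightarrow> 'k) \<Rightarrow> (('p list \<Rightarrow>\<^sub>0 'k) \<Rightarrow> 'k)" where
  "J_pow P 0 = eta_eps"
| "J_pow P (Suc n) = convolve P J_map (J_pow P n)"

text \<open>\<open>e = J - J\<^sup>2/2 + J\<^sup>3/3 - ...\<close> in the convolution algebra; for each \<open>f\<close> almost all terms vanish.\<close>

definition e_map :: "('k::field_char_0, 'p::ab_group_add) filtered_post_lie
    \<Rightarrow> (('p list \<Rightarrow>\<^sub>0 'k) \<Rightarrow> 'k) \<Rightarrow> (('p list \<Rightarrow>\<^sub>0 'k) \<Rightarrow> 'k)" where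
  "e_map P f = (\<lambda>u. Sum_any (\<lambda>n. (- 1) ^ n / of_nat (Suc n) * J_pow P (Suc n) f u))"

definition proj_Q :: "(('p list \<Rightarrow>\<^sub>0 'k::field) \<Rightarrow> 'k) \<Rightarrow> ('p \<Rightarrow> 'k)" where
  "proj_Q f = (\<lambda>x. f (basis [x]))"

text \<open>
  \<open>\<psi>\<close> is the algebra homomorphism that extends the inverse of the projection from the image
  of \<open>e\<close> onto \<open>Q\<close>. This determines it; bijectivity is a consequence and is not required.
\<close>

definition is_psi_bullet :: "('k::field_char_0, 'p::ab_group_add) filtered_post_lie
    \<Rightarrow> ((('p \<Rightarrow> 'k) multiset \<Rightarrow>\<^sub>0 'k) set \<Rightarrow> (('p list \<Rightarrow>\<^sub>0 'k) \<Rightarrow> 'k)) \<Rightarrow> bool" where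
  "is_psi_bullet P \<psi> \<longleftrightarrow> alg_hom (SymQ P) (Uc P) \<psi> \<and>
     (\<forall>q\<in>Q_dual P. \<psi> (sym_gen P q) \<in> e_map P ` carrier (Uc P) \<and> proj_Q (\<psi> (sym_gen P q)) = q)"

end

theory Submission
  imports Defs "HOL-Computational_Algebra.Formal_Power_Series" "HOL-Computational_Algebra.Polynomial"
begin

text \<open>
  An element \<open>\<psi> q\<close>, \<open>q \<in> Q\<close>, lies in the image of \<open>e\<close>, whose transpose sends a grouplike element of the
  completed enveloping algebra to its logarithm; hence \<open>\<psi> q\<close> takes the value \<open>q a\<close> at \<open>exp a\<close>, and by
  multiplicativity \<open>\<psi> f (exp a) = f a\<close> for every \<open>f\<close>. Since \<open>exp a * exp b = exp (a \<sharp> b)\<close>, both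
  coproducts of \<open>\<psi> f\<close> take the value \<open>f (a \<sharp> b)\<close> on \<open>exp a \<otimes> exp b\<close>. They agree everywhere because
  the exponentials span the enveloping algebra modulo each ideal \<open>F\<^sup>m\<close> (polarisation, and commuting
  letters at the cost of shorter words), and because an element of the tensor square is determined by its
  values. All computations take place in the free algebra on \<open>P\<close>, where the two coproduct formulas hold
  exactly; the ideals enter only through the fact that \<open>*\<close> respects them.
\<close>

section \<open>Linear maps out of free vector spaces\<close>

text \<open>\<open>U(P)\<close> is given no basis, so that \<open>*\<close> descends to it has to be
  derived from the recursion on words, and the left argument is the hard one. The recursion
  subtracts derivatives of words. Derivatives in which a letter is replaced by a relation must be
  seen to act as zero before the relation itself does; they have fewer letters around the relation,
  which is why the ideal is filtered by the bound in \<open>env_ideal_lt\<close>. The second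
  obstacle is that a truncated exponential is not grouplike: its coproduct keeps the terms with
  \<open>i + j < M\<close>, its tensor square those with \<open>i < M\<close> and
  \<open>j < M\<close>. Forms that vanish on \<open>F\<^sup>m\<close> do not see the difference once
  \<open>2 * m \<le> M\<close>. So \<open>\<psi> f (exp a) = f a\<close> means equality for all
  large truncation orders \<open>M\<close>, with a bound that depends on \<open>f\<close>.
  Finite-dimensional quotients give every \<open>F\<^sup>m\<close> finite codimension. Hence
  \<open>f (u * v)\<close> is a finite sum of products of forms in \<open>u\<close> and in
  \<open>v\<close>. This yields the coproduct behind the convolution powers in \<open>e\<close>, and
  lets grouplikeness be applied to a form evaluated at a product.\<close>

lemma lookup_pscale: "Poly_Mapping.lookup (pscale c t) x = c * Poly_Mapping.lookup t x"
  by (simp add: pscale_def map.rep_eq when_def)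

interpretation pm: vector_space "pscale :: 'k::field \<Rightarrow> ('x \<Rightarrow>\<^sub>0 'k) \<Rightarrow> 'x \<Rightarrow>\<^sub>0 'k"
  by unfold_locales (auto intro!: poly_mapping_eqI simp: lookup_pscale lookup_add algebra_simps)

interpretation fld: vector_space "(*) :: 'k::field \<Rightarrow> 'k \<Rightarrow> 'k"
  by unfold_locales (auto simp: algebra_simps)

text \<open>As a simplification rule this one loops together with \<open>mult.assoc\<close>.\<close>

declare fld.scale_scale [simp del]

abbreviation linear_form :: "(('x \<Rightarrow>\<^sub>0 'k::field) \<Rightarrow> 'k) \<Rightarrow> bool" where
  "linear_form \<equiv> Vector_Spaces.linear pscale (*)"

lemma keys_pscale: "Poly_Mapping.keys (pscale c t) \<subseteq> Poly_Mapping.keys t"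
  by (auto simp: in_keys_iff lookup_pscale)

lemma pscale_single: "pscale c (Poly_Mapping.single x d) = Poly_Mapping.single x (c * d)"
  by (rule poly_mapping_eqI) (simp add: lookup_pscale lookup_single when_def)

lemma linearI:
  assumes "vector_space s1" "vector_space s2"
    and "\<And>x y. f (x + y) = f x + f y" "\<And>c x. f (s1 c x) = s2 c (f x)"
  shows "Vector_Spaces.linear s1 s2 f"
  using assms by (simp add: Vector_Spaces.linear_iff)

lemmas linear_formI = linearI[OF pm.vector_space_axioms fld.vector_space_axioms]

lemma basis_expansion: "t = (\<Sum>x\<in>Poly_Mapping.keys t. pscale (Poly_Mapping.lookup t x) (basis x))"
  by (rule poly_mapping_eqI)
    (simp add: lookup_sum lookup_pscale lookup_single when_def in_keys_iff if_distrib[of "(*) _"] cong: if_cong)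

lemma in_subspace_if_basis_in:
  assumes "pm.subspace S" "\<And>x. x \<in> Poly_Mapping.keys t \<Longrightarrow> basis x \<in> S"
  shows "t \<in> S"
proof -
  have "(\<Sum>x\<in>Poly_Mapping.keys t. pscale (Poly_Mapping.lookup t x) (basis x)) \<in> S"
    using assms by (intro pm.subspace_sum pm.subspace_scale)
  then show ?thesis by (metis basis_expansion)
qed

lemma span_range_basis: "t \<in> pspan (range basis)"
  by (rule in_subspace_if_basis_in) (auto intro: pm.span_base)

lemma subspace_keys: "pm.subspace {t. Poly_Mapping.keys t \<subseteq> A}"
  by (rule pm.subspaceI)
    (auto simp del: in_keys_iff intro: subset_trans[OF keys_add] subset_trans[OF keys_pscale]
      dest!: subsetD[OF keys_add] subsetD[OF keys_pscale])

context vector_space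
begin

lemma lext_superset:
  assumes "finite A" "Poly_Mapping.keys t \<subseteq> A"
  shows "lext scale \<phi> t = (\<Sum>x\<in>A. scale (Poly_Mapping.lookup t x) (\<phi> x))"
  unfolding lext_def using assms by (intro sum.mono_neutral_left) (auto simp: in_keys_iff)

lemma linear_lext: "Vector_Spaces.linear pscale scale (lext scale \<phi>)"
proof (rule linearI)
  fix t u :: "'c \<Rightarrow>\<^sub>0 'a"
  let ?A = "Poly_Mapping.keys t \<union> Poly_Mapping.keys u"
  have k: "Poly_Mapping.keys (t + u) \<subseteq> ?A" by (rule keys_add)
  show "lext scale \<phi> (t + u) = lext scale \<phi> t + lext scale \<phi> u"
    by (simp add: lext_superset[of ?A] k lookup_add scale_left_distrib sum.distrib)
next
  fix c :: 'a and t :: "'c \<Rightarrow>\<^sub>0 'a"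
  show "lext scale \<phi> (pscale c t) = scale c (lext scale \<phi> t)"
    using lext_superset[of "Poly_Mapping.keys t" "pscale c t" \<phi>] keys_pscale[of c t]
    by (simp add: lext_def lookup_pscale scale_sum_right)
qed unfold_locales

lemma lext_basis [simp]: "lext scale \<phi> (basis x) = \<phi> x"
  by (simp add: lext_def)

lemma linear_eq_on_basis:
  assumes f: "Vector_Spaces.linear pscale scale f" and g: "Vector_Spaces.linear pscale scale g"
    and eq: "\<And>x. x \<in> Poly_Mapping.keys t \<Longrightarrow> f (basis x) = g (basis x)"
  shows "f t = g t"
proof -
  interpret f: Vector_Spaces.linear pscale scale f by fact
  interpret g: Vector_Spaces.linear pscale scale g by fact
  have "pm.subspace {t. f t = g t}"
    by (rule pm.subspaceI) (auto simp: f.add g.add f.scale g.scale f.zero g.zero)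
  then show ?thesis
    using in_subspace_if_basis_in[of "{t. f t = g t}" t] eq by auto
qed

lemma lext_add: "lext scale \<phi> (t + u) = lext scale \<phi> t + lext scale \<phi> u"
  and lext_pscale: "lext scale \<phi> (pscale c t) = scale c (lext scale \<phi> t)"
  and lext_zero [simp]: "lext scale \<phi> 0 = 0"
  and lext_diff: "lext scale \<phi> (t - u) = lext scale \<phi> t - lext scale \<phi> u"
  and lext_sum: "lext scale \<phi> (sum h A) = (\<Sum>a\<in>A. lext scale \<phi> (h a))"
proof -
  interpret l: Vector_Spaces.linear pscale scale "lext scale \<phi>" by (rule linear_lext)
  show "lext scale \<phi> (t + u) = lext scale \<phi> t + lext scale \<phi> u"
    "lext scale \<phi> (pscale c t) = scale c (lext scale \<phi> t)" "lext scale \<phi> 0 = 0"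
    "lext scale \<phi> (t - u) = lext scale \<phi> t - lext scale \<phi> u"
    "lext scale \<phi> (sum h A) = (\<Sum>a\<in>A. lext scale \<phi> (h a))"
    by (simp_all add: l.add l.scale l.zero l.diff l.sum)
qed

lemma lext_in_subspace:
  assumes "subspace S" "\<And>x. x \<in> Poly_Mapping.keys t \<Longrightarrow> \<phi> x \<in> S"
  shows "lext scale \<phi> t \<in> S"
  unfolding lext_def using assms by (intro subspace_sum subspace_scale)

lemma lext_cong:
  assumes "\<And>x. x \<in> Poly_Mapping.keys t \<Longrightarrow> \<phi> x = \<psi> x"
  shows "lext scale \<phi> t = lext scale \<psi> t"
  unfolding lext_def using assms by (intro sum.cong) auto

lemma linear_lext_comp:
  assumes "Vector_Spaces.linear scale s2 h"
  shows "h (lext scale \<phi> t) = lext s2 (\<lambda>x. h (\<phi> x)) t"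
proof -
  interpret h: Vector_Spaces.linear scale s2 h by fact
  show ?thesis unfolding lext_def by (simp add: h.sum h.scale)
qed

lemma lext_add_fun: "lext scale (\<lambda>x. \<phi> x + \<psi> x) t = lext scale \<phi> t + lext scale \<psi> t"
  and lext_scale_fun: "lext scale (\<lambda>x. scale c (\<phi> x)) t = scale c (lext scale \<phi> t)"
  unfolding lext_def by (simp_all add: scale_right_distrib sum.distrib scale_sum_right mult.commute)

end

lemma linear_comp:
  assumes "Vector_Spaces.linear s1 s2 f" "Vector_Spaces.linear s2 s3 g"
  shows "Vector_Spaces.linear s1 s3 (\<lambda>x. g (f x))"
  using Vector_Spaces.linear_compose[OF assms] by (simp add: o_def)

text \<open>With \<open>S = {0}\<close> it shows that a linear map killing the generators kills the
  span; with \<open>S\<close> an ideal or a filtration step it shows stability under the map. Most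
  arguments about ideals below are of one of these two kinds.\<close>

lemma linear_in_span:
  assumes "Vector_Spaces.linear s1 s2 f" "x \<in> Modules.module.span s1 B"
    and "Modules.module.subspace s2 S" "\<And>b. b \<in> B \<Longrightarrow> f b \<in> S"
  shows "f x \<in> S"
proof -
  interpret f: Vector_Spaces.linear s1 s2 f by fact
  from assms(2) show ?thesis
  proof (induction rule: f.vs1.span_induct_alt)
    case base then show ?case using assms(3) by (simp add: f.zero f.vs2.subspace_0)
  next
    case (step c x y) then show ?case
      using assms(3,4) by (simp add: f.add f.scale f.vs2.subspace_add f.vs2.subspace_scale)
  qed
qed

section \<open>The free associative algebra and the shuffle coproduct\<close>

lemma basis_mult: "basis u * basis v = (basis (u + v) :: 'x::monoid_add \<Rightarrow>\<^sub>0 'k::field)"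
  by (simp add: mult_single)

lemma basis_append: "(basis (u @ v) :: 'p list \<Rightarrow>\<^sub>0 'k::field) = basis u * basis v"
  by (simp add: mult_single plus_list_def)

lemma basis_Cons: "(basis (x # v) :: 'p list \<Rightarrow>\<^sub>0 'k::field) = basis [x] * basis v"
  using basis_append[of "[x]" v] by simp

lemma basis_Nil: "(basis [] :: 'p list \<Rightarrow>\<^sub>0 'k::field) = 1"
  by (simp add: zero_list_def[symmetric])

lemma pscale_conv_mult: "pscale c t = Poly_Mapping.single (0::'x::monoid_add) c * t"
  by (simp add: pscale_def mult_map_scale_conv_mult)

lemma pscale_mult_left: "pscale c a * b = pscale c (a * b :: 'x::monoid_add \<Rightarrow>\<^sub>0 'k::field)"
  by (simp add: pscale_conv_mult mult.assoc)

lemma pscale_mult_right: "a * pscale c b = pscale c (a * b :: 'x::monoid_add \<Rightarrow>\<^sub>0 'k::field)"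
proof -
  have "a * Poly_Mapping.single 0 c = Poly_Mapping.single 0 c * a"
  proof -
    \<comment> \<open>Stated for any expansion of \<open>t\<close>: rewriting with
      \<open>basis_expansion\<close> itself would not stop, since \<open>t\<close> occurs on its
      right-hand side.\<close>
    have "t * Poly_Mapping.single 0 c = Poly_Mapping.single 0 c * t"
      if "t = (\<Sum>x\<in>A. pscale (h x) (basis x))" for t :: "'x \<Rightarrow>\<^sub>0 'k" and A h
      unfolding that by (simp add: sum_distrib_left sum_distrib_right pscale_single mult_single mult.commute)
    then show ?thesis using basis_expansion by blast
  qed
  then show ?thesis by (simp add: pscale_conv_mult mult.assoc[symmetric])
qed

lemma linear_mult_left: "Vector_Spaces.linear pscale pscale (\<lambda>t. a * t :: 'x::monoid_add \<Rightarrow>\<^sub>0 'k::field)"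
  and linear_mult_right: "Vector_Spaces.linear pscale pscale (\<lambda>t. t * a :: 'x::monoid_add \<Rightarrow>\<^sub>0 'k::field)"
  by (rule linearI; simp add: algebra_simps pscale_mult_left pscale_mult_right pm.vector_space_axioms)+

text \<open>
  \<open>unshuffle w \<phi>\<close> is the sum of \<open>\<phi> a b\<close> over all ways to split the word \<open>w\<close> into
  complementary subwords \<open>a\<close>, \<open>b\<close>.
\<close>

primrec unshuffle :: "'p list \<Rightarrow> ('p list \<Rightarrow> 'p list \<Rightarrow> 'v::comm_monoid_add) \<Rightarrow> 'v" where
  "unshuffle [] \<phi> = \<phi> [] []"
| "unshuffle (x # w) \<phi> = unshuffle w (\<lambda>a b. \<phi> (x # a) b) + unshuffle w (\<lambda>a b. \<phi> a (x # b))"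

lemma unshuffle_add: "unshuffle w (\<lambda>a b. \<phi> a b + \<psi> a b) = unshuffle w \<phi> + unshuffle w \<psi>"
  by (induction w arbitrary: \<phi> \<psi>) (simp_all add: ac_simps)

lemma unshuffle_zero [simp]: "unshuffle w (\<lambda>a b. 0) = 0"
  by (induction w) simp_all

lemma unshuffle_linear:
  assumes "Vector_Spaces.linear s1 s2 h"
  shows "h (unshuffle w \<phi>) = unshuffle w (\<lambda>a b. h (\<phi> a b))"
proof -
  interpret h: Vector_Spaces.linear s1 s2 h by fact
  show ?thesis by (induction w arbitrary: \<phi>) (simp_all add: h.add)
qed

lemma unshuffle_diff:
  "unshuffle w (\<lambda>a b. \<phi> a b - \<psi> a b) = unshuffle w \<phi> - (unshuffle w \<psi> :: 'v::ab_group_add)"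
  by (induction w arbitrary: \<phi> \<psi>) simp_all

lemma unshuffle_append:
  "unshuffle (w @ v) \<phi> = unshuffle w (\<lambda>a b. unshuffle v (\<lambda>c d. \<phi> (a @ c) (b @ d)))"
  by (induction w arbitrary: \<phi>) simp_all

lemma unshuffle_commute: "unshuffle w (\<lambda>a b. \<phi> b a) = unshuffle w \<phi>"
proof (induction w arbitrary: \<phi>)
  case (Cons x w)
  show ?case
    using Cons.IH[of "\<lambda>a b. \<phi> a (x # b)"] Cons.IH[of "\<lambda>a b. \<phi> (x # a) b"]
    by (simp add: add.commute)
qed simp

lemma unshuffle_assoc:
  "unshuffle w (\<lambda>a b. unshuffle b (\<lambda>c d. \<phi> a c d)) = unshuffle w (\<lambda>a b. unshuffle a (\<lambda>c d. \<phi> c d b))"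
  by (induction w arbitrary: \<phi>) (simp_all add: unshuffle_add add.assoc)

text \<open>Of the four pieces of \<open>w\<close> the two middle ones are exchanged, which is
  cocommutativity inside the fourfold coproduct. It is the reason why \<open>*\<close> is compatible
  with the coproduct.\<close>

lemma unshuffle_interchange:
  "unshuffle w (\<lambda>a b. unshuffle a (\<lambda>a1 a2. unshuffle b (\<lambda>b1 b2. \<phi> a1 a2 b1 b2)))
     = unshuffle w (\<lambda>a b. unshuffle a (\<lambda>a1 a2. unshuffle b (\<lambda>b1 b2. \<phi> a1 b1 a2 b2)))"
proof (induction w arbitrary: \<phi>)
  case (Cons x w)
  note IH = Cons.IH[of "\<lambda>a1 a2 b1 b2. \<phi> (x # a1) a2 b1 b2"]
    Cons.IH[of "\<lambda>a1 a2 b1 b2. \<phi> a1 (x # a2) b1 b2"]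
    Cons.IH[of "\<lambda>a1 a2 b1 b2. \<phi> a1 a2 (x # b1) b2"]
    Cons.IH[of "\<lambda>a1 a2 b1 b2. \<phi> a1 a2 b1 (x # b2)"]
  show ?case
    unfolding unshuffle.simps unshuffle_add IH by (simp only: add.assoc add.left_commute)
qed simp

lemma unshuffle_swap:
  "unshuffle w (\<lambda>a b. unshuffle v (\<lambda>c d. \<phi> a b c d)) = unshuffle v (\<lambda>c d. unshuffle w (\<lambda>a b. \<phi> a b c d))"
  by (induction w arbitrary: \<phi>) (simp_all add: unshuffle_add)

lemma unshuffle_counit_left: "unshuffle w (\<lambda>a b. if a = [] then \<phi> b else 0) = \<phi> w"
  by (induction w arbitrary: \<phi>) simp_all

lemma unshuffle_cong:
  assumes "\<And>a b. length a + length b = length w \<Longrightarrow> \<phi> a b = \<psi> a b"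
  shows "unshuffle w \<phi> = unshuffle w \<psi>"
  using assms
proof (induction w arbitrary: \<phi> \<psi>)
  case (Cons x w)
  have "unshuffle w (\<lambda>a b. \<phi> (x # a) b) = unshuffle w (\<lambda>a b. \<psi> (x # a) b)"
    "unshuffle w (\<lambda>a b. \<phi> a (x # b)) = unshuffle w (\<lambda>a b. \<psi> a (x # b))"
    by (rule Cons.IH; simp add: Cons.prems)+
  then show ?case by simp
qed simp

lemma (in vector_space) unshuffle_in_subspace:
  assumes "subspace S" "\<And>a b. \<phi> a b \<in> S"
  shows "unshuffle w \<phi> \<in> S"
  using assms by (induction w arbitrary: \<phi>) (simp_all add: subspace_add)

text \<open>Expanding the product chooses for each letter one of the two tensor factors, and so do
  the two summands in the recursion of \<open>unshuffle\<close>.\<close>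

lemma coprod_basis: "coprod (basis w) = unshuffle w (\<lambda>a b. basis (a, b) :: _ \<Rightarrow>\<^sub>0 'k::field)"
proof -
  have "prod_list (map (\<lambda>x. basis ([x], []) + basis ([], [x])) w)
    = unshuffle w (\<lambda>a b. basis (a, b) :: _ \<Rightarrow>\<^sub>0 'k)"
  proof (induction w)
    case Nil then show ?case by (simp flip: single_one add: zero_prod_def zero_list_def)
  next
    case (Cons x w)
    show ?case
      by (simp add: Cons.IH distrib_right unshuffle_add unshuffle_linear[OF linear_mult_left] mult_single plus_prod_def
          plus_list_def)
  qed
  then show ?thesis by (simp add: coprod_def)
qed

lemma linear_coprod: "Vector_Spaces.linear pscale pscale (coprod :: _ \<Rightarrow> _ \<Rightarrow>\<^sub>0 'k::field)"
  unfolding coprod_def by (rule pm.linear_lext)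

lemma (in vector_space) lext_coprod_basis:
  "lext scale (\<lambda>(a, b). \<phi> a b) (coprod (basis w)) = unshuffle w \<phi>"
  by (simp add: coprod_basis unshuffle_linear[OF linear_lext])

lemma (in vector_space) linear_lext_coprod:
  "Vector_Spaces.linear pscale scale (\<lambda>u. lext scale \<phi> (coprod u))"
  using linear_comp[OF linear_coprod linear_lext] .

text \<open>Pure tensors in the free vector space on pairs of words, where \<open>coprod\<close>
  takes its values, as opposed to the cosets formed by \<open>tensor\<close>.\<close>

definition tens :: "('x \<Rightarrow>\<^sub>0 'k::field) \<Rightarrow> ('y \<Rightarrow>\<^sub>0 'k) \<Rightarrow> ('x \<times> 'y \<Rightarrow>\<^sub>0 'k)" where
  "tens A B = lext pscale (\<lambda>a. lext pscale (\<lambda>b. basis (a, b)) B) A"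

lemma tens_basis [simp]: "tens (basis a) (basis b) = basis (a, b)"
  by (simp add: tens_def)

lemma linear_tens_left: "Vector_Spaces.linear pscale pscale (\<lambda>A. tens A B)"
  unfolding tens_def by (rule pm.linear_lext)

lemma linear_tens_right: "Vector_Spaces.linear pscale pscale (tens A)"
  by (rule linearI)
    (simp_all add: tens_def pm.lext_add pm.lext_pscale pm.lext_add_fun pm.lext_scale_fun pm.vector_space_axioms)

lemma (in vector_space) bilinear_eq:
  assumes "\<And>B. Vector_Spaces.linear pscale scale (\<lambda>A. f A B)" "\<And>A. Vector_Spaces.linear pscale scale (f A)"
    and "\<And>B. Vector_Spaces.linear pscale scale (\<lambda>A. g A B)" "\<And>A. Vector_Spaces.linear pscale scale (g A)"
    and "\<And>a b. f (basis a) (basis b) = g (basis a) (basis b)"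
  shows "f A B = g A B"
proof (rule linear_eq_on_basis[OF assms(1,3)])
  show "f (basis a) B = g (basis a) B" for a
    by (rule linear_eq_on_basis[OF assms(2,4) assms(5)])
qed

lemma tens_mult:
  "tens A B * tens C D = tens (A * C) (B * D :: 'y::monoid_add \<Rightarrow>\<^sub>0 'k::field)"
    for A C :: "'x::monoid_add \<Rightarrow>\<^sub>0 'k::field"
proof -
  have 1: "basis (a, b) * tens C D = tens (basis a * C) (basis b * D)" for a :: 'x and b :: 'y
    by (rule pm.bilinear_eq[where f = "\<lambda>C D. basis (a, b) * tens C D" and g = "\<lambda>C D. tens (basis a * C) (basis b * D)"])
      (auto intro!: linear_comp[OF linear_tens_left linear_mult_left] linear_comp[OF linear_tens_right linear_mult_left]
        linear_comp[OF linear_mult_left linear_tens_left] linear_comp[OF linear_mult_left linear_tens_right]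
        simp: basis_mult plus_prod_def)
  show ?thesis
    by (rule pm.bilinear_eq[where f = "\<lambda>A B. tens A B * tens C D" and g = "\<lambda>A B. tens (A * C) (B * D)"])
      (auto intro!: linear_comp[OF linear_tens_left linear_mult_right] linear_comp[OF linear_tens_right linear_mult_right]
        linear_comp[OF linear_mult_right linear_tens_left] linear_comp[OF linear_mult_right linear_tens_right]
        simp: 1)
qed

lemma coprod_mult: "coprod (A * B) = coprod A * (coprod B :: _ \<Rightarrow>\<^sub>0 'k::field)"
proof (rule pm.bilinear_eq[where f = "\<lambda>A B. coprod (A * B)" and g = "\<lambda>A B. coprod A * coprod B"])
  fix a b :: "'a list"
  have "coprod (basis a) * coprod (basis b)
      = unshuffle a (\<lambda>a b'. unshuffle b (\<lambda>c d. basis (a, b') * (basis (c, d) :: _ \<Rightarrow>\<^sub>0 'k)))"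
    unfolding coprod_basis unshuffle_linear[OF linear_mult_right]
    unfolding unshuffle_linear[OF linear_mult_left] ..
  also have "\<dots> = coprod (basis (a @ b))"
    by (simp add: coprod_basis unshuffle_append basis_mult plus_prod_def plus_list_def)
  finally show "coprod (basis a * basis b) = coprod (basis a) * (coprod (basis b) :: _ \<Rightarrow>\<^sub>0 'k)"
    by (simp add: basis_append)
qed (auto intro!: linear_comp[OF linear_mult_left linear_coprod] linear_comp[OF linear_mult_right linear_coprod]
      linear_comp[OF linear_coprod linear_mult_left] linear_comp[OF linear_coprod linear_mult_right])

lemma coprod_letter: "coprod (basis [x]) = tens (basis [x]) 1 + tens 1 (basis [x])"
  by (simp add: coprod_basis flip: basis_Nil)

lemma coprod_1: "coprod 1 = (1 :: _ \<Rightarrow>\<^sub>0 'k::field)"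
  using coprod_basis[of "[]"] by (simp add: basis_Nil) (simp flip: single_one add: zero_prod_def zero_list_def)

section \<open>Derivations of the free algebra\<close>

text \<open>The derivation of words extending \<open>\<delta>\<close>, followed by
  \<open>\<phi>\<close>. Like \<open>unshuffle\<close> it takes a continuation with arbitrary
  values, so that it serves for sums in \<open>P\<close> as well as in the free algebra.\<close>

primrec wderiv :: "('p \<Rightarrow> 'p) \<Rightarrow> 'p list \<Rightarrow> ('p list \<Rightarrow> 'v::comm_monoid_add) \<Rightarrow> 'v" where
  "wderiv \<delta> [] \<phi> = 0"
| "wderiv \<delta> (y # w) \<phi> = \<phi> (\<delta> y # w) + wderiv \<delta> w (\<lambda>w'. \<phi> (y # w'))"

lemma wderiv_conv_sum: "(\<Sum>i<length w. \<phi> (w[i := \<delta> (w ! i)])) = wderiv \<delta> w \<phi>"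
proof (induction w arbitrary: \<phi>)
  case (Cons y w)
  have "(\<Sum>i<length (y # w). \<phi> ((y # w)[i := \<delta> ((y # w) ! i)]))
    = \<phi> (\<delta> y # w) + (\<Sum>i<length w. \<phi> (y # w[i := \<delta> (w ! i)]))"
    unfolding length_Cons sum.lessThan_Suc_shift by simp
  then show ?case by (simp only: Cons.IH[of "\<lambda>w. \<phi> (y # w)"] wderiv.simps)
qed simp

lemma word_act_Cons:
  "word_act tr (x # w) y = tr x (word_act tr w y) - wderiv (tr x) w (\<lambda>w'. word_act tr w' y)"
  by (simp add: wderiv_conv_sum[where \<phi> = "\<lambda>w'. word_act tr w' y" and \<delta> = "tr x"])

declare word_act.simps(2) [simp del]

lemma wderiv_add: "wderiv \<delta> w (\<lambda>w'. \<phi> w' + \<psi> w') = wderiv \<delta> w \<phi> + wderiv \<delta> w \<psi>"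
  by (induction w arbitrary: \<phi> \<psi>) (simp_all add: ac_simps)

lemma wderiv_linear:
  assumes "Vector_Spaces.linear s1 s2 h"
  shows "h (wderiv \<delta> w \<phi>) = wderiv \<delta> w (\<lambda>w'. h (\<phi> w'))"
proof -
  interpret h: Vector_Spaces.linear s1 s2 h by fact
  show ?thesis by (induction w arbitrary: \<phi>) (simp_all add: h.add h.zero)
qed

lemma wderiv_cong:
  assumes "\<And>w'. length w' = length w \<Longrightarrow> \<phi> w' = \<psi> w'"
  shows "wderiv \<delta> w \<phi> = wderiv \<delta> w \<psi>"
  using assms
proof (induction w arbitrary: \<phi> \<psi>)
  case (Cons y w)
  have "wderiv \<delta> w (\<lambda>w'. \<phi> (y # w')) = wderiv \<delta> w (\<lambda>w'. \<psi> (y # w'))"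
    by (rule Cons.IH) (rule Cons.prems, simp)
  moreover have "\<phi> (\<delta> y # w) = \<psi> (\<delta> y # w)" by (rule Cons.prems) simp
  ultimately show ?case by (simp only: wderiv.simps)
qed simp

lemma (in vector_space) wderiv_in_subspace:
  assumes "subspace S" "\<And>w'. length w' = length w \<Longrightarrow> \<phi> w' \<in> S"
  shows "wderiv \<delta> w \<phi> \<in> S"
  using assms
proof (induction w arbitrary: \<phi>)
  case (Cons y w)
  have "wderiv \<delta> w (\<lambda>w'. \<phi> (y # w')) \<in> S"
    by (rule Cons.IH[OF Cons.prems(1)]) (rule Cons.prems, simp)
  moreover have "\<phi> (\<delta> y # w) \<in> S" by (rule Cons.prems) simp
  ultimately show ?case using Cons.prems(1) by (simp add: subspace_add)
qed (simp add: subspace_0)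

text \<open>A derivation that replaces letters by letters is also a coderivation: the letter that it
  changes lies in exactly one of the two subwords.\<close>

lemma unshuffle_wderiv:
  "wderiv \<delta> w (\<lambda>w'. unshuffle w' \<phi>)
     = unshuffle w (\<lambda>a b. wderiv \<delta> a (\<lambda>a'. \<phi> a' b) + wderiv \<delta> b (\<lambda>b'. \<phi> a b'))"
  by (induction w arbitrary: \<phi>) (simp_all add: unshuffle_add wderiv_add ac_simps)

text \<open>Here a letter may be replaced by any element of the free algebra. Letters are not
  additive there: the difference between the derivation of \<open>x + z\<close> and those of
  \<open>x\<close> and \<open>z\<close> replaces a letter by a relation, not by a letter.\<close>

primrec der :: "('p \<Rightarrow> 'p list \<Rightarrow>\<^sub>0 'k::field) \<Rightarrow> 'p list \<Rightarrow> ('p list \<Rightarrow>\<^sub>0 'k)" where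
  "der \<kappa> [] = 0"
| "der \<kappa> (y # w) = \<kappa> y * basis w + basis [y] * der \<kappa> w"

lemma der_add: "der (\<lambda>y. \<kappa> y + \<mu> y) w = der \<kappa> w + der \<mu> w"
  and der_diff: "der (\<lambda>y. \<kappa> y - \<mu> y) w = der \<kappa> w - der \<mu> w"
  by (induction w) (simp_all add: distrib_left distrib_right left_diff_distrib right_diff_distrib)

lemma der_pscale: "der (\<lambda>y. pscale c (\<kappa> y)) w = pscale c (der \<kappa> w)"
  by (induction w) (simp_all add: pscale_mult_left pscale_mult_right pm.scale_right_distrib)

lemma wderiv_eq_der: "wderiv \<delta> w basis = der (\<lambda>y. basis [\<delta> y]) w"
proof (induction w)
  case (Cons y w)
  have "wderiv \<delta> w (\<lambda>w'. basis (y # w')) = wderiv \<delta> w (\<lambda>w'. basis [y] * (basis w' :: _ \<Rightarrow>\<^sub>0 'b))"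
    by (simp flip: basis_Cons)
  also have "\<dots> = basis [y] * der (\<lambda>y. basis [\<delta> y]) w"
    by (simp add: wderiv_linear[OF linear_mult_left, symmetric] Cons.IH)
  finally show ?case by (simp flip: basis_Cons)
qed simp

definition Der :: "('p \<Rightarrow> 'p list \<Rightarrow>\<^sub>0 'k::field) \<Rightarrow> ('p list \<Rightarrow>\<^sub>0 'k) \<Rightarrow> ('p list \<Rightarrow>\<^sub>0 'k)" where
  "Der \<kappa> = lext pscale (der \<kappa>)"

lemma linear_Der: "Vector_Spaces.linear pscale pscale (Der \<kappa>)"
  unfolding Der_def by (rule pm.linear_lext)

lemma Der_basis [simp]: "Der \<kappa> (basis w) = der \<kappa> w"
  by (simp add: Der_def)

lemma Der_add: "Der \<kappa> (a + b) = Der \<kappa> a + Der \<kappa> b" and Der_diff: "Der \<kappa> (a - b) = Der \<kappa> a - Der \<kappa> b"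
  and Der_pscale: "Der \<kappa> (pscale c a) = pscale c (Der \<kappa> a)" and Der_0 [simp]: "Der \<kappa> 0 = 0"
  by (simp_all add: Der_def pm.lext_add pm.lext_diff pm.lext_pscale)

lemma der_append: "der \<kappa> (u @ v) = der \<kappa> u * basis v + basis u * der \<kappa> v"
proof (induction u)
  case (Cons y u)
  then show ?case
    by (simp add: basis_append basis_Cons[of y u] algebra_simps)
qed (simp add: basis_Nil)

lemma Der_mult: "Der \<kappa> (a * b) = Der \<kappa> a * b + a * Der \<kappa> b"
  by (rule pm.bilinear_eq[where f = "\<lambda>a b. Der \<kappa> (a * b)" and g = "\<lambda>a b. Der \<kappa> a * b + a * Der \<kappa> b"])
    (auto intro!: linearI pm.vector_space_axioms simp: Der_add Der_pscale pscale_mult_left pscale_mult_right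
      der_append algebra_simps pm.scale_right_distrib simp flip: basis_append)

text \<open>A commutator of derivations is again a derivation, so only its values on letters matter:
  the terms in which \<open>\<delta>\<close> and \<open>\<epsilon>\<close> hit different letters
  cancel.\<close>

lemma der_commutator:
  "Der (\<lambda>y. basis [\<delta> y]) (der (\<lambda>y. basis [\<epsilon> y]) w) - Der (\<lambda>y. basis [\<epsilon> y]) (der (\<lambda>y. basis [\<delta> y]) w)
     = (der (\<lambda>y. basis [\<delta> (\<epsilon> y)] - basis [\<epsilon> (\<delta> y)]) w :: _ \<Rightarrow>\<^sub>0 'k::field)"
proof (induction w)
  case (Cons y w)
  have "der (\<lambda>y. basis [\<delta> (\<epsilon> y)] - basis [\<epsilon> (\<delta> y)]) (y # w)
    = (basis [\<delta> (\<epsilon> y)] - basis [\<epsilon> (\<delta> y)]) * basis w + basis [y] *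
      (Der (\<lambda>y. basis [\<delta> y]) (der (\<lambda>y. basis [\<epsilon> y]) w) - Der (\<lambda>y. basis [\<epsilon> y]) (der (\<lambda>y. basis [\<delta> y]) w)
        :: _ \<Rightarrow>\<^sub>0 'k)"
    by (simp add: Cons.IH)
  then show ?case by (simp add: Der_add Der_mult basis_Nil algebra_simps)
qed simp

section \<open>The action on the enveloping algebra is well defined\<close>

lemma subspace_env_ideal [simp]: "pm.subspace (env_ideal P N)"
  by (simp add: env_ideal_def)

lemma env_rels_in_ideal: "r \<in> env_rels P N \<Longrightarrow> a * r * b \<in> env_ideal P N"
  unfolding env_ideal_def by (rule pm.span_base) auto

lemma env_rels_cases:
  assumes "r \<in> env_rels P N"
  obtains (add) x y where "r = basis [x + y] - basis [x] - basis [y]"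
    | (scale) c x where "r = basis [scal P c x] - pscale c (basis [x])"
    | (brk) x y where "r = basis [x] * basis [y] - basis [y] * basis [x] - basis [brk P x y]"
    | (zero) x where "x \<in> N" "r = basis [x]"
  using assms unfolding env_rels_def by blast

lemma env_ideal_mult_left:
  assumes "u \<in> env_ideal P N"
  shows "c * u \<in> env_ideal P N"
proof (rule linear_in_span[OF linear_mult_left assms[unfolded env_ideal_def]])
  fix v assume "v \<in> {a * r * b | a r b. r \<in> env_rels P N}"
  then obtain a r b where "v = a * r * b" "r \<in> env_rels P N" by blast
  then show "c * v \<in> env_ideal P N"
    using env_rels_in_ideal[of r P N "c * a" b] by (simp add: mult.assoc)
qed simp

lemma env_ideal_mult_right:
  assumes "u \<in> env_ideal P N"
  shows "u * c \<in> env_ideal P N"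
proof (rule linear_in_span[OF linear_mult_right assms[unfolded env_ideal_def]])
  fix v assume "v \<in> {a * r * b | a r b. r \<in> env_rels P N}"
  then obtain a r b where "v = a * r * b" "r \<in> env_rels P N" by blast
  then show "v * c \<in> env_ideal P N"
    using env_rels_in_ideal[of r P N a "b * c"] by (simp add: mult.assoc)
qed simp

lemma env_ideal_letter: "x \<in> N \<Longrightarrow> basis [x] \<in> env_ideal P N"
  using env_rels_in_ideal[of "basis [x]" P N 1 1] by (auto simp: env_rels_def)

text \<open>Only the letters around the relation are counted. A word of length \<open>n\<close> in
  which one letter is replaced by a relation thus lies in level \<open>n\<close>, whereas a relation
  multiplied by such a word is a generator only from level \<open>Suc n\<close> on.\<close>

definition env_ideal_lt ::
    "('k::field_char_0, 'p::ab_group_add) filtered_post_lie \<Rightarrow> 'p set \<Rightarrow> nat \<Rightarrow> ('p list \<Rightarrow>\<^sub>0 'k) set" where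
  "env_ideal_lt P N n = pspan {basis a * r * basis b | a r b. r \<in> env_rels P N \<and> length a + length b < n}"

lemma env_ideal_lt_rels:
  assumes "r \<in> pspan (env_rels P N)" "length a + length b < n"
  shows "basis a * r * basis b \<in> env_ideal_lt P N n"
proof (rule linear_in_span[OF linear_comp[OF linear_mult_left linear_mult_right] assms(1)])
  fix r assume "r \<in> env_rels P N"
  with assms(2) show "basis a * r * basis b \<in> env_ideal_lt P N n"
    unfolding env_ideal_lt_def by (intro pm.span_base) blast
qed (simp add: env_ideal_lt_def)

lemma env_ideal_lt_mono: "m \<le> n \<Longrightarrow> env_ideal_lt P N m \<subseteq> env_ideal_lt P N n"
  unfolding env_ideal_lt_def by (rule pm.span_mono) fastforce

text \<open>It suffices to multiply the relations by words; this makes induction on the length possible.\<close>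

lemma env_ideal_in_lt:
  assumes "u \<in> env_ideal P N"
  obtains n where "u \<in> env_ideal_lt P N n"
proof -
  let ?W = "{basis a * r * basis b | a r b. r \<in> env_rels P N}"
  have W: "basis a * r * basis b \<in> pspan ?W" if "r \<in> env_rels P N" for a r b
    using that by (intro pm.span_base) blast
  have 1: "basis a * r * b \<in> pspan ?W" if r: "r \<in> env_rels P N" for a r b
  proof (rule linear_in_span[OF linear_mult_left span_range_basis])
    show "basis a * r * v \<in> pspan ?W" if "v \<in> range basis" for v
      using that W[OF r] by (elim rangeE) (simp only:)
  qed simp
  have *: "a * r * b \<in> pspan ?W" if r: "r \<in> env_rels P N" for a r b
  proof (rule linear_in_span[OF linear_comp[OF linear_mult_right linear_mult_right] span_range_basis])
    show "v * r * b \<in> pspan ?W" if "v \<in> range basis" for v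
      using that 1[OF r] by (elim rangeE) (simp only:)
  qed simp
  have "env_ideal P N \<subseteq> pspan ?W"
    unfolding env_ideal_def using * by (intro pm.span_minimal) auto
  with assms have "u \<in> pspan ?W" by blast
  then have "\<exists>n. u \<in> env_ideal_lt P N n"
  proof (induction rule: pm.span_induct_alt)
    case base
    then show ?case by (auto simp: env_ideal_lt_def intro: pm.span_zero)
  next
    case (step c x y)
    then obtain n a r b where n: "y \<in> env_ideal_lt P N n" and x: "x = basis a * r * basis b" "r \<in> env_rels P N"
      by auto
    let ?m = "max n (Suc (length a + length b))"
    have "x \<in> env_ideal_lt P N ?m"
      unfolding x(1) by (rule env_ideal_lt_rels) (auto simp: x(2) pm.span_base)
    moreover have "y \<in> env_ideal_lt P N ?m" using n env_ideal_lt_mono[of n ?m] by auto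
    ultimately have "pscale c x + y \<in> env_ideal_lt P N ?m"
      unfolding env_ideal_lt_def by (intro pm.span_add pm.span_scale)
    then show ?case by blast
  qed
  with that show ?thesis by blast
qed

context complete_filtered_post_lie_algebra
begin

lemmas scal_vector_space = vector_space_axioms

lemma brk_add_left: "brk P (x + y) z = brk P x z + brk P y z"
  and brk_scale_left: "brk P (scal P c x) z = scal P c (brk P x z)"
  and brk_add_right: "brk P z (x + y) = brk P z x + brk P z y"
  and brk_scale_right: "brk P z (scal P c x) = scal P c (brk P z x)"
  and tri_add_left: "tri P (x + y) z = tri P x z + tri P y z"
  and tri_scale_left: "tri P (scal P c x) z = scal P c (tri P x z)"
  and tri_add_right: "tri P z (x + y) = tri P z x + tri P z y"
  and tri_scale_right: "tri P z (scal P c x) = scal P c (tri P z x)"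
  using bracket_linear_left[of z] bracket_linear_right[of z] tri_linear_left[of z] tri_linear_right[of z]
  by (simp_all add: Vector_Spaces.linear_iff)

lemma tri_zero_left [simp]: "tri P 0 z = 0" and tri_zero_right [simp]: "tri P z 0 = 0"
  using tri_add_left[of 0 0 z] tri_add_right[of z 0 0] by simp_all

lemma tri_diff_right: "tri P z (x - y) = tri P z x - tri P z y"
  using tri_add_right[of z "x - y" y] by simp

lemma brk_diff_left: "brk P (x - y) z = brk P x z - brk P y z"
  using brk_add_left[of "x - y" y z] by simp

lemma brk_diff_right: "brk P z (x - y) = brk P z x - brk P z y"
  using brk_add_right[of z "x - y" y] by simp

subsection \<open>The letters are linear modulo the relations\<close>

abbreviation rels :: "('p list \<Rightarrow>\<^sub>0 'k) set" where
  "rels \<equiv> pspan (env_rels P {0})"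

lemma rels_add: "basis [x + y] - basis [x] - basis [y] \<in> rels"
  and rels_scale: "basis [scal P c x] - pscale c (basis [x]) \<in> rels"
  and rels_brk: "basis [x] * basis [y] - basis [y] * basis [x] - basis [brk P x y] \<in> rels"
proof -
  let ?A = "{basis [x + y] - basis [x] - basis [y] | x y. True} :: ('p list \<Rightarrow>\<^sub>0 'k) set"
    and ?S = "{basis [scal P c x] - pscale c (basis [x]) | c x. True} :: ('p list \<Rightarrow>\<^sub>0 'k) set"
    and ?B = "{basis [x] * basis [y] - basis [y] * basis [x] - basis [brk P x y] | x y. True} :: ('p list \<Rightarrow>\<^sub>0 'k) set"
  have sub: "?A \<union> ?S \<union> ?B \<subseteq> rels"
    using pm.span_superset[of "env_rels P {0}"] unfolding env_rels_def by simp
  have "basis [x + y] - basis [x] - basis [y] \<in> ?A"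
    by (rule CollectI, rule exI[of _ x], rule exI[of _ y]) simp
  then show "basis [x + y] - basis [x] - basis [y] \<in> rels" by (rule subsetD[OF sub, OF UnI1, OF UnI1])
  have "basis [scal P c x] - pscale c (basis [x]) \<in> ?S"
    by (rule CollectI, rule exI[of _ c], rule exI[of _ x]) simp
  then show "basis [scal P c x] - pscale c (basis [x]) \<in> rels" by (rule subsetD[OF sub, OF UnI1, OF UnI2])
  have "basis [x] * basis [y] - basis [y] * basis [x] - basis [brk P x y] \<in> ?B"
    by (rule CollectI, rule exI[of _ x], rule exI[of _ y]) simp
  then show "basis [x] * basis [y] - basis [y] * basis [x] - basis [brk P x y] \<in> rels"
    by (rule subsetD[OF sub, OF UnI2])
qed

lemma rels_zero: "basis [0] \<in> rels"
  using rels_scale[of 0 0] by simp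

lemma rels_diff: "basis [x - y] - basis [x] + basis [y] \<in> rels"
  using pm.span_neg[OF rels_add[of "x - y" y]] by (simp add: algebra_simps)

lemma rels_in_ideal: "r \<in> rels \<Longrightarrow> r \<in> env_ideal P {0}"
  using pm.span_minimal[of "env_rels P {0}" "env_ideal P {0}"] env_rels_in_ideal[of _ P "{0}" 1 1] by auto

definition act :: "('p list \<Rightarrow>\<^sub>0 'k) \<Rightarrow> 'p \<Rightarrow> 'p" where
  "act u y = lext (scal P) (\<lambda>w. word_act (tri P) w y) u"

lemma act_add: "act (u + v) y = act u y + act v y" and act_diff: "act (u - v) y = act u y - act v y"
  and act_pscale: "act (pscale c u) y = scal P c (act u y)"
  and act_basis: "act (basis w) y = word_act (tri P) w y"
  by (simp_all add: act_def lext_add lext_diff lext_pscale)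

lemma linear_act: "Vector_Spaces.linear pscale (scal P) (\<lambda>u. act u y)"
  unfolding act_def by (rule linear_lext)

abbreviation D :: "'p \<Rightarrow> ('p list \<Rightarrow>\<^sub>0 'k) \<Rightarrow> ('p list \<Rightarrow>\<^sub>0 'k)" where
  "D x \<equiv> Der (\<lambda>y. basis [tri P x y])"

lemma act_letter_mult: "act (basis [x] * u) y = tri P x (act u y) - act (D x u) y"
proof -
  have "act (basis [x] * basis w) y = tri P x (act (basis w) y) - act (D x (basis w)) y" for w
    by (simp add: act_basis word_act_Cons wderiv_linear[OF linear_act] flip: basis_Cons wderiv_eq_der)
  moreover have "Vector_Spaces.linear pscale (scal P) (\<lambda>u. tri P x (act u y) - act (D x u) y)"
    by (rule linearI)
      (auto simp: act_add act_pscale tri_add_right tri_scale_right Der_add Der_pscale scale_right_diff_distrib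
        scal_vector_space pm.vector_space_axioms)
  ultimately show ?thesis
    using linear_eq_on_basis[OF linear_comp[OF linear_mult_left linear_act],
        of "\<lambda>u. tri P x (act u y) - act (D x u) y" u "basis [x]" y] by blast
qed

text \<open>Linearity of \<open>x \<rhd> y\<close> in \<open>y\<close> preserves the linearity
  relations, and the derivation axiom preserves the commutator relations.\<close>

lemma D_rels: "r \<in> rels \<Longrightarrow> D x r \<in> rels"
proof (erule linear_in_span[OF linear_Der])
  fix r assume "r \<in> env_rels P {0}"
  then show "D x r \<in> rels"
  proof (cases rule: env_rels_cases)
    case add
    then show ?thesis using rels_add by (simp add: Der_diff tri_add_right basis_Nil)
  next
    case scale
    then show ?thesis using rels_scale by (simp add: Der_diff Der_pscale tri_scale_right basis_Nil)
  next
    case (brk y z)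
    let ?p = "tri P x y" and ?q = "tri P x z"
    \<comment> \<open>The derivation axiom makes the image of the bracket the single letter of a
      sum; besides the two commutator relations this costs one additivity relation.\<close>
    have "D x r = (basis [?p] * basis [z] - basis [z] * basis [?p] - basis [brk P ?p z])
      + (basis [y] * basis [?q] - basis [?q] * basis [y] - basis [brk P y ?q])
      - (basis [brk P ?p z + brk P y ?q] - basis [brk P ?p z] - basis [brk P y ?q])"
      unfolding brk Der_diff Der_mult by (simp add: basis_Nil tri_derivation)
    then show ?thesis by (simp only: pm.span_add pm.span_diff rels_add rels_brk)
  next
    case zero
    then show ?thesis using rels_zero by (simp add: basis_Nil)
  qed
qed simp

lemma D_ideal_lt:
  assumes "u \<in> env_ideal_lt P {0} n"
  shows "D x u \<in> env_ideal_lt P {0} n"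
  using assms unfolding env_ideal_lt_def
proof (rule linear_in_span[OF linear_Der], fold env_ideal_lt_def)
  fix u assume "u \<in> {basis a * r * basis b | a r b. r \<in> env_rels P {0} \<and> length a + length b < n}"
  then obtain a r b where u: "u = basis a * r * basis b" "r \<in> env_rels P {0}" "length a + length b < n"
    by blast
  have r: "r \<in> rels" using u(2) by (rule pm.span_base)
  have sub: "pm.subspace (env_ideal_lt P {0} n)" by (simp add: env_ideal_lt_def)
  have "der (\<lambda>y. basis [tri P x y]) a * r * basis b \<in> env_ideal_lt P {0} n"
    using u(3) r sub
    by (simp add: wderiv_linear[OF linear_mult_right] pm.wderiv_in_subspace env_ideal_lt_rels flip: wderiv_eq_der)
  moreover have "basis a * D x r * basis b \<in> env_ideal_lt P {0} n"
    using u(3) by (intro env_ideal_lt_rels D_rels r)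
  moreover have "basis a * r * der (\<lambda>y. basis [tri P x y]) b \<in> env_ideal_lt P {0} n"
    using u(3) r sub
    by (simp add: wderiv_linear[OF linear_mult_left] pm.wderiv_in_subspace env_ideal_lt_rels flip: wderiv_eq_der)
  ultimately show "D x u \<in> env_ideal_lt P {0} n"
    using sub by (simp add: u(1) Der_mult distrib_right pm.subspace_add)
qed (simp add: env_ideal_lt_def)

lemma der_ideal_lt:
  assumes "\<And>y. \<kappa> y \<in> rels"
  shows "der \<kappa> b \<in> env_ideal_lt P {0} (length b)"
proof -
  have "basis a * der \<kappa> b \<in> env_ideal_lt P {0} (length a + length b)" for a
  proof (induction b arbitrary: a)
    case Nil
    then show ?case by (simp add: env_ideal_lt_def pm.span_zero)
  next
    case (Cons y b)
    have "basis a * \<kappa> y * basis b \<in> env_ideal_lt P {0} (length a + length (y # b))"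
      using assms by (intro env_ideal_lt_rels) auto
    moreover have "basis a * (basis [y] * der \<kappa> b) \<in> env_ideal_lt P {0} (length a + length (y # b))"
      using Cons.IH[of "a @ [y]"] by (simp add: basis_append mult.assoc)
    ultimately show ?case
      by (simp add: distrib_left mult.assoc env_ideal_lt_def pm.span_add)
  qed
  from this[of "[]"] show ?thesis by (simp add: basis_Nil)
qed

text \<open>Induction on the number of letters around the relation. If a letter precedes the
  relation, \<open>act_letter_mult\<close> removes it, and both resulting terms lie in the smaller
  level because \<open>D x\<close> preserves levels. If the relation comes first, each kind reduces
  to the matching axiom in \<open>P\<close>; what remains is a derivative of the word behind it with
  values in the relations.\<close>

lemma act_ideal_lt: "u \<in> env_ideal_lt P {0} n \<Longrightarrow> act u y = 0"
proof (induction n arbitrary: u y)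
  case 0
  then show ?case by (simp add: env_ideal_lt_def act_def)
next
  case (Suc n)
  \<comment> \<open>One of the at most \<open>n\<close> letters of \<open>b\<close> becomes a
    relation, so fewer than \<open>n\<close> letters surround it.\<close>
  have der: "act (der \<kappa> b) y = 0" if "\<And>y. \<kappa> y \<in> rels" "length b \<le> n" for \<kappa> b y
    using Suc.IH[of "der \<kappa> b" y] der_ideal_lt[of \<kappa> b] that env_ideal_lt_mono[of "length b" n] by auto
  have "act u y \<in> {0}"
  proof (rule linear_in_span[OF linear_act Suc.prems[unfolded env_ideal_lt_def]])
    fix u assume "u \<in> {basis a * r * basis b | a r b. r \<in> env_rels P {0} \<and> length a + length b < Suc n}"
    then obtain a r b where u: "u = basis a * r * basis b" "r \<in> env_rels P {0}" "length a + length b \<le> n"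
      by auto
    show "act u y \<in> {0}"
    proof (cases a)
      case (Cons x a')
      have "basis a' * r * basis b \<in> env_ideal_lt P {0} n"
        using u Cons by (intro env_ideal_lt_rels) (auto simp: pm.span_base)
      then show ?thesis
        by (simp add: u(1) Cons basis_Cons[of x a'] mult.assoc act_letter_mult Suc.IH D_ideal_lt)
    next
      case Nil
      let ?b = "basis b :: 'p list \<Rightarrow>\<^sub>0 'k" and ?d = "\<lambda>x. der (\<lambda>y. basis [tri P x y]) b :: 'p list \<Rightarrow>\<^sub>0 'k"
      have b: "length b \<le> n" using u(3) Nil by simp
      have lm: "act (basis [x] * ?b) y = tri P x (act ?b y) - act (?d x) y" for x
        by (simp add: act_letter_mult)
      from u(2) show ?thesis
      proof (cases rule: env_rels_cases)
        case (add x z)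
        have "act (?d (x + z) - ?d x - ?d z) y = 0"
          using rels_add by (subst der_diff[symmetric])+ (auto intro!: der b simp: tri_add_left)
        then show ?thesis
          by (simp add: u(1) Nil basis_Nil add left_diff_distrib act_diff lm tri_add_left
              diff_eq_eq eq_diff_eq)
      next
        case (scale c x)
        have "act (?d (scal P c x) - pscale c (?d x)) y = 0"
          using rels_scale
          by (subst der_pscale[symmetric], subst der_diff[symmetric]) (auto intro!: der b simp: tri_scale_left)
        then show ?thesis
          by (simp add: u(1) Nil basis_Nil scale left_diff_distrib act_diff act_pscale lm pscale_mult_left
              tri_scale_left scale_right_diff_distrib)
      next
        case zero
        have "act (?d 0) y = 0" using rels_zero by (intro der b) simp
        moreover have "r = basis [0]" using zero by simp
        ultimately show ?thesis by (simp add: u(1) Nil basis_Nil lm)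
      next
        case (brk x z)
        \<comment> \<open>The associator axiom for the operators by which \<open>x\<close> and
          \<open>z\<close> act on letters, written with letters instead of elements of
          \<open>P\<close>. The corresponding sum in \<open>P\<close> is zero, so
          \<open>\<kappa> v\<close> is a combination of linearity relations.\<close>
        define \<kappa> :: "'p \<Rightarrow> 'p list \<Rightarrow>\<^sub>0 'k" where "\<kappa> v = basis [tri P (tri P x z) v] - basis [tri P (tri P z x) v]
          - (basis [tri P x (tri P z v)] - basis [tri P z (tri P x v)])
          + basis [tri P (brk P x z) v]" for v :: 'p
        have \<kappa>: "\<kappa> v \<in> rels" for v
        proof -
          let ?p = "tri P x (tri P z v)" and ?q = "tri P (tri P x z) v"
            and ?s = "tri P z (tri P x v)" and ?t = "tri P (tri P z x) v"
          have "\<kappa> v = (basis [(?p - ?q) - (?s - ?t)] - basis [?p - ?q] + basis [?s - ?t])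
            + (basis [?p - ?q] - basis [?p] + basis [?q]) - (basis [?s - ?t] - basis [?s] + basis [?t])"
            by (simp add: \<kappa>_def tri_associator)
          then show ?thesis using rels_diff by (simp only: pm.span_add pm.span_diff)
        qed
        have "der \<kappa> b = ?d (tri P x z) - ?d (tri P z x) - (D x (?d z) - D z (?d x)) + ?d (brk P x z)"
          unfolding \<kappa>_def der_add der_diff
          unfolding der_commutator[symmetric] der_diff[symmetric] by (simp only: der_diff der_commutator)
        then have "act (?d (tri P x z) - ?d (tri P z x) - (D x (?d z) - D z (?d x)) + ?d (brk P x z)) y = 0"
          using der[of \<kappa> b y, OF \<kappa> b] by simp
        then have key: "act (D x (?d z)) y = act (?d (tri P x z)) y - act (?d (tri P z x)) y
            + act (D z (?d x)) y + act (?d (brk P x z)) y"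
          by (simp add: act_add act_diff algebra_simps)
        have two: "act (basis [x] * basis [z] * ?b) y = tri P x (tri P z (act ?b y)) - tri P x (act (?d z) y)
            - (tri P (tri P x z) (act ?b y) - act (?d (tri P x z)) y) - (tri P z (act (?d x) y) - act (D z (?d x)) y)"
          for x z
          by (simp add: mult.assoc act_letter_mult Der_mult basis_Nil act_add tri_diff_right)
        \<comment> \<open>The mixed terms of \<open>two\<close> are symmetric in \<open>x\<close>
          and \<open>z\<close> and cancel in the commutator. Of the remaining terms, those that
          apply \<open>\<rhd>\<close> to \<open>act ?b y\<close> cancel by the associator axiom, the
          rest by \<open>key\<close>.\<close>
        have "act u y = act (basis [x] * basis [z] * ?b) y - act (basis [z] * basis [x] * ?b) y
            - act (basis [brk P x z] * ?b) y"
          by (simp only: u(1) Nil basis_Nil brk left_diff_distrib act_diff mult_1_left)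
        also have "\<dots> = 0"
          unfolding two lm tri_associator[of x z "act ?b y"] key by simp
        finally show ?thesis by simp
      qed
    qed
  qed simp
  then show ?case by simp
qed

lemma act_env_ideal: "u \<in> env_ideal P {0} \<Longrightarrow> act u y = 0"
  by (erule env_ideal_in_lt) (rule act_ideal_lt)

end

section \<open>The ideal of relations is a coideal\<close>

lemma unshuffle_left_commute:
  "unshuffle w (\<lambda>a b. unshuffle b (\<lambda>c d. \<phi> a c d)) = unshuffle w (\<lambda>a b. unshuffle b (\<lambda>c d. \<phi> c a d))"
proof -
  have "unshuffle w (\<lambda>a b. unshuffle b (\<lambda>c d. \<phi> a c d)) = unshuffle w (\<lambda>a b. unshuffle a (\<lambda>c d. \<phi> c d b))"
    by (rule unshuffle_assoc)
  also have "\<dots> = unshuffle w (\<lambda>a b. unshuffle a (\<lambda>c d. \<phi> d c b))"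
    by (subst unshuffle_commute[symmetric]) (rule refl)
  also have "\<dots> = unshuffle w (\<lambda>a b. unshuffle b (\<lambda>c d. \<phi> c a d))"
    by (rule unshuffle_assoc[symmetric])
  finally show ?thesis .
qed

lemma (in vector_space) lext_tens:
  "lext scale (\<lambda>(a, b). \<phi> a b) (tens A B) = lext scale (\<lambda>a. lext scale (\<phi> a) B) A"
  unfolding tens_def by (simp add: pm.linear_lext_comp[OF linear_lext])

lemma tens_1_1: "tens 1 1 = (1 :: _ \<Rightarrow>\<^sub>0 'k::field)"
proof -
  have "tens (basis 0) (basis 0) = (1 :: _ \<Rightarrow>\<^sub>0 'k)"
    unfolding tens_basis by (simp flip: single_one zero_prod_def)
  then show ?thesis by simp
qed

lemma tens_simps: "tens (A + A') B = tens A B + tens A' B" "tens A (B + B') = tens A B + tens A B'"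
    "tens (pscale c A) B = pscale c (tens A B)" "tens A (pscale c B) = pscale c (tens A B)"
    "tens (A - A') B = tens A B - tens A' B" "tens A (B - B') = tens A B - tens A B'"
    "tens 0 B = 0" "tens A 0 = 0"
proof -
  interpret l: Vector_Spaces.linear pscale pscale "\<lambda>A. tens A B" by (rule linear_tens_left)
  interpret r: Vector_Spaces.linear pscale pscale "tens A" by (rule linear_tens_right)
  show "tens (A + A') B = tens A B + tens A' B" "tens A (B + B') = tens A B + tens A B'"
    "tens (pscale c A) B = pscale c (tens A B)" "tens A (pscale c B) = pscale c (tens A B)"
    "tens (A - A') B = tens A B - tens A' B" "tens A (B - B') = tens A B - tens A B'"
    "tens 0 B = 0" "tens A 0 = 0"
    by (simp_all add: l.add r.add l.scale r.scale l.diff r.diff l.zero r.zero)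
qed

lemma coprod_simps: "coprod (A + B) = coprod A + coprod B" "coprod (A - B) = coprod A - coprod B"
    "coprod (pscale c A) = pscale c (coprod A)" "coprod 0 = 0"
  by (simp_all add: coprod_def pm.lext_add pm.lext_diff pm.lext_pscale)

text \<open>Letters are primitive, and primitive elements are closed under linear combinations and
  commutators: the mixed terms of a commutator are symmetric in the two letters and cancel.\<close>

lemma coprod_env_rels:
  fixes P :: "('k::field_char_0, 'p::ab_group_add) filtered_post_lie"
  assumes "r \<in> env_rels P N"
  shows "coprod r = tens r 1 + tens 1 r"
proof -
  from assms show ?thesis
  proof (cases rule: env_rels_cases)
    case (brk y z)
    have "coprod (basis [y] * basis [z]) = tens (basis [y] * basis [z]) 1 + tens (basis [y]) (basis [z])
        + tens (basis [z]) (basis [y]) + tens 1 (basis [y] * basis [z] :: 'p list \<Rightarrow>\<^sub>0 'k)" for y z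
      by (simp only: coprod_mult coprod_letter distrib_left distrib_right tens_mult mult_1_left mult_1_right)
        (simp only: ac_simps)
    then show ?thesis
      unfolding brk by (simp only: coprod_simps coprod_letter tens_simps) simp
  qed (simp_all add: coprod_simps coprod_letter tens_simps pm.scale_right_distrib)
qed

text \<open>The ideal is a coideal; this is tested with a linear map \<open>h\<close>, so that no span of tensors is needed.\<close>

lemma coprod_env_ideal:
  fixes P :: "('k::field_char_0, 'p::ab_group_add) filtered_post_lie"
  assumes u: "u \<in> env_ideal P N" and h: "Vector_Spaces.linear pscale s h"
    and S: "Modules.module.subspace s S"
    and I: "\<And>i t. i \<in> env_ideal P N \<Longrightarrow> h (tens i t) \<in> S" "\<And>i t. i \<in> env_ideal P N \<Longrightarrow> h (tens t i) \<in> S"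
  shows "h (coprod u) \<in> S"
proof (rule linear_in_span[OF linear_comp[OF linear_coprod h] u[unfolded env_ideal_def] S])
  fix v assume "v \<in> {a * r * b | a r b. r \<in> env_rels P N}"
  then obtain a r b where v: "v = a * r * b" "r \<in> env_rels P N" by blast
  \<comment> \<open>\<open>X\<close> and \<open>Y\<close> stand for the coproducts of
    \<open>a\<close> and \<open>b\<close>. By linearity they may be taken to be pure tensors;
    multiplied by these, a relation in one tensor factor gives an element of the ideal in that
    factor.\<close>
  have sandwich: "h (X * Z * Y) \<in> S" if Z: "\<And>p q p' q'. h (tens p q * Z * tens p' q') \<in> S" for X Y Z
  proof (rule linear_in_span[OF linear_comp[OF linear_mult_left h] span_range_basis S])
    fix y :: "'p list \<times> 'p list \<Rightarrow>\<^sub>0 'k" assume y: "y \<in> range basis"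
    show "h (X * Z * y) \<in> S"
    proof (rule linear_in_span[OF linear_comp[OF linear_comp[OF linear_mult_right linear_mult_right] h] span_range_basis S])
      fix x :: "'p list \<times> 'p list \<Rightarrow>\<^sub>0 'k" assume "x \<in> range basis"
      with y obtain p q p' q' where "x = tens (basis p) (basis q)" "y = tens (basis p') (basis q')"
        by (metis rangeE surj_pair tens_basis)
      then show "h (x * Z * y) \<in> S" using Z by (simp only:)
    qed
  qed
  have "h (X * tens r 1 * Y) \<in> S" "h (X * tens 1 r * Y) \<in> S" for X Y
    by (rule sandwich, simp only: tens_mult I[OF env_rels_in_ideal[OF v(2)]])+
  note lr = this
  interpret h: Vector_Spaces.linear pscale s h by fact
  have "h (coprod v) = h (coprod a * tens r 1 * coprod b) + h (coprod a * tens 1 r * coprod b)"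
    by (simp add: v(1) coprod_mult coprod_env_rels[OF v(2)] distrib_left distrib_right h.add)
  then show "h (coprod v) \<in> S" using lr S by (simp add: h.vs2.subspace_add)
qed

section \<open>Words acting on words, and \<open>*\<close>, as coalgebra maps\<close>

lemma word_tri_Cons: "word_tri tr w (y # v)
    = unshuffle w (\<lambda>a b. basis [word_act tr a y] * (word_tri tr b v :: _ \<Rightarrow>\<^sub>0 'k::field))"
  by (simp add: pm.lext_coprod_basis)

declare word_tri.simps(2) [simp del]

text \<open>The definition splits off one letter; coassociativity extends the rule to prefixes,
  which gives \<open>A \<rhd> (B \<bullet> C)\<close> for all words.\<close>

lemma word_tri_append: "word_tri tr w (u @ v)
    = unshuffle w (\<lambda>a b. word_tri tr a u * (word_tri tr b v :: _ \<Rightarrow>\<^sub>0 'k::field))"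
proof (induction u arbitrary: w)
  case Nil
  have "unshuffle w (\<lambda>a b. word_tri tr a [] * word_tri tr b v)
      = unshuffle w (\<lambda>a b. if a = [] then word_tri tr b v else 0 :: _ \<Rightarrow>\<^sub>0 'k)"
    by (rule unshuffle_cong) simp
  then show ?case by (simp only: unshuffle_counit_left append_Nil)
next
  case (Cons y u)
  show ?case
    by (simp add: word_tri_Cons Cons.IH unshuffle_linear[OF linear_mult_left]
        unshuffle_linear[OF linear_mult_right] unshuffle_assoc mult.assoc)
qed

lemma unshuffle_counit_right: "unshuffle w (\<lambda>a b. if b = [] then \<phi> a else 0) = \<phi> w"
  using unshuffle_counit_left[of w \<phi>] by (subst unshuffle_commute[symmetric])

lemma word_tri_letter: "word_tri tr w [y] = (basis [word_act tr w y] :: _ \<Rightarrow>\<^sub>0 'k::field)"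
proof -
  have "word_tri tr w [y] = unshuffle w (\<lambda>a b. if b = [] then (basis [word_act tr a y] :: _ \<Rightarrow>\<^sub>0 'k) else 0)"
    unfolding word_tri_Cons by (rule unshuffle_cong) simp
  then show ?thesis by (simp only: unshuffle_counit_right)
qed

text \<open>In the induction the new letter is primitive and goes to the left (\<open>X\<close>) or
  to the right (\<open>Y\<close>) tensor factor. In the second case cocommutativity brings the
  subword acting on that letter next to the one acting on the rest of the right factor.\<close>

lemma coprod_word_tri: "coprod (word_tri tr w v)
    = unshuffle w (\<lambda>a b. unshuffle v (\<lambda>c d. tens (word_tri tr a c) (word_tri tr b d :: _ \<Rightarrow>\<^sub>0 'k::field)))"
proof (induction v arbitrary: w)
  case Nil
  have "unshuffle w (\<lambda>a b. tens (word_tri tr a []) (word_tri tr b []))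
      = unshuffle w (\<lambda>a b. if a = [] then tens 1 (if b = [] then 1 else 0 :: _ \<Rightarrow>\<^sub>0 'k) else 0)"
    by (rule unshuffle_cong) (simp add: tens_simps)
  then show ?case
    by (simp only: unshuffle.simps unshuffle_counit_left) (simp add: coprod_1 tens_1_1 coprod_simps tens_simps)
next
  case (Cons y v)
  let ?L = "\<lambda>a. basis [word_act tr a y] :: _ \<Rightarrow>\<^sub>0 'k"
  define X where "X a c d = unshuffle v (\<lambda>e f. tens (?L a * word_tri tr c e) (word_tri tr d f))" for a c d
  define Y where "Y a c d = unshuffle v (\<lambda>e f. tens (word_tri tr c e) (?L a * word_tri tr d f))" for a c d
  have "coprod (word_tri tr w (y # v)) = unshuffle w (\<lambda>a b. unshuffle b (\<lambda>c d. X a c d + Y a c d))"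
    unfolding word_tri_Cons unshuffle_linear[OF linear_coprod] coprod_mult Cons.IH coprod_letter
      unshuffle_linear[OF linear_mult_left] X_def Y_def
    by (simp only: distrib_right tens_mult mult_1_left unshuffle_add)
  also have "\<dots> = unshuffle w (\<lambda>a b. unshuffle a (\<lambda>c d. X c d b)) + unshuffle w (\<lambda>a b. unshuffle b (\<lambda>c d. Y c a d))"
    unfolding unshuffle_add unshuffle_assoc[of w X] unshuffle_left_commute[of w Y] ..
  also have "\<dots> = unshuffle w (\<lambda>a b. unshuffle (y # v) (\<lambda>c d. tens (word_tri tr a c) (word_tri tr b d)))"
    unfolding X_def Y_def unshuffle.simps word_tri_Cons unshuffle_linear[OF linear_tens_left]
      unshuffle_linear[OF linear_tens_right] unshuffle_add
    by (subst (1 2) unshuffle_swap[of v]) (rule refl)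
  finally show ?case .
qed

definition word_star :: "('p \<Rightarrow> 'p \<Rightarrow> 'p::ab_group_add) \<Rightarrow> 'p list \<Rightarrow> 'p list \<Rightarrow> ('p list \<Rightarrow>\<^sub>0 'k::field)" where
  "word_star tr w v = unshuffle w (\<lambda>a b. basis a * word_tri tr b v)"

text \<open>Multiplication and action are both compatible with the coproduct. Each produces its own
  pair of pieces of \<open>w\<close>, and the interchange law sorts the four pieces by tensor
  factor.\<close>

lemma coprod_word_star: "coprod (word_star tr w v)
    = unshuffle w (\<lambda>a b. unshuffle v (\<lambda>c d. tens (word_star tr a c) (word_star tr b d :: _ \<Rightarrow>\<^sub>0 'k::field)))"
proof -
  have "coprod (word_star tr w v :: _ \<Rightarrow>\<^sub>0 'k) = unshuffle w (\<lambda>a b. unshuffle a (\<lambda>a1 a2. unshuffle b (\<lambda>b1 b2.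
      unshuffle v (\<lambda>c d. tens (basis a1 * word_tri tr b1 c) (basis a2 * word_tri tr b2 d)))))"
    unfolding word_star_def unshuffle_linear[OF linear_coprod] coprod_mult coprod_word_tri coprod_basis
      unshuffle_linear[OF linear_mult_right]
    unfolding unshuffle_linear[OF linear_mult_left] tens_basis[symmetric] tens_mult ..
  also have "\<dots> = unshuffle w (\<lambda>a b. unshuffle a (\<lambda>a1 a2. unshuffle b (\<lambda>b1 b2.
      unshuffle v (\<lambda>c d. tens (basis a1 * word_tri tr a2 c) (basis b1 * word_tri tr b2 d)))))"
    by (rule unshuffle_interchange)
  also have "\<dots> = unshuffle w (\<lambda>a b. unshuffle v (\<lambda>c d. tens (word_star tr a c) (word_star tr b d)))"
    unfolding word_star_def unshuffle_linear[OF linear_tens_left]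
    unfolding unshuffle_linear[OF linear_tens_right]
    by (rule unshuffle_cong, simp only: unshuffle_swap[where v = v])
  finally show ?thesis .
qed

lemma linear_env_tri_left: "Vector_Spaces.linear pscale pscale (\<lambda>A. env_tri P A B)"
  unfolding env_tri_def by (rule pm.linear_lext)

lemma linear_env_tri_right: "Vector_Spaces.linear pscale pscale (env_tri P A)"
  by (rule linearI)
    (simp_all add: env_tri_def pm.lext_add pm.lext_pscale pm.lext_add_fun pm.lext_scale_fun pm.vector_space_axioms)

lemma env_tri_basis: "env_tri P (basis w) (basis v) = word_tri (tri P) w v"
  by (simp add: env_tri_def)

lemma linear_env_star_left: "Vector_Spaces.linear pscale pscale (\<lambda>A. env_star P A B)"
  unfolding env_star_def by (rule pm.linear_lext_coprod)

lemma linear_env_star_right: "Vector_Spaces.linear pscale pscale (env_star P A)"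
proof (rule linearI)
  interpret l: Vector_Spaces.linear pscale pscale "env_tri P A" for A by (rule linear_env_tri_right)
  show "env_star P A (B + C) = env_star P A B + env_star P A C" for B C
    by (simp add: env_star_def l.add distrib_left split_def pm.lext_add_fun)
  show "env_star P A (pscale c B) = pscale c (env_star P A B)" for c B
    by (simp add: env_star_def l.scale pscale_mult_right split_def pm.lext_scale_fun)
qed (rule pm.vector_space_axioms)+

lemma env_star_basis: "env_star P (basis w) (basis v) = word_star (tri P) w v"
  by (simp add: env_star_def pm.lext_coprod_basis env_tri_basis word_star_def)

lemma counit_add: "counit (u + v) = counit u + counit v"
  and counit_pscale: "counit (pscale c u) = c * counit u"
  and counit_basis: "counit (basis w) = (if w = [] then 1 else 0)"
  by (simp_all add: counit_def lookup_add lookup_pscale lookup_single when_def)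

lemma linear_counit: "linear_form counit"
  by (rule linear_formI)
    (simp_all add: counit_add counit_pscale)

lemma counit_mult: "counit (u * v) = counit u * counit v"
proof (rule fld.bilinear_eq[where f = "\<lambda>u v. counit (u * v)" and g = "\<lambda>u v. counit u * counit v"])
  show "counit (basis a * basis b) = counit (basis a) * counit (basis b)" for a b
    unfolding basis_append[symmetric] by (simp add: counit_basis)
  show "linear_form (\<lambda>u. counit u * counit v)" for v
    by (rule linear_formI)
      (simp_all add: counit_add counit_pscale algebra_simps)
  show "linear_form (\<lambda>v. counit u * counit v)" for u
    by (rule linear_formI)
      (simp_all add: counit_add counit_pscale algebra_simps)
qed (rule linear_comp[OF linear_mult_left linear_counit] linear_comp[OF linear_mult_right linear_counit])+

lemma counit_env_ideal:
  fixes P :: "('k::field_char_0, 'p::ab_group_add) filtered_post_lie"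
  assumes u: "u \<in> env_ideal P N"
  shows "counit u = 0"
proof -
  interpret l: Vector_Spaces.linear pscale "(*)" "counit :: ('p list \<Rightarrow>\<^sub>0 'k) \<Rightarrow> 'k" by (rule linear_counit)
  have "counit u \<in> {0}"
  proof (rule linear_in_span[OF linear_counit u[unfolded env_ideal_def]])
    fix v assume "v \<in> {a * r * b | a r b. r \<in> env_rels P N}"
    then obtain a r b where v: "v = a * r * b" "r \<in> env_rels P N" by blast
    from v(2) have "counit r = 0" unfolding env_rels_def
      by (elim UnE CollectE exE conjE) (simp_all add: l.diff l.scale counit_basis counit_mult)
    then show "counit v \<in> {0}" by (simp add: v(1) counit_mult)
  qed simp
  then show ?thesis by simp
qed

section \<open>The action and \<open>*\<close> respect the relations\<close>

context complete_filtered_post_lie_algebra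
begin

text \<open>Transports linear combinations computed in \<open>P\<close> to the enveloping algebra;
  in the free algebra the letter of a sum is not the sum of the letters.\<close>

lemma letters_linear:
  "lext pscale (\<lambda>a. basis [f a]) u - basis [lext (scal P) f u] \<in> env_ideal P {0}"
proof -
  have "(\<Sum>x\<in>A. pscale (c x) (basis [f x])) - basis [\<Sum>x\<in>A. scal P (c x) (f x)] \<in> rels" if "finite A" for A c
    using that
  proof (induction A)
    case empty
    then show ?case using pm.span_neg[OF rels_zero] by simp
  next
    case (insert x A)
    let ?r = "\<Sum>x\<in>A. scal P (c x) (f x)"
    have "(\<Sum>x\<in>insert x A. pscale (c x) (basis [f x])) - basis [\<Sum>x\<in>insert x A. scal P (c x) (f x)]
      = ((\<Sum>x\<in>A. pscale (c x) (basis [f x])) - basis [?r])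
        - (basis [scal P (c x) (f x)] - pscale (c x) (basis [f x]))
        - (basis [scal P (c x) (f x) + ?r] - basis [scal P (c x) (f x)] - basis [?r])"
      using insert.hyps by simp
    then show ?case by (simp only: pm.span_diff insert.IH rels_add rels_scale)
  qed
  then show ?thesis unfolding lext_def by (intro rels_in_ideal) auto
qed

lemma unshuffle_letters_linear:
  "unshuffle w (\<lambda>a b. basis [f a b]) - basis [unshuffle w f] \<in> env_ideal P {0}"
  using letters_linear[of "\<lambda>(a, b). f a b" "coprod (basis w)"]
  by (simp add: split_def[symmetric] lext_coprod_basis) (simp add: split_def pm.lext_coprod_basis[symmetric])

lemma word_act_linear: "Vector_Spaces.linear (scal P) (scal P) (word_act (tri P) w)"
proof (rule linearI[OF scal_vector_space scal_vector_space])
  show "word_act (tri P) w (x + y) = word_act (tri P) w x + word_act (tri P) w y" for x y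
  \<comment> \<open>The induction is on the length, because the derivatives in the recursion change
    letters of the tail.\<close>
  proof (induction "length w" arbitrary: w)
    case (Suc n)
    then obtain z v where w: "w = z # v" "length v = n" by (cases w) auto
    have "wderiv (tri P z) v (\<lambda>w'. word_act (tri P) w' (x + y))
        = wderiv (tri P z) v (\<lambda>w'. word_act (tri P) w' x + word_act (tri P) w' y)"
      by (rule wderiv_cong) (simp add: Suc.hyps(1) w(2))
    then show ?case
      using Suc.hyps(1)[of v] by (simp add: w word_act_Cons tri_add_right wderiv_add)
  qed simp
  show "word_act (tri P) w (scal P c x) = scal P c (word_act (tri P) w x)" for c x
  proof (induction "length w" arbitrary: w)
    case (Suc n)
    then obtain z v where w: "w = z # v" "length v = n" by (cases w) auto
    have lin: "Vector_Spaces.linear (scal P) (scal P) (scal P c)"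
      by (rule linearI[OF scal_vector_space scal_vector_space]) (simp_all add: scale_right_distrib mult.commute)
    have "wderiv (tri P z) v (\<lambda>w'. word_act (tri P) w' (scal P c x))
        = wderiv (tri P z) v (\<lambda>w'. scal P c (word_act (tri P) w' x))"
      by (rule wderiv_cong) (simp add: Suc.hyps(1) w(2))
    then show ?case
      using Suc.hyps(1)[of v]
      by (simp add: w word_act_Cons tri_scale_right wderiv_linear[OF lin, symmetric] scale_right_diff_distrib)
  qed simp
qed

text \<open>A letter acts on brackets as a derivation. The derivatives subtracted in the recursion
  distribute over the two subwords by \<open>unshuffle_wderiv\<close>, so they match the corrections
  in the actions on \<open>y\<close> and on \<open>z\<close>.\<close>

lemma word_act_brk:
  "word_act (tri P) w (brk P y z) = unshuffle w (\<lambda>a b. brk P (word_act (tri P) a y) (word_act (tri P) b z))"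
proof (induction "length w" arbitrary: w)
  case (Suc n)
  then obtain x v where w: "w = x # v" "length v = n" by (cases w) auto
  let ?W = "word_act (tri P)"
  have linl: "Vector_Spaces.linear (scal P) (scal P) (\<lambda>u. brk P u z)"
    and linr: "Vector_Spaces.linear (scal P) (scal P) (brk P z)" for z
    by (rule linearI[OF scal_vector_space scal_vector_space]; simp add: brk_add_left brk_scale_left brk_add_right brk_scale_right)+
  have lint: "Vector_Spaces.linear (scal P) (scal P) (tri P x)"
    by (rule linearI[OF scal_vector_space scal_vector_space]; simp add: tri_add_right tri_scale_right)
  have "wderiv (tri P x) v (\<lambda>w'. ?W w' (brk P y z))
      = wderiv (tri P x) v (\<lambda>w'. unshuffle w' (\<lambda>a b. brk P (?W a y) (?W b z)))"
    by (rule wderiv_cong) (simp add: Suc.hyps(1) w(2))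
  moreover have "?W v (brk P y z) = unshuffle v (\<lambda>a b. brk P (?W a y) (?W b z))"
    using Suc.hyps(1) w(2) by simp
  ultimately show ?case
    unfolding w word_act_Cons unshuffle_wderiv unshuffle.simps
    by (simp add: unshuffle_linear[OF lint] tri_derivation brk_diff_left brk_diff_right
        unshuffle_add unshuffle_diff wderiv_linear[OF linl] wderiv_linear[OF linr])
qed simp

text \<open>For the commutator relation, cocommutativity indexes both products of letters by the
  same splittings of \<open>w\<close>, so that each summand is a commutator relation. The brackets
  are then collected into one letter by \<open>word_act_brk\<close> and the linearity of
  letters.\<close>

lemma word_tri_env_rels:
  assumes "r \<in> env_rels P {0}"
  shows "env_tri P (basis w) r \<in> env_ideal P {0}"
proof -
  interpret t: Vector_Spaces.linear pscale pscale "env_tri P (basis w)" by (rule linear_env_tri_right)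
  interpret W: Vector_Spaces.linear "scal P" "scal P" "word_act (tri P) w" by (rule word_act_linear)
  let ?W = "word_act (tri P)"
  from assms show ?thesis
  proof (cases rule: env_rels_cases)
    case add
    then show ?thesis
      using rels_in_ideal[OF rels_add] by (simp add: t.diff env_tri_basis word_tri_letter W.add)
  next
    case scale
    then show ?thesis
      using rels_in_ideal[OF rels_scale] by (simp add: t.diff t.scale env_tri_basis word_tri_letter W.scale)
  next
    case zero
    then show ?thesis
      using rels_in_ideal[OF rels_zero] by (simp add: env_tri_basis word_tri_letter W.zero)
  next
    case (brk y z)
    have two: "env_tri P (basis w) (basis [y] * basis [z])
        = unshuffle w (\<lambda>a b. basis [?W a y] * basis [?W b z])" for y z
      using word_tri_append[of "tri P" w "[y]" "[z]"]
      by (simp add: env_tri_basis word_tri_letter flip: basis_append)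
    have "env_tri P (basis w) (basis [z] * basis [y])
        = unshuffle w (\<lambda>a b. basis [?W b z] * basis [?W a y])"
      unfolding two by (rule unshuffle_commute)
    then have "env_tri P (basis w) r = unshuffle w (\<lambda>a b. basis [?W a y] * basis [?W b z]
          - basis [?W b z] * basis [?W a y] - basis [brk P (?W a y) (?W b z)])
        + (unshuffle w (\<lambda>a b. basis [brk P (?W a y) (?W b z)])
          - basis [unshuffle w (\<lambda>a b. brk P (?W a y) (?W b z))])"
      by (simp add: brk t.diff two env_tri_basis[of P w "[brk P y z]"] word_tri_letter word_act_brk unshuffle_diff)
    moreover have "unshuffle w (\<lambda>a b. basis [?W a y] * basis [?W b z]
          - basis [?W b z] * basis [?W a y] - basis [brk P (?W a y) (?W b z)]) \<in> env_ideal P {0}"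
      by (rule pm.unshuffle_in_subspace) (auto intro: rels_in_ideal rels_brk)
    ultimately show ?thesis
      using unshuffle_letters_linear[of w "\<lambda>a b. brk P (?W a y) (?W b z)"]
      by (simp add: pm.subspace_add)
  qed
qed

lemma env_tri_ideal_right:
  assumes "B \<in> env_ideal P {0}"
  shows "env_tri P A B \<in> env_ideal P {0}"
proof (rule linear_in_span[OF linear_env_tri_left span_range_basis])
  fix v :: "'p list \<Rightarrow>\<^sub>0 'k" assume "v \<in> range basis"
  then obtain w where v: "v = basis w" by blast
  have "B \<in> pspan {basis a * r * basis b | a r b. r \<in> env_rels P {0}}"
    using env_ideal_in_lt[OF assms] pm.span_mono[of "{basis a * r * basis b | a r b. r \<in> env_rels P {0} \<and> length a + length b < _}" "{basis a * r * basis b | a r b. r \<in> env_rels P {0}}"]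
    unfolding env_ideal_lt_def by (smt (verit, best) Collect_mono in_mono)
  then show "env_tri P v B \<in> env_ideal P {0}" unfolding v
  proof (rule linear_in_span[OF linear_env_tri_right])
    fix s assume "s \<in> {basis a * r * basis b | a r b. r \<in> env_rels P {0}}"
    then obtain a r b where s: "s = basis a * r * basis b" "r \<in> env_rels P {0}" by blast
    \<comment> \<open>The product rule used twice: \<open>w\<close> is distributed over the left
      flank, \<open>u\<close> and the right flank.\<close>
    let ?E = "\<lambda>u. unshuffle w (\<lambda>p q. unshuffle p (\<lambda>p1 p2.
        env_tri P (basis p1) (basis a) * env_tri P (basis p2) u * env_tri P (basis q) (basis b)))"
    have "env_tri P (basis w) (basis a * u * basis b) = ?E u" for u
    proof (rule pm.linear_eq_on_basis[where t = u and f = "\<lambda>u. env_tri P (basis w) (basis a * u * basis b)" and g = ?E])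
      show "Vector_Spaces.linear pscale pscale (\<lambda>u. env_tri P (basis w) (basis a * u * basis b))"
        by (rule linear_comp[OF linear_comp[OF linear_mult_left linear_mult_right] linear_env_tri_right])
      show "Vector_Spaces.linear pscale pscale ?E"
      proof (rule linearI)
        interpret t: Vector_Spaces.linear pscale pscale "env_tri P A" for A by (rule linear_env_tri_right)
        show "?E (u + v) = ?E u + ?E v" for u v
          by (simp add: t.add distrib_left distrib_right unshuffle_add)
        show "?E (pscale c u) = pscale c (?E u)" for c u
          by (simp add: t.scale pscale_mult_left pscale_mult_right
              unshuffle_linear[OF pm.linear_scale_self, symmetric])
      qed (rule pm.vector_space_axioms)+
      show "env_tri P (basis w) (basis a * basis v * basis b) = ?E (basis v)" for v
        unfolding basis_append[symmetric] env_tri_basis word_tri_append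
        by (simp add: unshuffle_linear[OF linear_mult_right])
    qed
    then show "env_tri P (basis w) s \<in> env_ideal P {0}"
      unfolding s
      by (simp only:) (intro pm.unshuffle_in_subspace subspace_env_ideal env_ideal_mult_right env_ideal_mult_left
          word_tri_env_rels s(2))
  qed simp
qed simp

text \<open>Induction on the word acted on. Its first letter \<open>y\<close> and its tail are acted
  on by the two factors of the coproduct, and as the ideal is a coideal, one factor may be taken in
  the ideal: on \<open>y\<close> it acts as zero by \<open>act_env_ideal\<close>, on the tail the
  induction hypothesis applies.\<close>

lemma env_tri_ideal_left:
  assumes "A \<in> env_ideal P {0}"
  shows "env_tri P A B \<in> env_ideal P {0}"
proof (rule linear_in_span[OF linear_env_tri_right span_range_basis])
  have "env_tri P A (basis v) \<in> env_ideal P {0}" if "A \<in> env_ideal P {0}" for v A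
    using that
  proof (induction v arbitrary: A)
    case Nil
    have "env_tri P A (basis []) = pscale (counit A) 1" for A
    proof (rule pm.linear_eq_on_basis[OF linear_env_tri_left])
      show "Vector_Spaces.linear pscale pscale (\<lambda>A :: 'p list \<Rightarrow>\<^sub>0 'k. pscale (counit A) (1 :: 'p list \<Rightarrow>\<^sub>0 'k))"
        by (rule linearI) (simp_all add: counit_def lookup_add lookup_pscale pm.scale_left_distrib
            pm.vector_space_axioms)
      show "env_tri P (basis w) (basis []) = pscale (counit (basis w)) 1" for w
        by (simp add: env_tri_basis counit_def lookup_single when_def)
    qed
    then show ?case using Nil by (simp add: counit_env_ideal pm.subspace_0)
  next
    case (Cons y v)
    let ?h = "lext pscale (\<lambda>(a, b). basis [word_act (tri P) a y] * word_tri (tri P) b v)"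
    have split: "?h (tens i t) = lext pscale (\<lambda>a. basis [word_act (tri P) a y]) i * env_tri P t (basis v)"
      for i t :: "'p list \<Rightarrow>\<^sub>0 'k"
    proof -
      have "lext pscale (\<lambda>a. lext pscale (\<lambda>b. basis [word_act (tri P) a y] * word_tri (tri P) b v) t) i
        = lext pscale (\<lambda>a. basis [word_act (tri P) a y] * env_tri P t (basis v)) i"
        by (simp add: env_tri_def pm.linear_lext_comp[OF linear_mult_left])
      then show ?thesis
        by (simp add: pm.lext_tens pm.linear_lext_comp[OF linear_mult_right])
    qed
    have "?h (coprod A) \<in> env_ideal P {0}"
    proof (rule coprod_env_ideal[OF Cons.prems pm.linear_lext])
      fix i t :: "'p list \<Rightarrow>\<^sub>0 'k" assume i: "i \<in> env_ideal P {0}"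
      \<comment> \<open>The action in \<open>P\<close> is zero, so the combination of letters is
        congruent to the letter \<open>[0]\<close>, itself a relation.\<close>
      have "lext pscale (\<lambda>a. basis [word_act (tri P) a y]) i - basis [0] \<in> env_ideal P {0}"
        using letters_linear[of "\<lambda>a. word_act (tri P) a y" i] act_env_ideal[OF i, of y]
        by (simp add: act_def)
      then have "lext pscale (\<lambda>a. basis [word_act (tri P) a y]) i \<in> env_ideal P {0}"
        using rels_in_ideal[OF rels_zero] pm.subspace_add[OF subspace_env_ideal] by fastforce
      then show "?h (tens i t) \<in> env_ideal P {0}"
        unfolding split by (rule env_ideal_mult_right)
      show "?h (tens t i) \<in> env_ideal P {0}"
        unfolding split using Cons.IH[OF i] by (rule env_ideal_mult_left)
    qed simp
    moreover have "env_tri P A (basis (y # v)) = ?h (coprod A)"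
      by (rule pm.linear_eq_on_basis[OF linear_env_tri_left pm.linear_lext_coprod])
        (simp add: env_tri_basis word_tri_Cons pm.lext_coprod_basis)
    ultimately show ?case by simp
  qed
  then show "env_tri P A b \<in> env_ideal P {0}" if "b \<in> range basis" for b
    using assms that by auto
qed simp

lemma env_star_ideal_left:
  assumes "A \<in> env_ideal P {0}"
  shows "env_star P A B \<in> env_ideal P {0}"
  unfolding env_star_def
proof (rule coprod_env_ideal[OF assms pm.linear_lext])
  have split: "lext pscale (\<lambda>(a, b). basis a * env_tri P (basis b) B) (tens i t) = i * env_tri P t B"
    for i t :: "'p list \<Rightarrow>\<^sub>0 'k"
  proof -
    have 1: "lext pscale (\<lambda>b. basis a * env_tri P (basis b) B) t = basis a * env_tri P t B" for a
      by (rule pm.linear_eq_on_basis[OF pm.linear_lext linear_comp[OF linear_env_tri_left linear_mult_left]]) simp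
    show ?thesis
      unfolding pm.lext_tens 1 by (rule pm.linear_eq_on_basis[OF pm.linear_lext linear_mult_right]) simp
  qed
  fix i t :: "'p list \<Rightarrow>\<^sub>0 'k" assume i: "i \<in> env_ideal P {0}"
  show "lext pscale (\<lambda>(a, b). basis a * env_tri P (basis b) B) (tens i t) \<in> env_ideal P {0}"
    unfolding split using i by (rule env_ideal_mult_right)
  show "lext pscale (\<lambda>(a, b). basis a * env_tri P (basis b) B) (tens t i) \<in> env_ideal P {0}"
    unfolding split by (intro env_ideal_mult_left env_tri_ideal_left i)
qed simp

lemma env_star_ideal_right:
  assumes "B \<in> env_ideal P {0}"
  shows "env_star P A B \<in> env_ideal P {0}"
  unfolding env_star_def
  by (rule pm.lext_in_subspace) (auto intro: env_ideal_mult_left env_tri_ideal_right assms)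

subsection \<open>The filtration\<close>

lemma Fil_mono: "p \<le> q \<Longrightarrow> 1 \<le> p \<Longrightarrow> Fil P q \<subseteq> Fil P p"
proof (induction q rule: dec_induct[consumes 1])
  case (step n)
  then show ?case using Fil_decreasing[of n] by auto
qed simp

text \<open>The condition on words in \<open>env_fil\<close>, isolated so that it can be unfolded
  letter by letter.\<close>

definition weight_ge :: "'p list \<Rightarrow> nat \<Rightarrow> bool" where
  "weight_ge w m \<longleftrightarrow> (\<exists>ks. list_all2 (\<lambda>x i. 1 \<le> i \<and> x \<in> Fil P i) w ks \<and> m \<le> sum_list ks)"

lemma weight_ge_Nil [simp]: "weight_ge [] m \<longleftrightarrow> m = 0"
  by (simp add: weight_ge_def)

lemma weight_ge_Cons:
  "weight_ge (x # w) m \<longleftrightarrow> (\<exists>i n. 1 \<le> i \<and> x \<in> Fil P i \<and> weight_ge w n \<and> m \<le> i + n)"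
proof
  assume "weight_ge (x # w) m"
  then obtain i ks where i: "1 \<le> i" "x \<in> Fil P i" "list_all2 (\<lambda>x i. 1 \<le> i \<and> x \<in> Fil P i) w ks"
      "m \<le> i + sum_list ks"
    unfolding weight_ge_def list_all2_Cons1 by auto
  then have "weight_ge w (sum_list ks)" unfolding weight_ge_def by blast
  with i show "\<exists>i n. 1 \<le> i \<and> x \<in> Fil P i \<and> weight_ge w n \<and> m \<le> i + n" by blast
next
  assume "\<exists>i n. 1 \<le> i \<and> x \<in> Fil P i \<and> weight_ge w n \<and> m \<le> i + n"
  then obtain i n ks where i: "1 \<le> i" "x \<in> Fil P i" "list_all2 (\<lambda>x i. 1 \<le> i \<and> x \<in> Fil P i) w ks"
      "n \<le> sum_list ks" "m \<le> i + n"
    unfolding weight_ge_def by blast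
  then show "weight_ge (x # w) m"
    unfolding weight_ge_def by (intro exI[of _ "i # ks"]) simp
qed

lemma weight_ge_mono: "weight_ge w m \<Longrightarrow> n \<le> m \<Longrightarrow> weight_ge w n"
  unfolding weight_ge_def using order_trans by blast

lemma weight_ge_append: "weight_ge u m \<Longrightarrow> weight_ge v n \<Longrightarrow> weight_ge (u @ v) (m + n)"
  unfolding weight_ge_def
proof (elim exE conjE)
  fix ks js assume "list_all2 (\<lambda>x i. 1 \<le> i \<and> x \<in> Fil P i) u ks" "m \<le> sum_list ks"
    "list_all2 (\<lambda>x i. 1 \<le> i \<and> x \<in> Fil P i) v js" "n \<le> sum_list js"
  then show "\<exists>ks. list_all2 (\<lambda>x i. 1 \<le> i \<and> x \<in> Fil P i) (u @ v) ks \<and> m + n \<le> sum_list ks"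
    by (intro exI[of _ "ks @ js"]) (simp add: list_all2_appendI)
qed

lemma weight_ge_length: "weight_ge w (length w)"
proof (induction w)
  case (Cons x w)
  then show ?case unfolding weight_ge_Cons using Fil_1 by (intro exI[of _ 1] exI[of _ "length w"]) auto
qed simp

lemma wderiv_weight:
  assumes "weight_ge w n" "1 \<le> i" "x \<in> Fil P i" "Modules.module.subspace s S" "vector_space s"
    and "\<And>w'. weight_ge w' (i + n) \<Longrightarrow> \<phi> w' \<in> S"
  shows "wderiv (tri P x) w \<phi> \<in> S"
  using assms(1,6)
proof (induction w arbitrary: n \<phi>)
  interpret s: vector_space s by fact
  case Nil then show ?case using assms(4) by (simp add: s.subspace_0)
next
  interpret s: vector_space s by fact
  case (Cons y w)
  then obtain j n' where j: "1 \<le> j" "y \<in> Fil P j" "weight_ge w n'" "n \<le> j + n'"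
    unfolding weight_ge_Cons by blast
  have "tri P x y \<in> Fil P (i + j)" using Fil_tri assms(2,3) j by blast
  then have "weight_ge (tri P x y # w) (i + n)"
    unfolding weight_ge_Cons using assms(2) j by (intro exI[of _ "i + j"] exI[of _ n']) auto
  moreover have "weight_ge (y # w') (i + n)" if "weight_ge w' (i + n')" for w'
    unfolding weight_ge_Cons using that j by (intro exI[of _ j] exI[of _ "i + n'"]) auto
  ultimately show ?case
    using Cons.IH[OF j(3), of "\<lambda>w'. \<phi> (y # w')"] Cons.prems(2) assms(4) by (simp add: s.subspace_add)
qed

lemma unshuffle_weight:
  assumes "weight_ge w m" "Modules.module.subspace s S" "vector_space s"
    and "\<And>a b i j. weight_ge a i \<Longrightarrow> weight_ge b j \<Longrightarrow> m \<le> i + j \<Longrightarrow> \<phi> a b \<in> S"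
  shows "unshuffle w \<phi> \<in> S"
  using assms(1,4)
proof (induction w arbitrary: m \<phi>)
  case Nil then show ?case by auto
next
  interpret s: vector_space s by fact
  case (Cons x w)
  then obtain k n where k: "1 \<le> k" "x \<in> Fil P k" "weight_ge w n" "m \<le> k + n"
    unfolding weight_ge_Cons by blast
  have *: "weight_ge (x # a) (k + i)" if "weight_ge a i" for a i
    unfolding weight_ge_Cons using k that by blast
  have "\<phi> (x # a) b \<in> S" "\<phi> a (x # b) \<in> S" if "weight_ge a i" "weight_ge b j" "n \<le> i + j" for a b i j
    using Cons.prems(2)[OF *[OF that(1)] that(2)] Cons.prems(2)[OF that(1) *[OF that(2)]] that(3) k(4)
    by auto
  then show ?case
    using Cons.IH[OF k(3), of "\<lambda>a b. \<phi> (x # a) b"] Cons.IH[OF k(3), of "\<lambda>a b. \<phi> a (x # b)"] assms(2)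
    by (simp add: s.subspace_add)
qed

lemma word_act_weight:
  assumes "weight_ge w m" "1 \<le> q" "y \<in> Fil P q"
  shows "word_act (tri P) w y \<in> Fil P (m + q)"
  using assms(1)
proof (induction "length w" arbitrary: w m)
  case 0
  then show ?case using assms(3) by simp
next
  case (Suc l)
  then obtain x v where w: "w = x # v" "length v = l" by (cases w) auto
  obtain i n where i: "1 \<le> i" "x \<in> Fil P i" "weight_ge v n" "m \<le> i + n"
    using Suc.prems unfolding w weight_ge_Cons by blast
  have sub: "subspace (Fil P (i + n + q))" using assms(2) by (intro Fil_subspace) simp
  have "word_act (tri P) v y \<in> Fil P (n + q)" using Suc.hyps(1) w(2) i(3) by blast
  then have "tri P x (word_act (tri P) v y) \<in> Fil P (i + n + q)"
    using Fil_tri[of i "n + q" x] i assms(2) by (simp add: add.assoc)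
  moreover have "wderiv (tri P x) v (\<lambda>w'. word_act (tri P) w' y) \<in> Fil P (i + n + q)"
  proof -
    let ?S = "Fil P (i + n + q)"
    \<comment> \<open>\<open>wderiv_weight\<close> asks about all words of the given weight, while
      the induction hypothesis covers only length \<open>l\<close>. The default value 0 elsewhere
      does no harm, as derivatives preserve the length.\<close>
    have "wderiv (tri P x) v (\<lambda>w'. if length w' = l then word_act (tri P) w' y else 0) \<in> ?S"
      by (rule wderiv_weight[OF i(3,1,2) sub scal_vector_space]) (use Suc.hyps(1) sub subspace_0 in auto)
    moreover have "wderiv (tri P x) v (\<lambda>w'. if length w' = l then word_act (tri P) w' y else 0)
      = wderiv (tri P x) v (\<lambda>w'. word_act (tri P) w' y)"
      by (rule wderiv_cong) (simp add: w(2))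
    ultimately show ?thesis by simp
  qed
  ultimately have "word_act (tri P) w y \<in> Fil P (i + n + q)"
    unfolding w word_act_Cons using sub by (intro subspace_diff)
  moreover have "Fil P (i + n + q) \<subseteq> Fil P (m + q)" using i(4) assms(2) by (intro Fil_mono) linarith+
  ultimately show ?case by blast
qed

abbreviation fil :: "nat \<Rightarrow> ('p list \<Rightarrow>\<^sub>0 'k) set" where
  "fil m \<equiv> env_fil P {0} m"

lemma fil_def: "fil m = pspan (env_ideal P {0} \<union> {basis w | w. weight_ge w m})"
  by (simp add: env_fil_def weight_ge_def)

lemma subspace_fil [simp]: "pm.subspace (fil m)"
  by (simp add: fil_def)

lemma env_ideal_fil: "u \<in> env_ideal P {0} \<Longrightarrow> u \<in> fil m"
  unfolding fil_def by (rule pm.span_base) simp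

lemma word_fil: "weight_ge w m \<Longrightarrow> basis w \<in> fil m"
  unfolding fil_def by (rule pm.span_base) auto

lemma fil_induct:
  assumes "u \<in> fil m" "Vector_Spaces.linear pscale s h" "Modules.module.subspace s S"
    and "\<And>i. i \<in> env_ideal P {0} \<Longrightarrow> h i \<in> S" "\<And>w. weight_ge w m \<Longrightarrow> h (basis w) \<in> S"
  shows "h u \<in> S"
  by (rule linear_in_span[OF assms(2) assms(1)[unfolded fil_def] assms(3)]) (use assms(4,5) in auto)

lemma fil_mono: "m \<le> n \<Longrightarrow> fil n \<subseteq> fil m"
  unfolding fil_def by (intro pm.span_mono) (auto intro: weight_ge_mono)

lemma fil_0: "u \<in> fil 0"
  by (rule in_subspace_if_basis_in) (auto intro: word_fil weight_ge_mono[OF weight_ge_length])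

lemma fil_bilinear:
  assumes "A \<in> fil m" "B \<in> fil n"
    and "\<And>B. Vector_Spaces.linear pscale pscale (\<lambda>A. f A B)" "\<And>A. Vector_Spaces.linear pscale pscale (f A)"
    and "\<And>i B. i \<in> env_ideal P {0} \<Longrightarrow> f i B \<in> env_ideal P {0}"
    and "\<And>i A. i \<in> env_ideal P {0} \<Longrightarrow> f A i \<in> env_ideal P {0}"
    and "\<And>u v. weight_ge u m \<Longrightarrow> weight_ge v n \<Longrightarrow> f (basis u) (basis v) \<in> fil (m + n)"
  shows "f A B \<in> fil (m + n)"
proof (rule fil_induct[OF assms(1,3) subspace_fil])
  show "f i B \<in> fil (m + n)" if "i \<in> env_ideal P {0}" for i
    using that by (intro env_ideal_fil assms(5))
  show "f (basis u) B \<in> fil (m + n)" if u: "weight_ge u m" for u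
    by (rule fil_induct[OF assms(2,4) subspace_fil]) (auto intro: env_ideal_fil assms(6,7) u)
qed

lemma fil_mult: "A \<in> fil m \<Longrightarrow> B \<in> fil n \<Longrightarrow> A * B \<in> fil (m + n)"
  by (erule fil_bilinear)
    (auto intro: linear_mult_left linear_mult_right env_ideal_mult_left env_ideal_mult_right word_fil
      weight_ge_append simp flip: basis_append)

lemma fil_mult_left: "A \<in> fil m \<Longrightarrow> B * A \<in> fil m" and fil_mult_right: "A \<in> fil m \<Longrightarrow> A * B \<in> fil m"
  using fil_mult[of B 0 A m] fil_mult[of A m B 0] fil_0 by auto

lemma word_tri_weight: "weight_ge w m \<Longrightarrow> weight_ge v n \<Longrightarrow> word_tri (tri P) w v \<in> fil (m + n)"
proof (induction v arbitrary: w m n)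
  case Nil
  then show ?case by (auto simp: pm.subspace_0 fil_0)
next
  case (Cons y v)
  obtain j n' where j: "1 \<le> j" "y \<in> Fil P j" "weight_ge v n'" "n \<le> j + n'"
    using Cons.prems(2) unfolding weight_ge_Cons by blast
  show ?case
    unfolding word_tri_Cons
  proof (rule unshuffle_weight[OF Cons.prems(1) subspace_fil pm.vector_space_axioms])
    fix a b i k assume a: "weight_ge a i" "weight_ge b k" "m \<le> i + k"
    have "weight_ge [word_act (tri P) a y] (i + j)"
      unfolding weight_ge_Cons using word_act_weight[OF a(1) j(1,2)] j(1)
      by (intro exI[of _ "i + j"] exI[of _ 0]) auto
    then have "basis [word_act (tri P) a y] * word_tri (tri P) b v \<in> fil ((i + j) + (k + n'))"
      by (intro fil_mult word_fil Cons.IH a j)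
    then show "basis [word_act (tri P) a y] * word_tri (tri P) b v \<in> fil (m + n)"
      using fil_mono[of "m + n" "i + j + (k + n')"] a(3) j(4) by auto
  qed
qed

lemma fil_star: "A \<in> fil m \<Longrightarrow> B \<in> fil n \<Longrightarrow> env_star P A B \<in> fil (m + n)"
proof (erule fil_bilinear, assumption)
  fix u v assume u: "weight_ge u m" and v: "weight_ge v n"
  show "env_star P (basis u) (basis v) \<in> fil (m + n)"
    unfolding env_star_basis word_star_def
  proof (rule unshuffle_weight[OF u subspace_fil pm.vector_space_axioms])
    fix a b i k assume a: "weight_ge a i" "weight_ge b k" "m \<le> i + k"
    have "basis a * word_tri (tri P) b v \<in> fil (i + (k + n))"
      by (intro fil_mult word_fil word_tri_weight a v)
    then show "basis a * word_tri (tri P) b v \<in> fil (m + n)"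
      using fil_mono[of "m + n" "i + (k + n)"] a(3) by auto
  qed
qed (auto intro: linear_env_star_left linear_env_star_right env_star_ideal_left env_star_ideal_right)

end

section \<open>Cosets and tensor products\<close>

lemma coset_eq_iff:
  assumes "pm.subspace N"
  shows "t +o N = t' +o N \<longleftrightarrow> t - t' \<in> N"
proof
  assume "t +o N = t' +o N"
  moreover have "t \<in> t +o N" using pm.subspace_0[OF assms] by (force simp: elt_set_plus_def)
  ultimately show "t - t' \<in> N" by (auto simp: elt_set_plus_def)
next
  assume *: "t - t' \<in> N"
  have sub: "x +o N \<subseteq> y +o N" if "x - y \<in> N" for x y
  proof
    fix z assume "z \<in> x +o N"
    then obtain n where n: "n \<in> N" "z = x + n" by (auto simp: elt_set_plus_def)
    then have "(x - y) + n \<in> N" using that assms by (simp add: pm.subspace_add)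
    then show "z \<in> y +o N"
      unfolding elt_set_plus_def by (intro CollectI bexI[of _ "(x - y) + n"]) (simp_all add: n)
  qed
  show "t +o N = t' +o N"
    using sub[OF *] sub[of t' t] pm.subspace_neg[OF assms *] by simp
qed

lemma rep_coset_diff:
  assumes "pm.subspace N"
  shows "rep (t +o N) - t \<in> N"
proof -
  have "t \<in> t +o N" using pm.subspace_0[OF assms] by (force simp: elt_set_plus_def)
  then have "rep (t +o N) \<in> t +o N" unfolding rep_def by (rule someI)
  then show ?thesis by (auto simp: elt_set_plus_def)
qed

lemma rep_coset:
  assumes "pm.subspace N"
  shows "rep (t +o N) +o N = t +o N"
  using rep_coset_diff[OF assms] by (simp add: coset_eq_iff[OF assms])

text \<open>Closure under the operations keeps the generators of \<open>tensor_rel\<close> supported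
  on pairs of elements of the carriers.\<close>

definition closed_module :: "('k::field, 'v) module \<Rightarrow> bool" where
  "closed_module V \<longleftrightarrow> (\<forall>x\<in>carrier V. \<forall>y\<in>carrier V. x \<oplus>\<^bsub>V\<^esub> y \<in> carrier V) \<and>
     (\<forall>c. \<forall>x\<in>carrier V. c \<odot>\<^bsub>V\<^esub> x \<in> carrier V)"

lemma subspace_tensor_rel [simp]: "pm.subspace (tensor_rel V W)"
  by (simp add: tensor_rel_def)

text \<open>Consequently any representative that \<open>rep\<close> picks from a tensor over the
  carriers is supported there as well.\<close>

lemma tensor_rel_keys:
  assumes "closed_module V" "closed_module W" "r \<in> tensor_rel V W"
  shows "Poly_Mapping.keys r \<subseteq> carrier V \<times> carrier W"
proof -
  have "r \<in> {t. Poly_Mapping.keys t \<subseteq> carrier V \<times> carrier W}"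
  proof (rule subsetD[OF pm.span_minimal assms(3)[unfolded tensor_rel_def]])
    have b: "basis x \<in> {t. Poly_Mapping.keys t \<subseteq> carrier V \<times> carrier W}" if "x \<in> carrier V \<times> carrier W" for x
      using that by auto
    note sub = subspace_keys[of "carrier V \<times> carrier W"]
    show "{basis (v \<oplus>\<^bsub>V\<^esub> v', w) - basis (v, w) - basis (v', w) | v v' w.
        v \<in> carrier V \<and> v' \<in> carrier V \<and> w \<in> carrier W} \<union>
     {basis (v, w \<oplus>\<^bsub>W\<^esub> w') - basis (v, w) - basis (v, w') | v w w'.
        v \<in> carrier V \<and> w \<in> carrier W \<and> w' \<in> carrier W} \<union>
     {basis (c \<odot>\<^bsub>V\<^esub> v, w) - pscale c (basis (v, w)) | c v w.
        v \<in> carrier V \<and> w \<in> carrier W} \<union>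
     {basis (v, c \<odot>\<^bsub>W\<^esub> w) - pscale c (basis (v, w)) | c v w.
        v \<in> carrier V \<and> w \<in> carrier W} \<subseteq> {t. Poly_Mapping.keys t \<subseteq> carrier V \<times> carrier W}"
      using assms(1,2) unfolding closed_module_def
      by (intro Un_least subsetI; elim CollectE exE conjE; simp only:)
        (intro pm.subspace_diff[OF sub] pm.subspace_scale[OF sub] b; simp)+
  qed (rule subspace_keys)
  then show ?thesis by simp
qed

lemma tensor_rep:
  assumes "closed_module V" "closed_module W" "X \<in> carrier (tensor V W)"
  shows "Poly_Mapping.keys (rep X) \<subseteq> carrier V \<times> carrier W" "X = rep X +o tensor_rel V W"
proof -
  obtain t where t: "Poly_Mapping.keys t \<subseteq> carrier V \<times> carrier W" "X = t +o tensor_rel V W"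
    using assms(3) by (auto simp: tensor_def)
  have "Poly_Mapping.keys (rep X - t) \<subseteq> carrier V \<times> carrier W"
    unfolding t(2) by (rule tensor_rel_keys[OF assms(1,2) rep_coset_diff]) simp
  then have "rep X - t + t \<in> {t. Poly_Mapping.keys t \<subseteq> carrier V \<times> carrier W}"
    using t(1) by (intro pm.subspace_add[OF subspace_keys]) auto
  then show "Poly_Mapping.keys (rep X) \<subseteq> carrier V \<times> carrier W" by simp
  show "X = rep X +o tensor_rel V W" unfolding t(2) by (rule rep_coset[symmetric]) simp
qed

lemma tensor_carrierI:
  "Poly_Mapping.keys t \<subseteq> carrier V \<times> carrier W \<Longrightarrow> t +o tensor_rel V W \<in> carrier (tensor V W)"
  by (auto simp: tensor_def)

lemma tensor_rel_form:
  assumes r: "r \<in> tensor_rel V W"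
    and "\<And>v v' w. v \<in> carrier V \<Longrightarrow> v' \<in> carrier V \<Longrightarrow> w \<in> carrier W \<Longrightarrow> \<beta> (v \<oplus>\<^bsub>V\<^esub> v') w = \<beta> v w + \<beta> v' w"
    and "\<And>v w w'. v \<in> carrier V \<Longrightarrow> w \<in> carrier W \<Longrightarrow> w' \<in> carrier W \<Longrightarrow> \<beta> v (w \<oplus>\<^bsub>W\<^esub> w') = \<beta> v w + \<beta> v w'"
    and "\<And>c v w. v \<in> carrier V \<Longrightarrow> w \<in> carrier W \<Longrightarrow> \<beta> (c \<odot>\<^bsub>V\<^esub> v) w = c * \<beta> v w"
    and "\<And>c v w. v \<in> carrier V \<Longrightarrow> w \<in> carrier W \<Longrightarrow> \<beta> v (c \<odot>\<^bsub>W\<^esub> w) = c * \<beta> v w"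
  shows "lext (*) (\<lambda>(v, w). \<beta> v w) r = 0"
proof -
  have "lext (*) (\<lambda>(v, w). \<beta> v w) r \<in> {0}"
    by (rule linear_in_span[OF fld.linear_lext r[unfolded tensor_rel_def]])
      (auto simp: fld.lext_diff fld.lext_pscale assms(2-))
  then show ?thesis by simp
qed

section \<open>The dual Hopf algebra\<close>

lemma Uc_simps: "f \<oplus>\<^bsub>Uc P\<^esub> g = (\<lambda>u. f u + g u)" "c \<odot>\<^bsub>Uc P\<^esub> f = (\<lambda>u. c * f u)" "\<one>\<^bsub>Uc P\<^esub> = counit"
    "f \<otimes>\<^bsub>Uc P\<^esub> g = (\<lambda>u. lext (*) (\<lambda>(u1, u2). f (basis u1) * g (basis u2)) (coprod u))"
  by (simp_all add: Uc_def)

context complete_filtered_post_lie_algebra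
begin

abbreviation UcR :: "((('p list \<Rightarrow>\<^sub>0 'k) \<Rightarrow> 'k) \<times> (('p list \<Rightarrow>\<^sub>0 'k) \<Rightarrow> 'k) \<Rightarrow>\<^sub>0 'k) set" where
  "UcR \<equiv> tensor_rel (Uc P) (Uc P)"

lemma env_ideal_Fil_fil: "1 \<le> m \<Longrightarrow> u \<in> env_ideal P (Fil P m) \<Longrightarrow> u \<in> fil m"
proof (unfold env_ideal_def, erule linear_in_span[OF pm.linear_ident])
  fix v assume m: "1 \<le> m" and "v \<in> {a * r * b | a r b. r \<in> env_rels P (Fil P m)}"
  then obtain a r b where v: "v = a * r * b" "r \<in> env_rels P (Fil P m)" by blast
  from v(2) have "r \<in> env_rels P {0} \<or> (\<exists>x\<in>Fil P m. r = basis [x])"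
    unfolding env_rels_def by blast
  then have "r \<in> fil m"
  proof
    assume "r \<in> env_rels P {0}"
    then show ?thesis using env_rels_in_ideal[of r P "{0}" 1 1] by (simp add: env_ideal_fil)
  next
    assume "\<exists>x\<in>Fil P m. r = basis [x]"
    then obtain x where "x \<in> Fil P m" "r = basis [x]" by blast
    moreover from this have "weight_ge [x] m" unfolding weight_ge_Cons using m by (intro exI[of _ m] exI[of _ 0]) auto
    ultimately show ?thesis by (simp add: word_fil)
  qed
  then show "v \<in> fil m" unfolding v by (intro fil_mult_left fil_mult_right)
qed simp

text \<open>A letter outside the step \<open>Suc p\<close> contributes at most \<open>p\<close> to
  the weight. So a heavy word is long unless it contains a letter of that step.\<close>

lemma weight_short:
  assumes "weight_ge w m" "\<And>x. x \<in> set w \<Longrightarrow> x \<notin> Fil P (Suc p)"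
  shows "m \<le> p * length w"
  using assms
proof (induction w arbitrary: m)
  case (Cons x w)
  then obtain i n where i: "1 \<le> i" "x \<in> Fil P i" "weight_ge w n" "m \<le> i + n"
    unfolding weight_ge_Cons by blast
  have "i \<le> p"
  proof (rule ccontr)
    assume "\<not> i \<le> p"
    then have "x \<in> Fil P (Suc p)" using Fil_mono[of "Suc p" i] i(2) by auto
    then show False using Cons.prems(2) by auto
  qed
  moreover have "n \<le> p * length w" using Cons.IH i(3) Cons.prems(2) by auto
  ultimately show ?case using i(4) by auto
qed simp

text \<open>The two-parameter family of ideals in the definition of \<^const>\<open>Uc\<close> is cofinal with \<open>F\<^sup>m\<close>.\<close>

lemma Uc_carrier:
  "f \<in> carrier (Uc P) \<longleftrightarrow> linear_form f \<and> (\<exists>m. \<forall>u\<in>fil m. f u = 0)"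
proof (safe)
  assume "f \<in> carrier (Uc P)"
  then obtain j p where lin: "linear_form f"
    and f: "\<And>u. u \<in> env_fil P (Fil P (p + 1)) (j + 1) \<Longrightarrow> f u = 0" by (auto simp: Uc_def)
  then show "linear_form f" by simp
  let ?N = "Fil P (p + 1)"
  have N: "0 \<in> ?N" using Fil_subspace[of "p + 1"] subspace_0 by simp
  \<comment> \<open>A word without letters in \<open>?N\<close> has weight at most \<open>p\<close>
    per letter, so weight \<open>p * j + 1\<close> forces more than \<open>j\<close>
    letters.\<close>
  have "f u = 0" if "u \<in> fil (p * j + 1)" for u
  proof -
    have "f u \<in> {0}"
    proof (rule fil_induct[OF that lin])
      fix i assume "i \<in> env_ideal P {0}"
      moreover have "env_rels P {0} \<subseteq> env_rels P ?N" unfolding env_rels_def using N by blast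
      ultimately have "i \<in> env_ideal P ?N"
        unfolding env_ideal_def using pm.span_mono[of "{a * r * b |a r b. r \<in> env_rels P {0}}" "{a * r * b |a r b. r \<in> env_rels P ?N}"]
        by blast
      then have "i \<in> env_fil P ?N (j + 1)" unfolding env_fil_def by (intro pm.span_base) simp
      then show "f i \<in> {0}" using f by simp
    next
      fix w assume w: "weight_ge w (p * j + 1)"
      have "basis w \<in> env_fil P ?N (j + 1)"
      proof (cases "\<exists>x\<in>set w. x \<in> ?N")
        case True
        then obtain a x b where "w = a @ [x] @ b" "x \<in> ?N" by (metis append_Cons append_Nil split_list)
        then have "basis w \<in> env_ideal P ?N"
          by (simp only: basis_append env_ideal_mult_left env_ideal_mult_right env_ideal_letter)
        then show ?thesis unfolding env_fil_def by (intro pm.span_base) simp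
      next
        case False
        then have "p * j + 1 \<le> p * length w" using weight_short[OF w, of p] by auto
        then have "p * j < p * length w" by linarith
        then have "j + 1 \<le> length w" unfolding mult_less_cancel1 by simp
        then have "weight_ge w (j + 1)" using weight_ge_mono[OF weight_ge_length] by blast
        then show ?thesis unfolding env_fil_def weight_ge_def by (intro pm.span_base) blast
      qed
      then show "f (basis w) \<in> {0}" using f by simp
    qed simp
    then show ?thesis by simp
  qed
  then show "\<exists>m. \<forall>u\<in>fil m. f u = 0" by blast
next
  fix m assume lin: "linear_form f" and f: "\<forall>u\<in>fil m. f u = 0"
  \<comment> \<open>Both parameters of the direct system are set to \<open>m\<close>: letters in
    \<open>P\<^sup>m\<^sup>+\<^sup>1\<close> and words of weight \<open>m + 1\<close> lie in
    \<open>F\<^sup>m\<^sup>+\<^sup>1\<close>.\<close>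
  have "u \<in> fil m" if u: "u \<in> env_fil P (Fil P (m + 1)) (m + 1)" for u
  proof -
    have "u \<in> fil (m + 1)"
    proof (rule linear_in_span[OF pm.linear_ident u[unfolded env_fil_def]])
      fix b assume "b \<in> env_ideal P (Fil P (m + 1)) \<union>
        {basis w |w. \<exists>is. list_all2 (\<lambda>x i. 1 \<le> i \<and> x \<in> Fil P i) w is \<and> m + 1 \<le> sum_list is}"
      then show "b \<in> fil (m + 1)"
        using env_ideal_Fil_fil[of "m + 1"] word_fil[unfolded weight_ge_def] by auto
    qed simp
    then show ?thesis using fil_mono[of m "m + 1"] by auto
  qed
  then show "f \<in> carrier (Uc P)" using lin f unfolding Uc_def by auto
qed

lemma UcE:
  assumes "f \<in> carrier (Uc P)"
  obtains m where "linear_form f" "\<forall>n\<ge>m. \<forall>u\<in>fil n. f u = 0"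
proof -
  obtain m where "linear_form f" "\<forall>u\<in>fil m. f u = 0"
    using assms Uc_carrier by blast
  then show ?thesis using that[of m] fil_mono by blast
qed

lemma Uc_linear: "f \<in> carrier (Uc P) \<Longrightarrow> linear_form f"
  using Uc_carrier by blast

lemma UcI: "linear_form f \<Longrightarrow> (\<And>u. u \<in> fil m \<Longrightarrow> f u = 0) \<Longrightarrow> f \<in> carrier (Uc P)"
  using Uc_carrier by blast

lemma closed_Uc: "closed_module (Uc P)"
  unfolding closed_module_def Uc_simps
proof safe
  fix f g :: "('p list \<Rightarrow>\<^sub>0 'k) \<Rightarrow> 'k" and c :: 'k
  assume "f \<in> carrier (Uc P)"
  then obtain m where m: "linear_form f" "\<forall>n\<ge>m. \<forall>u\<in>fil n. f u = 0"
    by (rule UcE)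
  interpret f: Vector_Spaces.linear pscale "(*)" f by (rule m)
  show "(\<lambda>u. c * f u) \<in> carrier (Uc P)"
  proof (rule UcI)
    show "linear_form (\<lambda>u. c * f u)"
      by (rule linear_formI) (simp_all add: f.add f.scale algebra_simps)
    show "c * f u = 0" if "u \<in> fil m" for u using m(2) that by auto
  qed
  assume "g \<in> carrier (Uc P)"
  then obtain n where n: "linear_form g" "\<forall>k\<ge>n. \<forall>u\<in>fil k. g u = 0"
    by (rule UcE)
  interpret g: Vector_Spaces.linear pscale "(*)" g by (rule n)
  show "(\<lambda>u. f u + g u) \<in> carrier (Uc P)"
  proof (rule UcI)
    show "linear_form (\<lambda>u. f u + g u)"
      by (rule linear_formI)
        (simp_all add: f.add f.scale g.add g.scale algebra_simps)
    show "f u + g u = 0" if "u \<in> fil (max m n)" for u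
      using m(2)[rule_format, of "max m n" u] n(2)[rule_format, of "max m n" u] that by simp
  qed
qed

lemma Uc_add: "f \<in> carrier (Uc P) \<Longrightarrow> g \<in> carrier (Uc P) \<Longrightarrow> (\<lambda>u. f u + g u) \<in> carrier (Uc P)"
  and Uc_scale: "f \<in> carrier (Uc P) \<Longrightarrow> (\<lambda>u. c * f u) \<in> carrier (Uc P)"
  using closed_Uc unfolding closed_module_def Uc_simps by blast+

lemma UcR_rels:
  assumes "g \<in> carrier (Uc P)" "g' \<in> carrier (Uc P)" "h \<in> carrier (Uc P)"
  shows UcR_add_left: "basis (\<lambda>u. g u + g' u, h) - basis (g, h) - basis (g', h) \<in> UcR"
    and UcR_add_right: "basis (h, \<lambda>u. g u + g' u) - basis (h, g) - basis (h, g') \<in> UcR"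
    and UcR_scale_left: "basis (\<lambda>u. c * g u, h) - pscale c (basis (g, h)) \<in> UcR"
    and UcR_scale_right: "basis (h, \<lambda>u. c * g u) - pscale c (basis (h, g)) \<in> UcR"
proof -
  show "basis (\<lambda>u. g u + g' u, h) - basis (g, h) - basis (g', h) \<in> UcR"
    unfolding tensor_rel_def Uc_simps
    by (rule pm.span_base, rule UnI1, rule UnI1, rule UnI1, rule CollectI)
      (rule exI[of _ g], rule exI[of _ g'], rule exI[of _ h], simp add: assms)
  show "basis (h, \<lambda>u. g u + g' u) - basis (h, g) - basis (h, g') \<in> UcR"
    unfolding tensor_rel_def Uc_simps
    by (rule pm.span_base, rule UnI1, rule UnI1, rule UnI2, rule CollectI)
      (rule exI[of _ h], rule exI[of _ g], rule exI[of _ g'], simp add: assms)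
  show "basis (\<lambda>u. c * g u, h) - pscale c (basis (g, h)) \<in> UcR"
    unfolding tensor_rel_def Uc_simps
    by (rule pm.span_base, rule UnI1, rule UnI2, rule CollectI)
      (rule exI[of _ c], rule exI[of _ g], rule exI[of _ h], simp add: assms)
  show "basis (h, \<lambda>u. c * g u) - pscale c (basis (h, g)) \<in> UcR"
    unfolding tensor_rel_def Uc_simps
    by (rule pm.span_base, rule UnI2, rule CollectI)
      (rule exI[of _ c], rule exI[of _ h], rule exI[of _ g], simp add: assms)
qed

lemma Uc_zero: "(\<lambda>u. 0) \<in> carrier (Uc P)"
  by (rule UcI[of _ 0]) (rule linear_formI, simp_all)

lemma Uc_sum_list: "(\<And>x. x \<in> set xs \<Longrightarrow> G x \<in> carrier (Uc P)) \<Longrightarrow> (\<lambda>u. \<Sum>x\<leftarrow>xs. c x * G x u) \<in> carrier (Uc P)"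
  by (induction xs) (simp_all add: Uc_zero Uc_add Uc_scale)

lemma UcR_sum_list:
  assumes "\<And>x. x \<in> set xs \<Longrightarrow> G x \<in> carrier (Uc P)" "h \<in> carrier (Uc P)"
  shows "basis (\<lambda>u. \<Sum>x\<leftarrow>xs. c x * G x u, h) - (\<Sum>x\<leftarrow>xs. pscale (c x) (basis (G x, h))) \<in> UcR"
  using assms
proof (induction xs)
  case Nil
  then show ?case using UcR_scale_left[OF Uc_zero Uc_zero Nil.prems(2), of 0] by simp
next
  case (Cons x xs)
  let ?G = "\<lambda>u. \<Sum>x\<leftarrow>xs. c x * G x u"
  have G: "?G \<in> carrier (Uc P)" using Cons.prems by (intro Uc_sum_list) auto
  have x: "G x \<in> carrier (Uc P)" using Cons.prems by simp
  have "basis (\<lambda>u. \<Sum>x\<leftarrow>x # xs. c x * G x u, h) - (\<Sum>x\<leftarrow>x # xs. pscale (c x) (basis (G x, h)))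
    = (basis (\<lambda>u. c x * G x u + ?G u, h) - basis (\<lambda>u. c x * G x u, h) - basis (?G, h))
      + (basis (\<lambda>u. c x * G x u, h) - pscale (c x) (basis (G x, h)))
      + (basis (?G, h) - (\<Sum>x\<leftarrow>xs. pscale (c x) (basis (G x, h))))"
    by simp
  also have "\<dots> \<in> UcR"
    by (intro pm.subspace_add[OF subspace_tensor_rel] UcR_add_left UcR_scale_left[OF x G] Uc_scale x G Cons)
      (use Cons.prems in auto)
  finally show ?case .
qed

text \<open>
  An element of the tensor square is determined by its values: if \<open>\<Sum>g\<^sub>i(u) h\<^sub>i(v) = 0\<close> for all \<open>u\<close>, \<open>v\<close>
  and \<open>h\<^sub>0(v\<^sub>0) \<noteq> 0\<close>, then \<open>g\<^sub>0\<close> is a combination of the other \<open>g\<^sub>i\<close>, which shortens the sum.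
\<close>

lemma tensor_list_zero:
  assumes "set ps \<subseteq> carrier (Uc P) \<times> carrier (Uc P)" "\<And>u v. (\<Sum>(g, h)\<leftarrow>ps. g u * h v) = 0"
  shows "(\<Sum>x\<leftarrow>ps. basis x) \<in> UcR"
  using assms
proof (induction "length ps" arbitrary: ps)
  case 0
  then show ?case by (simp add: pm.subspace_0)
next
  case (Suc n)
  then obtain g0 h0 qs where ps: "ps = (g0, h0) # qs" "length qs = n" by (cases ps) auto
  have g0: "g0 \<in> carrier (Uc P)" and h0: "h0 \<in> carrier (Uc P)" and qs: "set qs \<subseteq> carrier (Uc P) \<times> carrier (Uc P)"
    using Suc.prems(1) ps by auto
  have sum0: "g0 u * h0 v + (\<Sum>(g, h)\<leftarrow>qs. g u * h v) = 0" for u v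
    using Suc.prems(2)[of u v] by (simp add: ps)
  show ?case
  proof (cases "\<exists>v. h0 v \<noteq> 0")
    case False
    then have "h0 = (\<lambda>v. 0)" by auto
    then have "basis (g0, h0) \<in> UcR" using UcR_scale_right[OF h0 h0 g0, of 0] by simp
    moreover have "(\<Sum>x\<leftarrow>qs. basis x) \<in> UcR"
      using sum0 False by (intro Suc.hyps(1)[of qs]) (auto simp: ps qs)
    ultimately show ?thesis by (simp add: ps pm.subspace_add)
  next
    case True
    then obtain v0 where v0: "h0 v0 \<noteq> 0" by blast
    \<comment> \<open>The coefficients obtained by solving the relation at \<open>v0\<close> for
      \<open>g0\<close>.\<close>
    define c where "c = (\<lambda>(g :: ('p list \<Rightarrow>\<^sub>0 'k) \<Rightarrow> 'k, h :: ('p list \<Rightarrow>\<^sub>0 'k) \<Rightarrow> 'k). - (h v0 / h0 v0))"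
    have g0_eq: "g0 = (\<lambda>u. \<Sum>x\<leftarrow>qs. c x * fst x u)"
    proof
      fix u
      have "(\<Sum>x\<leftarrow>qs. c x * fst x u) = - (1 / h0 v0) * (\<Sum>(g, h)\<leftarrow>qs. g u * h v0)"
        unfolding sum_list_const_mult[symmetric]
        by (intro arg_cong[where f = sum_list] map_cong refl) (auto simp: c_def)
      also have "\<dots> = g0 u" using sum0[of u v0] v0 by (simp add: field_simps neg_eq_iff_add_eq_0 add.commute)
      finally show "g0 u = (\<Sum>x\<leftarrow>qs. c x * fst x u)" by simp
    qed
    \<comment> \<open>Substituting the combination for \<open>g0\<close> spreads
      \<open>g0 \<otimes> h0\<close> over the other terms, each of which becomes
      \<open>g \<otimes> (h + c h0)\<close>.\<close>
    define k where "k x = (fst x, \<lambda>v. snd x v + c x * h0 v)" for x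
    have kc: "k x \<in> carrier (Uc P) \<times> carrier (Uc P)" if "x \<in> set qs" for x
      using that qs unfolding k_def by (auto intro!: Uc_add Uc_scale h0)
    have "(\<Sum>(g, h)\<leftarrow>map k qs. g u * h v) = 0" for u v
    proof -
      have "(\<Sum>(g, h)\<leftarrow>map k qs. g u * h v) = (\<Sum>x\<leftarrow>qs. (case x of (g, h) \<Rightarrow> g u * h v) + h0 v * (c x * fst x u))"
        by (simp add: k_def split_def o_def algebra_simps)
      also have "\<dots> = (\<Sum>(g, h)\<leftarrow>qs. g u * h v) + h0 v * g0 u"
        unfolding sum_list_addf sum_list_const_mult g0_eq ..
      also have "\<dots> = 0" using sum0[of u v] by (simp add: algebra_simps)
      finally show ?thesis .
    qed
    then have 1: "(\<Sum>x\<leftarrow>map k qs. basis x) \<in> UcR"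
      using kc by (intro Suc.hyps(1)) (simp_all add: ps image_subset_iff del: mem_Sigma_iff)
    have 2: "(\<Sum>x\<leftarrow>xs. basis (k x)) - (\<Sum>x\<leftarrow>xs. basis x) - (\<Sum>x\<leftarrow>xs. pscale (c x) (basis (fst x, h0))) \<in> UcR"
      if "set xs \<subseteq> set qs" for xs
      using that
    proof (induction xs)
      case Nil
      then show ?case by (simp add: pm.subspace_0)
    next
      case (Cons x xs)
      have x: "fst x \<in> carrier (Uc P)" "snd x \<in> carrier (Uc P)" using Cons.prems qs by auto
      have "basis (k x) - basis x - pscale (c x) (basis (fst x, h0))
        = (basis (fst x, \<lambda>v. snd x v + c x * h0 v) - basis (fst x, snd x) - basis (fst x, \<lambda>v. c x * h0 v))
          + (basis (fst x, \<lambda>v. c x * h0 v) - pscale (c x) (basis (fst x, h0)))"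
        by (simp add: k_def)
      also have "\<dots> \<in> UcR"
        by (intro pm.subspace_add[OF subspace_tensor_rel] UcR_add_right UcR_scale_right[OF h0 h0] Uc_scale x h0)
      finally have "(basis (k x) - basis x - pscale (c x) (basis (fst x, h0))) + ((\<Sum>x\<leftarrow>xs. basis (k x)) - (\<Sum>x\<leftarrow>xs. basis x)
            - (\<Sum>x\<leftarrow>xs. pscale (c x) (basis (fst x, h0)))) \<in> UcR"
        using Cons by (intro pm.subspace_add[OF subspace_tensor_rel]) auto
      then show ?case by (simp add: algebra_simps)
    qed
    have 3: "basis (g0, h0) - (\<Sum>x\<leftarrow>qs. pscale (c x) (basis (fst x, h0))) \<in> UcR"
      unfolding g0_eq using qs by (intro UcR_sum_list h0) auto
    have "(\<Sum>x\<leftarrow>ps. basis x) = (basis (g0, h0) - (\<Sum>x\<leftarrow>qs. pscale (c x) (basis (fst x, h0))))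
        + (\<Sum>x\<leftarrow>map k qs. basis x)
        - ((\<Sum>x\<leftarrow>qs. basis (k x)) - (\<Sum>x\<leftarrow>qs. basis x) - (\<Sum>x\<leftarrow>qs. pscale (c x) (basis (fst x, h0))))"
      by (simp add: ps o_def)
    then show ?thesis
      using 1 2[of qs] 3 by (simp only: pm.subspace_add[OF subspace_tensor_rel] pm.subspace_diff[OF subspace_tensor_rel] order_refl)
  qed
qed

lemma tensor_zero:
  assumes keys: "Poly_Mapping.keys t \<subseteq> carrier (Uc P) \<times> carrier (Uc P)"
    and zero: "\<And>u v. lext (*) (\<lambda>(g, h). g u * h v) t = 0"
  shows "t \<in> UcR"
proof -
  obtain xs where xs: "set xs = Poly_Mapping.keys t" "distinct xs"
    using finite_distinct_list[of "Poly_Mapping.keys t"] by auto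
  \<comment> \<open>The coefficients are absorbed into the first factors, which turns
    \<open>t\<close> into a sum of pure tensors.\<close>
  define l where "l = (\<lambda>x. (\<lambda>u. Poly_Mapping.lookup t x * fst x u :: 'k, snd x :: ('p list \<Rightarrow>\<^sub>0 'k) \<Rightarrow> 'k))"
  have "(\<Sum>x\<leftarrow>map l xs. basis x) \<in> UcR"
  proof (rule tensor_list_zero)
    show "set (map l xs) \<subseteq> carrier (Uc P) \<times> carrier (Uc P)"
      using xs(1) keys by (auto simp: l_def intro!: Uc_scale)
    show "(\<Sum>(g, h)\<leftarrow>map l xs. g u * h v) = 0" for u v
    proof -
      have "(\<Sum>(g, h)\<leftarrow>map l xs. g u * h v) = (\<Sum>x\<leftarrow>xs. Poly_Mapping.lookup t x * (case x of (g, h) \<Rightarrow> g u * h v))"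
        by (simp add: l_def split_def o_def mult.assoc)
      also have "\<dots> = lext (*) (\<lambda>(g, h). g u * h v) t"
        unfolding lext_def xs(1)[symmetric] by (rule sum_list_distinct_conv_sum_set[OF xs(2)])
      finally show ?thesis by (simp add: zero)
    qed
  qed
  moreover have "(\<Sum>x\<leftarrow>ys. basis (l x)) - (\<Sum>x\<leftarrow>ys. pscale (Poly_Mapping.lookup t x) (basis x)) \<in> UcR"
    if "set ys \<subseteq> Poly_Mapping.keys t" for ys
    using that
  proof (induction ys)
    case Nil
    then show ?case by (simp add: pm.subspace_0)
  next
    case (Cons x ys)
    have x: "fst x \<in> carrier (Uc P)" "snd x \<in> carrier (Uc P)" using Cons.prems keys by auto
    have "basis (l x) - pscale (Poly_Mapping.lookup t x) (basis x) \<in> UcR"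
      using UcR_scale_left[OF x(1,1,2), of "Poly_Mapping.lookup t x"] by (simp add: l_def)
    then have "(basis (l x) - pscale (Poly_Mapping.lookup t x) (basis x))
      + ((\<Sum>x\<leftarrow>ys. basis (l x)) - (\<Sum>x\<leftarrow>ys. pscale (Poly_Mapping.lookup t x) (basis x))) \<in> UcR"
      using Cons by (intro pm.subspace_add[OF subspace_tensor_rel]) auto
    then show ?case by (simp add: algebra_simps)
  qed
  from this[of xs] have "(\<Sum>x\<leftarrow>xs. basis (l x)) - t \<in> UcR"
    using basis_expansion[of t] by (simp add: xs sum_list_distinct_conv_sum_set)
  ultimately have "(\<Sum>x\<leftarrow>map l xs. basis x) - ((\<Sum>x\<leftarrow>xs. basis (l x)) - t) \<in> UcR"
    by (rule pm.subspace_diff[OF subspace_tensor_rel])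
  then show ?thesis by (simp add: o_def)
qed

text \<open>A tensor is determined by its values, by \<open>tensor_zero\<close>; so the description
  in \<open>dual_coprod\<close> is met by exactly one element as soon as some \<open>t\<close> with
  the right values is exhibited.\<close>

lemma dual_coprod_eqI:
  assumes t: "t \<in> carrier (tensor (Uc P) (Uc P))"
    and eq: "\<And>u v. tensor_form (\<lambda>g h. g u * h v) t = f (m u v)"
  shows "dual_coprod P m f = t"
  unfolding dual_coprod_def
proof (rule the_equality)
  fix s assume s: "s \<in> carrier (tensor (Uc P) (Uc P)) \<and> (\<forall>u v. tensor_form (\<lambda>g h. g u * h v) s = f (m u v))"
  have "rep s - rep t \<in> UcR"
  proof (rule tensor_zero)
    have "rep s - rep t \<in> {t. Poly_Mapping.keys t \<subseteq> carrier (Uc P) \<times> carrier (Uc P)}"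
      using tensor_rep[OF closed_Uc closed_Uc] s t by (intro pm.subspace_diff[OF subspace_keys]) auto
    then show "Poly_Mapping.keys (rep s - rep t) \<subseteq> carrier (Uc P) \<times> carrier (Uc P)" by simp
    show "lext (*) (\<lambda>(g, h). g u * h v) (rep s - rep t) = 0" for u v
      using s eq[of u v] unfolding tensor_form_def by (simp add: fld.lext_diff)
  qed
  then show "s = t"
    using tensor_rep(2)[OF closed_Uc closed_Uc] s t coset_eq_iff[OF subspace_tensor_rel] by metis
qed (use assms in auto)

end

section \<open>Finite codimension, and the transposes of the convolution powers of
  \<open>J\<close>\<close>

lemma finite_codim_coordinates:
  assumes N: "pm.subspace N" and S: "finite S" "pspan (S \<union> N) = UNIV"
  obtains T g where "finite T" "\<forall>s. linear_form (g s)"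
    "\<forall>s\<in>T. \<forall>u\<in>N. g s u = 0" "\<forall>u. u - (\<Sum>s\<in>T. pscale (g s u) s) \<in> N"
proof -
  obtain BN where BN: "BN \<subseteq> N" "pm.independent BN" "N \<subseteq> pspan BN"
    using pm.maximal_independent_subset[of N] by blast
  \<comment> \<open>A basis of \<open>N\<close> is enlarged by elements of \<open>S\<close>, so only
    finitely many basis vectors lie outside \<open>BN\<close>. Their coordinates vanish on
    \<open>N\<close>.\<close>
  obtain B where B: "BN \<subseteq> B" "B \<subseteq> BN \<union> S" "pm.independent B" "BN \<union> S \<subseteq> pspan B"
    using pm.maximal_independent_subset_extend[of BN "BN \<union> S"] BN(2) by blast
  have "N \<subseteq> pspan B" using BN(3) pm.span_mono[OF B(1)] by blast
  then have "S \<union> N \<subseteq> pspan B" using B(4) by blast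
  then have "pspan (S \<union> N) \<subseteq> pspan B" by (intro pm.span_minimal) simp_all
  then have UB: "u \<in> pspan B" for u using S(2) by auto
  define g where "g s u = pm.representation B u s" for s u
  let ?T = "B - BN"
  have fin: "finite ?T" using B(2) S(1) by (meson Diff_subset_conv finite_subset)
  have lin: "linear_form (g s)" for s
    by (rule linear_formI)
      (simp_all add: g_def pm.representation_add pm.representation_scale B(3) UB)
  have zero: "g s u = 0" if "s \<in> ?T" "u \<in> N" for s u
  proof -
    have u: "u \<in> pspan BN" using that BN(3) by blast
    have "g s u = pm.representation BN u s"
      unfolding g_def using pm.representation_extend[OF B(3) u B(1)] by simp
    then show ?thesis using pm.representation_ne_zero[of BN u s] that(1) by auto
  qed
  have exp: "u - (\<Sum>s\<in>?T. pscale (g s u) s) \<in> N" for u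
  proof -
    let ?K = "{b. pm.representation B u b \<noteq> 0}"
    have fK: "finite ?K" by (rule pm.finite_representation)
    have K: "?K \<subseteq> B" using pm.representation_ne_zero by blast
    have "u = (\<Sum>b\<in>?K. pscale (g b u) b)"
      unfolding g_def by (rule pm.sum_nonzero_representation_eq[OF B(3) UB, symmetric])
    also have "\<dots> = (\<Sum>b\<in>?K \<inter> BN. pscale (g b u) b) + (\<Sum>b\<in>?K - BN. pscale (g b u) b)"
      by (rule sum.Int_Diff[OF fK])
    also have "(\<Sum>b\<in>?K - BN. pscale (g b u) b) = (\<Sum>b\<in>?T. pscale (g b u) b)"
      by (rule sum.mono_neutral_left[OF fin]) (use K in \<open>auto simp: g_def\<close>)
    finally have "u - (\<Sum>b\<in>?T. pscale (g b u) b) = (\<Sum>b\<in>?K \<inter> BN. pscale (g b u) b)"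
      by (simp add: algebra_simps)
    also have "\<dots> \<in> N" using BN(1) by (intro pm.subspace_sum[OF N] pm.subspace_scale[OF N]) auto
    finally show ?thesis .
  qed
  show ?thesis using that[of ?T g] fin lin zero exp by blast
qed

lemma fld_lext_swap:
  "lext (*) (\<lambda>x. lext (*) (\<lambda>y. \<phi> x y) s) r = lext (*) (\<lambda>y. lext (*) (\<lambda>x. \<phi> x y) r) s"
proof -
  have "lext (*) (\<lambda>x. lext (*) (\<lambda>y. \<phi> x y) s) r = (\<Sum>x\<in>Poly_Mapping.keys r. \<Sum>y\<in>Poly_Mapping.keys s.
      Poly_Mapping.lookup r x * (Poly_Mapping.lookup s y * \<phi> x y))"
    unfolding lext_def sum_distrib_left ..
  also have "\<dots> = (\<Sum>y\<in>Poly_Mapping.keys s. \<Sum>x\<in>Poly_Mapping.keys r.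
      Poly_Mapping.lookup s y * (Poly_Mapping.lookup r x * \<phi> x y))"
    by (subst sum.swap) (simp only: mult.left_commute)
  also have "\<dots> = lext (*) (\<lambda>y. lext (*) (\<lambda>x. \<phi> x y) r) s"
    unfolding lext_def sum_distrib_left ..
  finally show ?thesis .
qed

text \<open>The dual on the free algebra of the convolution powers of \<open>J\<close>.\<close>

primrec word_J :: "nat \<Rightarrow> 'p list \<Rightarrow> ('p list \<Rightarrow>\<^sub>0 'k::field)" where
  "word_J 0 w = (if w = [] then 1 else 0)"
| "word_J (Suc n) w = unshuffle w (\<lambda>a b. (if a = [] then 0 else basis a) * word_J n b)"

definition env_J :: "nat \<Rightarrow> ('p list \<Rightarrow>\<^sub>0 'k::field) \<Rightarrow> ('p list \<Rightarrow>\<^sub>0 'k)" where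
  "env_J n = lext pscale (word_J n)"

lemma linear_env_J: "Vector_Spaces.linear pscale pscale (env_J n)"
  unfolding env_J_def by (rule pm.linear_lext)

lemma env_J_basis: "env_J n (basis w) = word_J n w"
  by (simp add: env_J_def)

lemma env_J_0: "env_J 0 u = pscale (counit u) 1"
proof (rule pm.linear_eq_on_basis[OF linear_env_J])
  show "Vector_Spaces.linear pscale pscale (\<lambda>u. pscale (counit u) 1)"
    by (rule linearI[OF pm.vector_space_axioms pm.vector_space_axioms])
      (simp_all add: counit_add counit_pscale pm.scale_left_distrib)
qed (simp add: env_J_basis counit_basis)

lemma env_J_Suc: "env_J (Suc n) u
    = lext pscale (\<lambda>(a, b). (if a = [] then 0 else basis a) * word_J n b) (coprod u)"
  by (rule pm.linear_eq_on_basis[OF linear_env_J pm.linear_lext_coprod])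
    (simp add: env_J_basis pm.lext_coprod_basis)

text \<open>The transpose of \<open>J\<close>, that is, the projection onto the kernel of the
  counit. On words it drops the empty one, which is the form used in \<open>word_J\<close>.\<close>

lemma lext_reduced: "lext pscale (\<lambda>a. if a = [] then 0 else basis a) u = u - pscale (counit u) 1"
proof (rule pm.linear_eq_on_basis[OF pm.linear_lext])
  show "Vector_Spaces.linear pscale pscale (\<lambda>u :: 'a list \<Rightarrow>\<^sub>0 'b. u - pscale (counit u) 1)"
    by (rule linearI[OF pm.vector_space_axioms pm.vector_space_axioms])
      (simp_all add: counit_add counit_pscale pm.scale_left_distrib pm.scale_right_diff_distrib)
qed (simp add: counit_basis basis_Nil)

lemma env_J_split:
  "lext pscale (\<lambda>(a, b). (if a = [] then 0 else basis a) * word_J n b) (tens i t) = (i - pscale (counit i) 1) * env_J n t"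
proof -
  have "lext pscale (\<lambda>b. (if a = [] then 0 else basis a) * word_J n b) t
      = (if a = [] then 0 else basis a) * env_J n t" for a
    by (rule pm.linear_eq_on_basis[OF pm.linear_lext linear_comp[OF linear_env_J linear_mult_left]])
      (simp add: env_J_basis)
  then show ?thesis
    by (simp only: pm.lext_tens pm.linear_lext_comp[OF linear_mult_right, symmetric] lext_reduced)
qed

section \<open>The map \<open>e\<close> on letters and on grouplike elements\<close>

context complete_filtered_post_lie_algebra
begin

lemma counit_fil: "u \<in> fil m \<Longrightarrow> 1 \<le> m \<Longrightarrow> counit u = 0"
proof -
  assume u: "u \<in> fil m" and m: "1 \<le> m"
  have "counit u \<in> {0}"
    by (rule fil_induct[OF u linear_counit]) (use m in \<open>auto simp: counit_env_ideal counit_basis\<close>)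
  then show "counit u = 0" by simp
qed

lemma fil_1: "counit u = 0 \<Longrightarrow> u \<in> fil 1"
proof (rule in_subspace_if_basis_in[OF subspace_fil])
  fix w assume "counit u = 0" "w \<in> Poly_Mapping.keys u"
  then have "w \<noteq> []" by (auto simp: counit_def in_keys_iff)
  then have "1 \<le> length w" by (simp add: Suc_le_eq)
  then show "basis w \<in> fil 1" by (intro word_fil weight_ge_mono[OF weight_ge_length])
qed

lemma fil_power: "u \<in> fil 1 \<Longrightarrow> u ^ n \<in> fil n"
proof (induction n)
  case (Suc n)
  then show ?case using fil_mult[of u 1 "u ^ n" n] by simp
qed (simp add: fil_0)

lemma env_J_ideal: "u \<in> env_ideal P {0} \<Longrightarrow> env_J n u \<in> env_ideal P {0}"
proof (induction n arbitrary: u)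
  case 0
  then show ?case by (simp add: env_J_0 counit_env_ideal pm.subspace_0)
next
  case (Suc n)
  show ?case
    unfolding env_J_Suc
    by (rule coprod_env_ideal[OF Suc.prems pm.linear_lext])
      (auto simp: env_J_split counit_env_ideal intro: env_ideal_mult_left env_ideal_mult_right Suc.IH)
qed

lemma word_J_weight: "weight_ge w m \<Longrightarrow> word_J n w \<in> fil m"
proof (induction n arbitrary: w m)
  case 0
  then show ?case by (auto simp: fil_0 pm.subspace_0)
next
  case (Suc n)
  show ?case unfolding word_J.simps
  proof (rule unshuffle_weight[OF Suc.prems subspace_fil pm.vector_space_axioms])
    fix a b i j assume a: "weight_ge a i" "weight_ge b j" "m \<le> i + j"
    have "(if a = [] then 0 else basis a) * word_J n b \<in> fil (i + j)"
      using a by (intro fil_mult Suc.IH) (auto simp: pm.subspace_0 word_fil)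
    then show "(if a = [] then 0 else basis a) * word_J n b \<in> fil m"
      using fil_mono[OF a(3)] by blast
  qed
qed

lemma env_J_fil: "u \<in> fil m \<Longrightarrow> env_J n u \<in> fil m"
  by (erule fil_induct[OF _ linear_env_J subspace_fil])
    (auto simp: env_J_basis intro: env_ideal_fil env_J_ideal word_J_weight)

lemma Uc_comp_mult_left:
  "f \<in> carrier (Uc P) \<Longrightarrow> (\<lambda>v. f (u * v)) \<in> carrier (Uc P)"
proof -
  assume "f \<in> carrier (Uc P)"
  then obtain m where m: "linear_form f" "\<forall>n\<ge>m. \<forall>u\<in>fil n. f u = 0" by (rule UcE)
  show "(\<lambda>v. f (u * v)) \<in> carrier (Uc P)"
    by (rule UcI[OF linear_comp[OF linear_mult_left m(1)], of m]) (use m(2) fil_mult_left in blast)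
qed

text \<open>Grouplike modulo \<open>F\<^sup>m\<close>, expressed by pairing the coproduct of
  \<open>w\<close> with pairs of forms that vanish on \<open>F\<^sup>m\<close>: for these,
  evaluation at \<open>w\<close> is multiplicative for the shuffle product.\<close>

definition grouplike :: "nat \<Rightarrow> ('p list \<Rightarrow>\<^sub>0 'k) \<Rightarrow> bool" where
  "grouplike m w \<longleftrightarrow> counit w = 1 \<and> (\<forall>f g. linear_form f \<longrightarrow> linear_form g \<longrightarrow>
     (\<forall>u\<in>fil m. f u = 0) \<longrightarrow> (\<forall>u\<in>fil m. g u = 0) \<longrightarrow> (f \<otimes>\<^bsub>Uc P\<^esub> g) w = f w * g w)"

definition log_trunc :: "nat \<Rightarrow> ('p list \<Rightarrow>\<^sub>0 'k) \<Rightarrow> ('p list \<Rightarrow>\<^sub>0 'k)" where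
  "log_trunc m w = (\<Sum>n\<in>{1..<m}. pscale ((- 1) ^ (n - 1) / of_nat n) ((w - 1) ^ n))"

context
  assumes fin: "finite_dim_quotients P"
begin

text \<open>Modulo \<open>F\<^sup>m\<close> a letter may be replaced by a combination of the
  finitely many letters in \<open>B\<close>, and words of length at least \<open>m\<close>
  vanish.\<close>

lemma fil_finite_codim: "\<exists>S. finite S \<and> pspan (S \<union> fil m) = UNIV"
proof (cases "m = 0")
  case True
  then have "fil m = UNIV" using fil_0 by auto
  then show ?thesis by (intro exI[of _ "{}"]) simp
next
  case False
  then obtain B where B: "finite B" "span (B \<union> Fil P m) = UNIV"
    using fin unfolding finite_dim_quotients_def by (metis One_nat_def Suc_leI not_gr_zero)
  define S where "S = (basis :: 'p list \<Rightarrow> 'p list \<Rightarrow>\<^sub>0 'k) ` {w. set w \<subseteq> B \<and> length w \<le> m}"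
  let ?V = "pspan (S \<union> fil m)"
  have filV: "u \<in> ?V" if "u \<in> fil m" for u using that by (intro pm.span_base) simp
  \<comment> \<open>\<open>v\<close> is the part already rewritten in letters from \<open>B\<close>;
    the letters of \<open>w\<close> are expanded and moved to \<open>v\<close> one at a
    time.\<close>
  have "basis (v @ w) \<in> ?V" if "set v \<subseteq> B" for v w
    using that
  proof (induction w arbitrary: v)
    case Nil
    show ?case
    proof (cases "length v \<le> m")
      case True
      then show ?thesis using Nil by (intro pm.span_base) (auto simp: S_def)
    next
      case False
      then have "weight_ge v m" by (intro weight_ge_mono[OF weight_ge_length]) simp
      then show ?thesis by (simp add: filV word_fil)
    qed
  next
    case (Cons x w)
    have lin: "basis (v @ [y + z] @ w) - basis (v @ [y] @ w) - basis (v @ [z] @ w) \<in> ?V"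
      "basis (v @ [scal P c y] @ w) - pscale c (basis (v @ [y] @ w)) \<in> ?V" for y z c
    proof -
      have "basis v * (basis [y + z] - basis [y] - basis [z]) * basis w \<in> ?V"
        by (intro filV env_ideal_fil env_ideal_mult_left env_ideal_mult_right rels_in_ideal rels_add)
      then show "basis (v @ [y + z] @ w) - basis (v @ [y] @ w) - basis (v @ [z] @ w) \<in> ?V"
        by (simp only: basis_append right_diff_distrib left_diff_distrib mult.assoc)
      have "basis v * (basis [scal P c y] - pscale c (basis [y])) * basis w \<in> ?V"
        by (intro filV env_ideal_fil env_ideal_mult_left env_ideal_mult_right rels_in_ideal rels_scale)
      then show "basis (v @ [scal P c y] @ w) - pscale c (basis (v @ [y] @ w)) \<in> ?V"
        by (simp only: basis_append right_diff_distrib left_diff_distrib mult.assoc pscale_mult_left pscale_mult_right)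
    qed
    have "x \<in> span (B \<union> Fil P m)" using B(2) by simp
    then have "basis (v @ [x] @ w) \<in> ?V"
    proof (induction rule: span_induct_alt)
      case base
      have "basis v * basis [0] * basis w \<in> ?V"
        by (intro filV env_ideal_fil env_ideal_mult_left env_ideal_mult_right rels_in_ideal rels_zero)
      then show ?case by (simp only: basis_append mult.assoc)
    next
      case (step c y z)
      have "basis (v @ [y] @ w) \<in> ?V"
      proof (cases "y \<in> B")
        case True
        then show ?thesis using Cons.IH[of "v @ [y]"] Cons.prems by simp
      next
        case False
        then have "weight_ge [y] m" unfolding weight_ge_Cons using step(1) \<open>m \<noteq> 0\<close>
          by (intro exI[of _ m] exI[of _ 0]) auto
        then have "basis v * basis [y] * basis w \<in> ?V"
          by (intro filV fil_mult_left fil_mult_right word_fil)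
        then show ?thesis by (simp only: basis_append mult.assoc)
      qed
      then have "(basis (v @ [scal P c y + z] @ w) - basis (v @ [scal P c y] @ w) - basis (v @ [z] @ w))
          + (basis (v @ [scal P c y] @ w) - pscale c (basis (v @ [y] @ w)))
          + pscale c (basis (v @ [y] @ w)) + basis (v @ [z] @ w) \<in> ?V"
        by (intro pm.span_add pm.span_scale lin step)
      then show ?case by simp
    qed
    then show ?case by simp
  qed
  from this[of "[]"] have "basis w \<in> ?V" for w by simp
  then have "u \<in> ?V" for u by (rule in_subspace_if_basis_in[OF pm.subspace_span])
  then have "?V = UNIV" by blast
  moreover have "finite S" unfolding S_def using finite_lists_length_le[OF B(1), of m] by simp
  ultimately show ?thesis by blast
qed

text \<open>Since \<open>F\<^sup>m\<close> is an ideal, \<open>f (u * v)\<close> depends only on the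
  class of \<open>u\<close>, which has finitely many coordinates \<open>g s u\<close>. The formula
  exhibits the coproduct of \<open>f\<close> as a finite sum.\<close>

lemma Uc_product_decomposition:
  assumes lin: "linear_form f" and f: "\<forall>u\<in>fil m. f u = 0"
  obtains T g where "finite T" "\<forall>s. linear_form (g s)" "\<forall>s\<in>T. \<forall>u\<in>fil m. g s u = 0"
    "\<forall>u v. f (u * v) = (\<Sum>s\<in>T. g s u * f (s * v))"
proof -
  interpret f: Vector_Spaces.linear pscale "(*)" f by (rule lin)
  obtain S where S: "finite S" "pspan (S \<union> fil m) = UNIV" using fil_finite_codim by blast
  obtain T g where T: "finite T" "\<forall>s. linear_form (g s)"
    "\<forall>s\<in>T. \<forall>u\<in>fil m. g s u = 0" "\<forall>u. u - (\<Sum>s\<in>T. pscale (g s u) s) \<in> fil m"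
    by (rule finite_codim_coordinates[OF subspace_fil S])
  have "f (u * v) = (\<Sum>s\<in>T. g s u * f (s * v))" for u v
  proof -
    have "f ((u - (\<Sum>s\<in>T. pscale (g s u) s)) * v) = 0"
      using f fil_mult_right[OF T(4)[rule_format, of u]] by simp
    then show ?thesis
      by (simp add: left_diff_distrib sum_distrib_right f.diff f.sum pscale_mult_left f.scale)
  qed
  then have "\<forall>u v. f (u * v) = (\<Sum>s\<in>T. g s u * f (s * v))" by (intro allI)
  then show ?thesis by (rule that[OF T(1-3)])
qed

lemma Delta_bullet:
  assumes f: "f \<in> carrier (Uc P)"
  shows "Poly_Mapping.keys (rep (Delta_bullet P f)) \<subseteq> carrier (Uc P) \<times> carrier (Uc P)"
    and "lext (*) (\<lambda>(g, h). g u * h v) (rep (Delta_bullet P f)) = f (u * v)"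
proof -
  obtain m where m: "linear_form f" "\<forall>n\<ge>m. \<forall>u\<in>fil n. f u = 0" using f by (rule UcE)
  obtain T g where T: "finite T" "\<forall>s. linear_form (g s)" "\<forall>s\<in>T. \<forall>u\<in>fil m. g s u = 0"
    "\<forall>u v. f (u * v) = (\<Sum>s\<in>T. g s u * f (s * v))"
    by (rule Uc_product_decomposition[OF m(1) m(2)[THEN spec, THEN mp, OF order_refl]])
  define t :: "(('p list \<Rightarrow>\<^sub>0 'k) \<Rightarrow> 'k) \<times> (('p list \<Rightarrow>\<^sub>0 'k) \<Rightarrow> 'k) \<Rightarrow>\<^sub>0 'k"
    where "t = (\<Sum>s\<in>T. basis (g s, \<lambda>v. f (s * v)))"
  let ?X = "t +o UcR"
  have "t \<in> {t. Poly_Mapping.keys t \<subseteq> carrier (Uc P) \<times> carrier (Uc P)}"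
    unfolding t_def
  proof (rule pm.subspace_sum[OF subspace_keys])
    fix s assume "s \<in> T"
    then have "g s \<in> carrier (Uc P)" using T(2,3) by (intro UcI[of _ m]) auto
    then show "basis (g s, \<lambda>v. f (s * v)) \<in> {t. Poly_Mapping.keys t \<subseteq> carrier (Uc P) \<times> carrier (Uc P)}"
      using Uc_comp_mult_left[OF f] by simp
  qed
  then have X: "?X \<in> carrier (tensor (Uc P) (Uc P))" by (intro tensor_carrierI) simp
  have form: "lext (*) (\<lambda>(g, h). g u * h v) (rep ?X) = f (u * v)" for u v
  proof -
    have "lext (*) (\<lambda>(g, h). g u * h v) (rep ?X - t) = 0"
      by (rule tensor_rel_form[OF rep_coset_diff[OF subspace_tensor_rel]])
        (simp_all add: Uc_simps algebra_simps)
    moreover have "lext (*) (\<lambda>(g, h). g u * h v) t = f (u * v)"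
      by (simp add: t_def fld.lext_sum T(4)[rule_format, of u v])
    ultimately show ?thesis by (simp add: fld.lext_diff)
  qed
  have eq: "Delta_bullet P f = ?X"
    unfolding Delta_bullet_def by (rule dual_coprod_eqI[OF X]) (simp add: tensor_form_def form)
  show "Poly_Mapping.keys (rep (Delta_bullet P f)) \<subseteq> carrier (Uc P) \<times> carrier (Uc P)"
    unfolding eq by (rule tensor_rep(1)[OF closed_Uc closed_Uc X])
  show "lext (*) (\<lambda>(g, h). g u * h v) (rep (Delta_bullet P f)) = f (u * v)"
    unfolding eq by (rule form)
qed

text \<open>Allows \<open>convolve\<close> to be computed on any representative of the
  tensor.\<close>

lemma Uc_mult_form_UcR:
  assumes "r \<in> UcR"
  shows "lext (*) (\<lambda>(g, h). (g \<otimes>\<^bsub>Uc P\<^esub> h) u) r = 0"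
proof (rule tensor_rel_form[OF assms])
  fix g g' h :: "('p list \<Rightarrow>\<^sub>0 'k) \<Rightarrow> 'k" and c :: 'k
  show "((g \<oplus>\<^bsub>Uc P\<^esub> g') \<otimes>\<^bsub>Uc P\<^esub> h) u = (g \<otimes>\<^bsub>Uc P\<^esub> h) u + (g' \<otimes>\<^bsub>Uc P\<^esub> h) u"
    "(h \<otimes>\<^bsub>Uc P\<^esub> (g \<oplus>\<^bsub>Uc P\<^esub> g')) u = (h \<otimes>\<^bsub>Uc P\<^esub> g) u + (h \<otimes>\<^bsub>Uc P\<^esub> g') u"
    "((c \<odot>\<^bsub>Uc P\<^esub> g) \<otimes>\<^bsub>Uc P\<^esub> h) u = c * (g \<otimes>\<^bsub>Uc P\<^esub> h) u"
    "(h \<otimes>\<^bsub>Uc P\<^esub> (c \<odot>\<^bsub>Uc P\<^esub> g)) u = c * (h \<otimes>\<^bsub>Uc P\<^esub> g) u"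
    by (simp_all add: Uc_simps split_def fld.lext_add_fun[symmetric] fld.lext_scale_fun[symmetric] algebra_simps)
qed

text \<open>Convolution of endomorphisms of the dual is the transpose of the convolution formed with
  \<open>coprod\<close> and the first product. The finite sum over the coproduct of \<open>f\<close>
  is exchanged with the one over \<open>coprod u\<close> and then recombined to \<open>f\<close> of
  a product.\<close>

lemma J_pow: "f \<in> carrier (Uc P) \<Longrightarrow> J_pow P n f u = f (env_J n u)"
proof (induction n arbitrary: f u)
  case 0
  interpret f: Vector_Spaces.linear pscale "(*)" f using 0 by (rule Uc_linear)
  show ?case by (simp add: eta_eps_def env_J_0 f.scale)
next
  case (Suc n)
  interpret f: Vector_Spaces.linear pscale "(*)" f using Suc.prems by (rule Uc_linear)
  let ?R = "rep (Delta_bullet P f)"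
  let ?J = "\<lambda>a. if a = [] then 0 else basis a :: 'p list \<Rightarrow>\<^sub>0 'k"
  let ?t = "lext pscale (\<lambda>(v, w). basis (J_map v, J_pow P n w)) ?R"
  let ?\<beta> = "\<lambda>(g, h). (g \<otimes>\<^bsub>Uc P\<^esub> h) u"
  have "J_pow P (Suc n) f u = lext (*) ?\<beta> (rep (?t +o UcR))"
    by (simp add: convolve_def tensor_map_def tensor_form_def)
  also have "\<dots> = lext (*) ?\<beta> ?t"
    using Uc_mult_form_UcR[OF rep_coset_diff[OF subspace_tensor_rel], of u ?t] by (simp add: fld.lext_diff)
  also have "\<dots> = lext (*) (\<lambda>(g, h). (J_map g \<otimes>\<^bsub>Uc P\<^esub> J_pow P n h) u) ?R"
    by (simp add: pm.linear_lext_comp[OF fld.linear_lext] split_def)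
  also have "\<dots> = lext (*) (\<lambda>x. lext (*) (\<lambda>y. fst x (?J (fst y)) * snd x (word_J n (snd y))) (coprod u)) ?R"
  proof (rule fld.lext_cong)
    fix x assume "x \<in> Poly_Mapping.keys ?R"
    then obtain g h where x: "x = (g, h)" "g \<in> carrier (Uc P)" "h \<in> carrier (Uc P)"
      using Delta_bullet(1)[OF Suc.prems] by blast
    interpret g: Vector_Spaces.linear pscale "(*)" g using x(2) by (rule Uc_linear)
    have "J_map g (basis a) = g (?J a)" for a
      by (simp add: J_map_def eta_eps_def counit_basis basis_Nil g.zero)
    then show "(case x of (g, h) \<Rightarrow> (J_map g \<otimes>\<^bsub>Uc P\<^esub> J_pow P n h) u)
        = lext (*) (\<lambda>y. fst x (?J (fst y)) * snd x (word_J n (snd y))) (coprod u)"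
      using Suc.IH[OF x(3)] by (simp add: x(1) Uc_simps split_def env_J_basis)
  qed
  also have "\<dots> = lext (*) (\<lambda>y. lext (*) (\<lambda>x. fst x (?J (fst y)) * snd x (word_J n (snd y))) ?R) (coprod u)"
    by (rule fld_lext_swap)
  also have "\<dots> = lext (*) (\<lambda>y. f (?J (fst y) * word_J n (snd y))) (coprod u)"
    using Delta_bullet(2)[OF Suc.prems] by (simp add: split_def)
  also have "\<dots> = f (env_J (Suc n) u)"
    unfolding env_J_Suc split_def pm.linear_lext_comp[OF f.linear_axioms] ..
  finally show ?case .
qed

text \<open>A single letter has no splitting into two nonempty words, so only the first power of
  \<open>J\<close> contributes. Hence \<open>e\<close> leaves the projection to \<open>Q\<close>
  unchanged, and \<open>q\<close> can be read off from any preimage of \<open>\<psi> q\<close> under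
  \<open>e\<close>.\<close>

lemma e_map_letter:
  assumes f: "f \<in> carrier (Uc P)"
  shows "e_map P f (basis [x]) = f (basis [x])"
proof -
  interpret f: Vector_Spaces.linear pscale "(*)" f using f by (rule Uc_linear)
  have Nil: "word_J (Suc n) [] = (0 :: 'p list \<Rightarrow>\<^sub>0 'k)" for n by simp
  have "word_J (Suc n) [x] = (if n = 0 then basis [x] else 0 :: 'p list \<Rightarrow>\<^sub>0 'k)" for n
    by (cases n) (simp_all add: Nil)
  then have J: "J_pow P (Suc n) f (basis [x]) = (if n = 0 then f (basis [x]) else 0)" for n
    by (simp only: J_pow[OF f] env_J_basis) (simp add: f.zero)
  have "e_map P f (basis [x]) = (\<Sum>n\<in>{0}. (- 1) ^ n / of_nat (Suc n) * J_pow P (Suc n) f (basis [x]))"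
    unfolding e_map_def by (rule Sum_any.expand_superset) (auto simp: J simp del: J_pow.simps)
  then show ?thesis by (simp add: J del: J_pow.simps)
qed

text \<open>The coproduct of \<open>w\<close> may be replaced by \<open>w \<otimes> w\<close>, which
  turns convolution powers of \<open>J\<close> into powers of \<open>w - 1\<close>. As
  \<open>f\<close> is applied to a product of the two coproduct factors, it is first decomposed into
  products \<open>g s u * f (s * v)\<close>, to which \<open>grouplike\<close> applies.\<close>

lemma env_J_grouplike:
  assumes w: "grouplike m w" and m: "1 \<le> m"
    and "linear_form f" "\<forall>u\<in>fil m. f u = 0"
  shows "f (env_J n w) = f ((w - 1) ^ n)"
  using assms(3,4)
proof (induction n arbitrary: f)
  case 0
  then show ?case using w by (simp add: env_J_0 grouplike_def)
next
  case (Suc n)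
  interpret f: Vector_Spaces.linear pscale "(*)" f by (rule Suc.prems)
  let ?J = "\<lambda>a. if a = [] then 0 else basis a :: 'p list \<Rightarrow>\<^sub>0 'k"
  let ?K = "\<lambda>u :: 'p list \<Rightarrow>\<^sub>0 'k. u - pscale (counit u) 1"
  have K: "Vector_Spaces.linear pscale pscale ?K" "?K (basis a) = ?J a" for a
    unfolding lext_reduced[symmetric] by (rule pm.linear_lext, simp)
  obtain T g where T: "finite T" "\<forall>s. linear_form (g s)" "\<forall>s\<in>T. \<forall>u\<in>fil m. g s u = 0"
    "\<forall>u v. f (u * v) = (\<Sum>s\<in>T. g s u * f (s * v))"
    by (rule Uc_product_decomposition[OF Suc.prems])
  have "f (env_J (Suc n) w) = lext (*) (\<lambda>y. f (?J (fst y) * word_J n (snd y))) (coprod w)"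
    unfolding env_J_Suc split_def pm.linear_lext_comp[OF f.linear_axioms] ..
  also have "\<dots> = lext (*) (\<lambda>y. \<Sum>s\<in>T. g s (?J (fst y)) * f (s * word_J n (snd y))) (coprod w)"
    by (rule fld.lext_cong) (rule T(4)[rule_format])
  also have "\<dots> = (\<Sum>s\<in>T. lext (*) (\<lambda>y. g s (?K (basis (fst y))) * f (s * env_J n (basis (snd y)))) (coprod w))"
    unfolding K(2) env_J_basis lext_def sum_distrib_left by (rule sum.swap)
  also have "\<dots> = (\<Sum>s\<in>T. g s (?K w) * f (s * env_J n w))"
  proof (rule sum.cong[OF refl])
    fix s assume s: "s \<in> T"
    have "linear_form (\<lambda>u. g s (?K u))" "linear_form (\<lambda>u. f (s * env_J n u))"
      using T(2) K(1) by (auto intro: linear_comp[OF K(1)] linear_comp[OF linear_comp[OF linear_env_J linear_mult_left]] Suc.prems)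
    moreover have "\<forall>u\<in>fil m. g s (?K u) = 0" using T(3) s counit_fil m by simp
    moreover have "\<forall>u\<in>fil m. f (s * env_J n u) = 0"
      using Suc.prems(2) env_J_fil fil_mult_left by blast
    ultimately have "((\<lambda>u. g s (?K u)) \<otimes>\<^bsub>Uc P\<^esub> (\<lambda>u. f (s * env_J n u))) w = g s (?K w) * f (s * env_J n w)"
      using w unfolding grouplike_def by blast
    then show "lext (*) (\<lambda>y. g s (?K (basis (fst y))) * f (s * env_J n (basis (snd y)))) (coprod w)
      = g s (?K w) * f (s * env_J n w)"
      by (simp add: Uc_simps split_def)
  qed
  also have "\<dots> = f (?K w * env_J n w)"
    by (rule T(4)[rule_format, symmetric])
  also have "?K w = w - 1"
    using w by (simp add: grouplike_def)
  also have "f ((w - 1) * env_J n w) = f ((w - 1) * (w - 1) ^ n)"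
    using Suc.prems(2) fil_mult_left
    by (intro Suc.IH[of "\<lambda>v. f ((w - 1) * v)"] linear_comp[OF linear_mult_left Suc.prems(1)]) blast
  finally show ?case by simp
qed

text \<open>On grouplike elements the dual of \<open>e\<close> is the logarithm.\<close>

lemma e_map_grouplike:
  assumes w: "grouplike m w" and m: "1 \<le> m"
    and lin: "linear_form f" and f: "\<forall>u\<in>fil m. f u = 0"
  shows "e_map P f w = f (log_trunc m w)"
proof -
  interpret f: Vector_Spaces.linear pscale "(*)" f by (rule lin)
  have Uc: "f \<in> carrier (Uc P)" using lin f by (intro UcI[of f m]) auto
  have J: "J_pow P (Suc n) f w = f ((w - 1) ^ Suc n)" for n
    unfolding J_pow[OF Uc] by (rule env_J_grouplike[OF w m lin f])
  have "w - 1 \<in> fil 1"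
    using w by (intro fil_1) (simp add: grouplike_def counit_def lookup_minus flip: basis_Nil)
  \<comment> \<open>\<open>(w - 1) ^ Suc n\<close> lies in \<open>F\<^sup>n\<^sup>+\<^sup>1\<close>,
    so the series of \<open>e\<close> ends where \<open>log_trunc\<close> stops.\<close>
  then have "f ((w - 1) ^ Suc n) = 0" if "m \<le> Suc n" for n
    using fil_power[of "w - 1" "Suc n"] fil_mono[OF that] f by blast
  then have "n \<in> {..<m - 1}" if "f ((w - 1) ^ Suc n) \<noteq> 0" for n
    using that not_less[of "Suc n" m] by fastforce
  then have "e_map P f w = (\<Sum>n\<in>{..<m - 1}. (- 1) ^ n / of_nat (Suc n) * f ((w - 1) ^ Suc n))"
    unfolding e_map_def J by (intro Sum_any.expand_superset) (auto simp del: power_Suc)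
  also have "\<dots> = (\<Sum>n\<in>{1..<m}. (- 1) ^ (n - 1) / of_nat n * f ((w - 1) ^ n))"
    by (rule sum.reindex_bij_witness[of _ "\<lambda>n. n - 1" Suc]) (auto simp del: power_Suc)
  also have "\<dots> = f (log_trunc m w)"
    by (simp add: log_trunc_def f.sum f.scale)
  finally show ?thesis .
qed

end

end

section \<open>Exponentials are grouplike\<close>

lemma basis_power: "basis [a] ^ n = (basis (replicate n a) :: 'p list \<Rightarrow>\<^sub>0 'k::field)"
proof (induction n)
  case (Suc n)
  then show ?case using basis_Cons[of a "replicate n a", where 'k = 'k] by simp
qed (simp add: basis_Nil)

text \<open>All splittings with \<open>i\<close> letters on the left coincide. Divided by
  \<open>n!\<close>, the binomial coefficient separates into \<open>1 / i!\<close> and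
  \<open>1 / (n - i)!\<close>, which makes exponentials grouplike.\<close>

lemma unshuffle_replicate:
  "unshuffle (replicate n a) \<phi>
     = (\<Sum>i\<le>n. of_nat (n choose i) * (\<phi> (replicate i a) (replicate (n - i) a) :: 'k::comm_semiring_1))"
proof (induction n arbitrary: \<phi>)
  case (Suc n)
  let ?\<psi> = "\<lambda>i j. \<phi> (replicate i a) (replicate j a)"
  have "(\<Sum>i\<le>n. of_nat (n choose i) * ?\<psi> i (Suc (n - i))) = (\<Sum>i\<le>n. of_nat (n choose i) * ?\<psi> i (Suc n - i))"
    by (rule sum.cong) (auto simp: Suc_diff_le)
  also have "\<dots> = (\<Sum>i\<le>Suc n. of_nat (n choose i) * ?\<psi> i (Suc n - i))"
    by (simp add: binomial_eq_0)
  also have "\<dots> = ?\<psi> 0 (Suc n) + (\<Sum>i\<le>n. of_nat (n choose Suc i) * ?\<psi> (Suc i) (n - i))"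
    unfolding sum.atMost_Suc_shift by simp
  finally have 1: "(\<Sum>i\<le>n. of_nat (n choose i) * ?\<psi> i (Suc (n - i)))
    = ?\<psi> 0 (Suc n) + (\<Sum>i\<le>n. of_nat (n choose Suc i) * ?\<psi> (Suc i) (n - i))" .
  have "(\<Sum>i\<le>Suc n. of_nat (Suc n choose i) * ?\<psi> i (Suc n - i))
    = ?\<psi> 0 (Suc n) + (\<Sum>i\<le>n. of_nat (Suc n choose Suc i) * ?\<psi> (Suc i) (n - i))"
    unfolding sum.atMost_Suc_shift by simp
  also have "\<dots> = (\<Sum>i\<le>n. of_nat (n choose i) * ?\<psi> (Suc i) (n - i))
      + (?\<psi> 0 (Suc n) + (\<Sum>i\<le>n. of_nat (n choose Suc i) * ?\<psi> (Suc i) (n - i)))"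
    by (simp add: distrib_right sum.distrib ac_simps)
  also have "\<dots> = unshuffle (replicate (Suc n) a) \<phi>"
    unfolding 1[symmetric] by (simp add: Suc.IH)
  finally show ?case by simp
qed simp

text \<open>The triangle \<open>i + j < M\<close> and the square \<open>i, j < M\<close> differ by
  terms with \<open>i + j \<ge> M \<ge> 2 m\<close>, where one of the indices is at least
  \<open>m\<close> and its factor is zero. This is the source of the bound
  \<open>2 * m \<le> M\<close> for grouplike exponentials.\<close>

lemma sum_convolution:
  fixes F G :: "nat \<Rightarrow> 'a::comm_semiring_0"
  assumes "\<And>i. m \<le> i \<Longrightarrow> F i = 0" "\<And>i. m \<le> i \<Longrightarrow> G i = 0" "2 * m \<le> M"
  shows "(\<Sum>n<M. \<Sum>i\<le>n. F i * G (n - i)) = sum F {..<M} * sum G {..<M}"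
proof -
  have "(\<Sum>n<M. \<Sum>i\<le>n. F i * G (n - i)) = (\<Sum>(i, j)\<in>{(i, j). i + j < M}. F i * G j)"
    by (rule sum.triangle_reindex[symmetric])
  also have "\<dots> = (\<Sum>(i, j)\<in>{..<M} \<times> {..<M}. F i * G j)"
  proof (rule sum.mono_neutral_left)
    show "\<forall>x\<in>{..<M} \<times> {..<M} - {(i, j). i + j < M}. (case x of (i, j) \<Rightarrow> F i * G j) = 0"
    proof
      fix x assume "x \<in> {..<M} \<times> {..<M} - {(i, j). i + j < M}"
      then have "m \<le> fst x \<or> m \<le> snd x" using assms(3) by auto
      then show "(case x of (i, j) \<Rightarrow> F i * G j) = 0" using assms(1,2) by (auto simp: split_def)
    qed
  qed auto
  also have "\<dots> = sum F {..<M} * sum G {..<M}"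
    by (simp add: sum_product sum.cartesian_product)
  finally show ?thesis .
qed

definition exp_trunc :: "nat \<Rightarrow> 'p \<Rightarrow> ('p list \<Rightarrow>\<^sub>0 'k::field_char_0)" where
  "exp_trunc m a = (\<Sum>n<m. pscale (1 / fact n) (basis [a] ^ n))"

lemma exp_trunc_replicate: "exp_trunc m a = (\<Sum>n<m. pscale (1 / fact n) (basis (replicate n a)))"
  by (simp add: exp_trunc_def basis_power)

lemma counit_exp_trunc:
  assumes m: "1 \<le> m"
  shows "counit (exp_trunc m a :: 'a list \<Rightarrow>\<^sub>0 'b::field_char_0) = 1"
proof -
  interpret l: Vector_Spaces.linear pscale "(*)" "counit :: ('a list \<Rightarrow>\<^sub>0 'b) \<Rightarrow> 'b" by (rule linear_counit)
  have "counit (exp_trunc m a :: 'a list \<Rightarrow>\<^sub>0 'b) = (\<Sum>n<m. if n = 0 then 1 else 0)"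
    unfolding exp_trunc_replicate l.sum by (rule sum.cong) (auto simp: counit_pscale counit_basis)
  then show ?thesis using m by simp
qed

lemma Uc_mult_linear: "linear_form (f \<otimes>\<^bsub>Uc P\<^esub> g)"
  unfolding Uc_simps by (rule fld.linear_lext_coprod)

lemma Uc_mult_basis: "(f \<otimes>\<^bsub>Uc P\<^esub> g) (basis w) = unshuffle w (\<lambda>a b. f (basis a) * g (basis b))"
  by (simp add: Uc_simps fld.lext_coprod_basis)

lemma Uc_mult_word_star:
  assumes f: "linear_form f" and g: "linear_form g"
  shows "(f \<otimes>\<^bsub>Uc P\<^esub> g) (word_star tr w v)
    = unshuffle w (\<lambda>a b. unshuffle v (\<lambda>c d. f (word_star tr a c) * g (word_star tr b d)))"
proof -
  have tens: "lext (*) (\<lambda>(u1, u2). f (basis u1) * g (basis u2)) (tens A B) = f A * g B" for A B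
  proof (rule fld.bilinear_eq[where f = "\<lambda>A B. lext (*) (\<lambda>(u1, u2). f (basis u1) * g (basis u2)) (tens A B)"])
    interpret f: Vector_Spaces.linear pscale "(*)" f by (rule f)
    interpret g: Vector_Spaces.linear pscale "(*)" g by (rule g)
    show "linear_form (\<lambda>A. f A * g B)" for B
      by (rule linear_formI) (simp_all add: f.add f.scale algebra_simps)
    show "linear_form (\<lambda>B. f A * g B)" for A
      by (rule linear_formI) (simp_all add: g.add g.scale algebra_simps)
  qed (auto intro: linear_comp[OF linear_tens_left fld.linear_lext] linear_comp[OF linear_tens_right fld.linear_lext])
  show ?thesis
    unfolding Uc_simps coprod_word_star unshuffle_linear[OF fld.linear_lext] tens ..
qed

context complete_filtered_post_lie_algebra
begin

lemma replicate_fil: "m \<le> i \<Longrightarrow> basis (replicate i a) \<in> fil m"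
  using word_fil[OF weight_ge_mono[OF weight_ge_length[of "replicate i a"]]] by simp

lemma grouplike_exp_trunc:
  assumes "1 \<le> m" "2 * m \<le> M"
  shows "grouplike m (exp_trunc M a)"
  unfolding grouplike_def
proof (intro conjI allI impI)
  show "counit (exp_trunc M a) = 1" using assms by (intro counit_exp_trunc) simp
  fix f g assume f: "linear_form f" "\<forall>u\<in>fil m. f u = 0"
    and g: "linear_form g" "\<forall>u\<in>fil m. g u = 0"
  interpret f: Vector_Spaces.linear pscale "(*)" f by (rule f)
  interpret g: Vector_Spaces.linear pscale "(*)" g by (rule g)
  interpret fg: Vector_Spaces.linear pscale "(*)" "f \<otimes>\<^bsub>Uc P\<^esub> g" by (rule Uc_mult_linear)
  let ?F = "\<lambda>i. f (basis (replicate i a)) / fact i" and ?G = "\<lambda>i. g (basis (replicate i a)) / fact i"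
  have "(f \<otimes>\<^bsub>Uc P\<^esub> g) (exp_trunc M a) = (\<Sum>n<M. \<Sum>i\<le>n. ?F i * ?G (n - i))"
    unfolding exp_trunc_replicate fg.sum fg.scale Uc_mult_basis unshuffle_replicate sum_distrib_left
    by (intro sum.cong refl) (simp add: binomial_fact)
  also have "\<dots> = sum ?F {..<M} * sum ?G {..<M}"
    using f(2) g(2) replicate_fil by (intro sum_convolution[of m]) (simp_all add: assms)
  also have "\<dots> = f (exp_trunc M a) * g (exp_trunc M a)"
    unfolding exp_trunc_replicate f.sum g.sum f.scale g.scale by simp
  finally show "(f \<otimes>\<^bsub>Uc P\<^esub> g) (exp_trunc M a) = f (exp_trunc M a) * g (exp_trunc M a)" .
qed

lemma env_star_exp_trunc: "env_star P (exp_trunc M a) (exp_trunc M b)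
    = (\<Sum>p<M. \<Sum>q<M. pscale (1 / (fact p * fact q)) (word_star (tri P) (replicate p a) (replicate q b)))"
proof -
  interpret l: Vector_Spaces.linear pscale pscale "\<lambda>A. env_star P A B" for B by (rule linear_env_star_left)
  interpret r: Vector_Spaces.linear pscale pscale "env_star P A" for A by (rule linear_env_star_right)
  show ?thesis
    unfolding exp_trunc_replicate l.sum l.scale
    unfolding r.sum r.scale env_star_basis pm.scale_sum_right pm.scale_scale by simp
qed

text \<open>A product of two words that are not both empty lies in \<open>F\<^sup>1\<close>, where
  the counit vanishes.\<close>

lemma counit_env_star: "counit (env_star P A B) = counit A * counit B"
proof (rule fld.bilinear_eq[where f = "\<lambda>A B. counit (env_star P A B)" and g = "\<lambda>A B. counit A * counit B"])
  show "linear_form (\<lambda>A. counit A * counit B)" for B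
    by (rule linear_formI)
      (simp_all add: counit_add counit_pscale algebra_simps)
  show "linear_form (\<lambda>B. counit A * counit B)" for A
    by (rule linear_formI)
      (simp_all add: counit_add counit_pscale algebra_simps)
  show "counit (env_star P (basis a) (basis b)) = counit (basis a) * counit (basis b)" for a b
  proof (cases "a = [] \<and> b = []")
    case True
    then show ?thesis by (simp add: env_star_basis word_star_def counit_basis)
  next
    case False
    have "env_star P (basis a) (basis b) \<in> fil (length a + length b)"
      by (intro fil_star word_fil weight_ge_length)
    then have "counit (env_star P (basis a) (basis b)) = 0"
      using False by (intro counit_fil) (auto simp: Suc_le_eq)
    then show ?thesis using False by (auto simp: counit_basis)
  qed
qed (rule linear_comp[OF linear_env_star_left linear_counit] linear_comp[OF linear_env_star_right linear_counit])+

text \<open>\<open>*\<close> is a coalgebra map, so the pairing is a Cauchy product in the exponents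
  of \<open>a\<close> and of \<open>b\<close> at once; \<open>sum_convolution\<close> is applied to
  the inner and then to the outer one.\<close>

lemma grouplike_env_star:
  assumes "1 \<le> m" "2 * m \<le> M"
  shows "grouplike m (env_star P (exp_trunc M a) (exp_trunc M b))"
  unfolding grouplike_def
proof (intro conjI allI impI)
  show "counit (env_star P (exp_trunc M a) (exp_trunc M b)) = 1"
    using assms by (simp add: counit_env_star counit_exp_trunc)
  fix f g assume f: "linear_form f" "\<forall>u\<in>fil m. f u = 0"
    and g: "linear_form g" "\<forall>u\<in>fil m. g u = 0"
  interpret f: Vector_Spaces.linear pscale "(*)" f by (rule f)
  interpret g: Vector_Spaces.linear pscale "(*)" g by (rule g)
  interpret fg: Vector_Spaces.linear pscale "(*)" "f \<otimes>\<^bsub>Uc P\<^esub> g" by (rule Uc_mult_linear)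
  let ?s = "\<lambda>i k. word_star (tri P) (replicate i a) (replicate k b) :: 'p list \<Rightarrow>\<^sub>0 'k"
  let ?F = "\<lambda>i k. f (?s i k) / (fact i * fact k)" and ?G = "\<lambda>i k. g (?s i k) / (fact i * fact k)"
  \<comment> \<open>\<open>*\<close> adds filtration degrees, so either exponent alone is
    enough.\<close>
  have s: "?s i k \<in> fil m" if "m \<le> i \<or> m \<le> k" for i k
  proof -
    have "?s i k \<in> fil (i + k)"
      using fil_star[OF replicate_fil[OF order_refl] replicate_fil[OF order_refl]]
      by (simp add: env_star_basis)
    then show ?thesis using that fil_mono[of m "i + k"] by auto
  qed
  have F: "?F i k = 0" "?G i k = 0" if "m \<le> i \<or> m \<le> k" for i k
    using s[OF that] f(2) g(2) by simp_all
  have "(f \<otimes>\<^bsub>Uc P\<^esub> g) (env_star P (exp_trunc M a) (exp_trunc M b))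
    = (\<Sum>p<M. \<Sum>q<M. \<Sum>i\<le>p. \<Sum>k\<le>q. ?F i k * ?G (p - i) (q - k))"
    unfolding env_star_exp_trunc fg.sum fg.scale Uc_mult_word_star[OF f(1) g(1)] unshuffle_replicate sum_distrib_left
    by (intro sum.cong refl) (simp add: binomial_fact)
  also have "\<dots> = (\<Sum>p<M. \<Sum>i\<le>p. \<Sum>q<M. \<Sum>k\<le>q. ?F i k * ?G (p - i) (q - k))"
    by (rule sum.cong[OF refl], rule sum.swap)
  also have "\<dots> = (\<Sum>p<M. \<Sum>i\<le>p. sum (?F i) {..<M} * sum (?G (p - i)) {..<M})"
    by (intro sum.cong refl sum_convolution[of m] F assms) auto
  also have "\<dots> = (\<Sum>i<M. sum (?F i) {..<M}) * (\<Sum>i<M. sum (?G i) {..<M})"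
    by (rule sum_convolution[of m]) (auto intro!: sum.neutral F assms)
  also have "\<dots> = f (env_star P (exp_trunc M a) (exp_trunc M b)) * g (env_star P (exp_trunc M a) (exp_trunc M b))"
    unfolding env_star_exp_trunc f.sum g.sum f.scale g.scale by simp
  finally show "(f \<otimes>\<^bsub>Uc P\<^esub> g) (env_star P (exp_trunc M a) (exp_trunc M b))
    = f (env_star P (exp_trunc M a) (exp_trunc M b)) * g (env_star P (exp_trunc M a) (exp_trunc M b))" .
qed

section \<open>Logarithms\<close>

lemma fil_cong_mult: "a - a' \<in> fil m \<Longrightarrow> b - b' \<in> fil m \<Longrightarrow> a * b - a' * b' \<in> fil m"
proof -
  assume "a - a' \<in> fil m" "b - b' \<in> fil m"
  then have "(a - a') * b + a' * (b - b') \<in> fil m"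
    by (intro pm.subspace_add[OF subspace_fil] fil_mult_left fil_mult_right)
  then show "a * b - a' * b' \<in> fil m" by (simp add: algebra_simps)
qed

lemma fil_cong_power: "a - a' \<in> fil m \<Longrightarrow> a ^ n - a' ^ n \<in> fil m"
  by (induction n) (auto simp: pm.subspace_0 intro: fil_cong_mult)

lemma fil_cong_sum:
  "(\<And>i. i \<in> A \<Longrightarrow> h i - h' i \<in> fil m) \<Longrightarrow> (\<Sum>i\<in>A. pscale (c i) (h i)) - (\<Sum>i\<in>A. pscale (c i) (h' i)) \<in> fil m"
  unfolding sum_subtractf[symmetric] pm.scale_right_diff_distrib[symmetric]
  by (intro pm.subspace_sum[OF subspace_fil] pm.subspace_scale[OF subspace_fil])

lemma log_trunc_cong: "w - w' \<in> fil m \<Longrightarrow> log_trunc n w - log_trunc n w' \<in> fil m"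
  unfolding log_trunc_def by (intro fil_cong_sum fil_cong_power) simp

lemma log_trunc_le:
  assumes "w - 1 \<in> fil 1" "m \<le> M"
  shows "log_trunc M w - log_trunc m w \<in> fil m"
proof -
  have "log_trunc M w = log_trunc m w + (\<Sum>n\<in>{1..<M} - {1..<m}. pscale ((- 1) ^ (n - 1) / of_nat n) ((w - 1) ^ n))"
    unfolding log_trunc_def using assms(2)
    by (subst add.commute, intro sum.subset_diff) auto
  moreover have "(\<Sum>n\<in>{1..<M} - {1..<m}. pscale ((- 1) ^ (n - 1) / of_nat n) ((w - 1) ^ n)) \<in> fil m"
    by (intro pm.subspace_sum[OF subspace_fil] pm.subspace_scale[OF subspace_fil])
      (auto intro!: subsetD[OF fil_mono fil_power[OF assms(1)]])
  ultimately show ?thesis by simp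
qed

text \<open>Substituting \<open>[a]\<close> into power series cut off at order \<open>M\<close> is
  multiplicative modulo \<open>F\<^sup>M\<close>; this is \<open>\<phi>\<close>. It carries over
  from formal power series that \<open>ln (1 + X)\<close> and \<open>exp X - 1\<close> are inverse
  under composition.\<close>

lemma log_exp_trunc:
  assumes M: "2 \<le> M"
  shows "log_trunc M (exp_trunc M a) - basis [a] \<in> fil M"
proof -
  define \<phi> :: "'k fps \<Rightarrow> 'p list \<Rightarrow>\<^sub>0 'k" where "\<phi> F = (\<Sum>n<M. pscale (fps_nth F n) (basis [a] ^ n))" for F
  have a1: "basis [a] \<in> fil 1" by (intro fil_1) (simp add: counit_basis)
  have \<phi>_mult: "\<phi> (F * G) - \<phi> F * \<phi> G \<in> fil M" for F G
  proof -
    let ?t = "\<lambda>i j. pscale (fps_nth F i * fps_nth G j) (basis [a] ^ (i + j))"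
    have "\<phi> (F * G) = (\<Sum>n<M. \<Sum>i\<le>n. ?t i (n - i))"
      by (simp add: \<phi>_def fps_mult_nth pm.scale_sum_left atMost_atLeast0)
    also have "\<dots> = (\<Sum>(i, j)\<in>{(i, j). i + j < M}. ?t i j)"
      by (rule sum.triangle_reindex[symmetric])
    finally have 1: "\<phi> (F * G) = (\<Sum>(i, j)\<in>{(i, j). i + j < M}. ?t i j)" .
    have "\<phi> F * \<phi> G = (\<Sum>(i, j)\<in>{..<M} \<times> {..<M}. ?t i j)"
      by (simp add: \<phi>_def sum_product pscale_mult_left pscale_mult_right sum.cartesian_product power_add mult.commute)
    also have "\<dots> = (\<Sum>(i, j)\<in>{..<M} \<times> {..<M} - {(i, j). i + j < M}. ?t i j) + \<phi> (F * G)"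
      unfolding 1 by (rule sum.subset_diff) auto
    finally have "\<phi> (F * G) - \<phi> F * \<phi> G = - (\<Sum>(i, j)\<in>{..<M} \<times> {..<M} - {(i, j). i + j < M}. ?t i j)"
      by simp
    also have "\<dots> \<in> fil M"
    proof (rule pm.subspace_neg[OF subspace_fil], rule pm.subspace_sum[OF subspace_fil])
      fix x assume "x \<in> {..<M} \<times> {..<M} - {(i, j). i + j < M}"
      then have "M \<le> fst x + snd x" by auto
      then have "basis [a] ^ (fst x + snd x) \<in> fil M" using fil_power[OF a1] fil_mono by blast
      then show "(case x of (i, j) \<Rightarrow> ?t i j) \<in> fil M"
        by (simp add: split_def pm.subspace_scale[OF subspace_fil])
    qed
    finally show ?thesis .
  qed
  have \<phi>_1: "\<phi> 1 = 1"
  proof -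
    have "\<phi> 1 = (\<Sum>n\<in>{0}. pscale (fps_nth 1 n) (basis [a] ^ n))"
      unfolding \<phi>_def by (rule sum.mono_neutral_right) (use M in auto)
    then show ?thesis by simp
  qed
  have \<phi>_power: "\<phi> F ^ n - \<phi> (F ^ n) \<in> fil M" for F n
  proof (induction n)
    case 0
    then show ?case by (simp add: \<phi>_1 pm.subspace_0)
  next
    case (Suc n)
    have "\<phi> F * (\<phi> F ^ n - \<phi> (F ^ n)) - (\<phi> (F * F ^ n) - \<phi> F * \<phi> (F ^ n)) \<in> fil M"
      by (intro pm.subspace_diff[OF subspace_fil] fil_mult_left Suc \<phi>_mult)
    then show ?case by (simp add: algebra_simps)
  qed
  let ?X = "fps_exp 1 - 1 :: 'k fps"
  have X0: "fps_nth ?X 0 = 0" by simp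
  have "exp_trunc M a = \<phi> (fps_exp 1)" by (simp add: exp_trunc_def \<phi>_def)
  then have E: "exp_trunc M a - 1 = \<phi> ?X"
    using \<phi>_1 by (simp add: \<phi>_def pm.scale_left_diff_distrib sum_subtractf)
  have "fps_ln 1 oo ?X = fps_X"
    using fps_inv[of ?X] by (simp add: fps_ln_fps_exp_inv)
  \<comment> \<open>Coefficients of the composite. The sum may run up to \<open>M\<close> because
    \<open>?X ^ i\<close> starts in degree \<open>i\<close>, and from 1 because the logarithm has
    constant term zero.\<close>
  then have co: "(\<Sum>i\<in>{1..<M}. fps_nth (fps_ln 1) i * fps_nth (?X ^ i) n) = fps_nth fps_X n" if "n < M" for n
  proof -
    have "fps_nth fps_X n = (\<Sum>i\<in>{0..n}. fps_nth (fps_ln 1) i * fps_nth (?X ^ i) n)"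
      using \<open>fps_ln 1 oo ?X = fps_X\<close> by (simp add: fps_compose_nth[symmetric])
    also have "\<dots> = (\<Sum>i\<in>{0..<M}. fps_nth (fps_ln 1) i * fps_nth (?X ^ i) n)"
      using that startsby_zero_power_prefix[OF X0] by (intro sum.mono_neutral_left) auto
    also have "\<dots> = (\<Sum>i\<in>{1..<M}. fps_nth (fps_ln 1) i * fps_nth (?X ^ i) n)"
      by (rule sum.mono_neutral_right) (auto simp: Suc_le_eq)
    finally show ?thesis ..
  qed
  have "log_trunc M (exp_trunc M a) = (\<Sum>i\<in>{1..<M}. pscale (fps_nth (fps_ln 1) i) (\<phi> ?X ^ i))"
    unfolding log_trunc_def E by (rule sum.cong) (simp_all add: fps_ln_nth)
  moreover have "(\<Sum>i\<in>{1..<M}. pscale (fps_nth (fps_ln 1) i) (\<phi> ?X ^ i))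
      - (\<Sum>i\<in>{1..<M}. pscale (fps_nth (fps_ln 1) i) (\<phi> (?X ^ i))) \<in> fil M"
    by (intro fil_cong_sum \<phi>_power)
  moreover have "(\<Sum>i\<in>{1..<M}. pscale (fps_nth (fps_ln 1) i) (\<phi> (?X ^ i))) = basis [a]"
  proof -
    have "(\<Sum>i\<in>{1..<M}. pscale (fps_nth (fps_ln 1) i) (\<phi> (?X ^ i)))
      = (\<Sum>n<M. pscale (\<Sum>i\<in>{1..<M}. fps_nth (fps_ln 1) i * fps_nth (?X ^ i) n) (basis [a] ^ n))"
      unfolding \<phi>_def pm.scale_sum_right pm.scale_sum_left pm.scale_scale by (rule sum.swap)
    also have "\<dots> = (\<Sum>n<M. pscale (fps_nth fps_X n) (basis [a] ^ n))"
      by (rule sum.cong[OF refl]) (simp only: lessThan_iff co)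
    also have "\<dots> = (\<Sum>n\<in>{1}. pscale (fps_nth fps_X n) (basis [a] ^ n))"
      by (rule sum.mono_neutral_right) (use M in auto)
    finally show ?thesis by simp
  qed
  ultimately show ?thesis by simp
qed

text \<open>The completed operations are computed on arbitrary representatives. At level
  \<open>M\<close> these may be replaced by truncated exponentials, since powers, \<open>*\<close>
  and the truncated logarithm respect congruence modulo \<open>F\<^sup>M\<close>.\<close>

lemma sharp_log:
  assumes sh: "is_sharp P sh"
  shows "log_trunc M (env_star P (exp_trunc M a) (exp_trunc M b)) - basis [sh a b] \<in> fil M"
proof -
  define ha where "ha c = rep (hat_incl P c M)" for c
  define he where "he c = rep (hat_exp P (hat_incl P c) M)" for c
  define hs where "hs = rep (hat_star P (hat_exp P (hat_incl P a)) (hat_exp P (hat_incl P b)) M)"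
  have ha: "ha c - basis [c] \<in> fil M" for c
    unfolding ha_def hat_incl_def hat_class_def by (rule rep_coset_diff) simp
  have he: "he c - exp_trunc M c \<in> fil M" for c
  proof -
    have 1: "he c - (\<Sum>n<M. pscale (1 / fact n) (ha c ^ n)) \<in> fil M"
      unfolding he_def hat_exp_def hat_class_def ha_def by (rule rep_coset_diff) simp
    have 2: "(\<Sum>n<M. pscale (1 / fact n) (ha c ^ n)) - exp_trunc M c \<in> fil M"
      unfolding exp_trunc_def by (intro fil_cong_sum fil_cong_power ha)
    show ?thesis using pm.subspace_add[OF subspace_fil 1 2] by simp
  qed
  have hs: "hs - env_star P (exp_trunc M a) (exp_trunc M b) \<in> fil M"
  proof -
    interpret l: Vector_Spaces.linear pscale pscale "\<lambda>A. env_star P A B" for B by (rule linear_env_star_left)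
    interpret r: Vector_Spaces.linear pscale pscale "env_star P A" for A by (rule linear_env_star_right)
    have 1: "hs - env_star P (he a) (he b) \<in> fil M"
      unfolding hs_def hat_star_def hat_class_def he_def by (rule rep_coset_diff) simp
    have 2: "env_star P (he a - exp_trunc M a) (he b) \<in> fil M"
      using fil_star[OF he fil_0] by simp
    have 3: "env_star P (exp_trunc M a) (he b - exp_trunc M b) \<in> fil M"
      using fil_star[OF fil_0 he] by simp
    show ?thesis
      using pm.subspace_add[OF subspace_fil 1 pm.subspace_add[OF subspace_fil 2 3]]
      by (simp add: l.diff r.diff)
  qed
  have "hat_incl P (sh a b) M = hat_log P (hat_star P (hat_exp P (hat_incl P a)) (hat_exp P (hat_incl P b))) M"
    using sh unfolding is_sharp_def by simp
  then have "basis [sh a b] +o fil M = log_trunc M hs +o fil M"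
    unfolding hat_incl_def hat_log_def hat_class_def log_trunc_def hs_def .
  then have "basis [sh a b] - log_trunc M hs \<in> fil M"
    by (simp add: coset_eq_iff)
  moreover have "log_trunc M hs - log_trunc M (env_star P (exp_trunc M a) (exp_trunc M b)) \<in> fil M"
    by (rule log_trunc_cong[OF hs])
  ultimately have "- ((basis [sh a b] - log_trunc M hs)
      + (log_trunc M hs - log_trunc M (env_star P (exp_trunc M a) (exp_trunc M b)))) \<in> fil M"
    by (intro pm.subspace_neg[OF subspace_fil] pm.subspace_add[OF subspace_fil])
  then show ?thesis by simp
qed

end

text \<open>A polynomial that vanishes at all points of an infinite field is zero. It serves to
  extract homogeneous parts from an identity that holds for every value of a scalar
  parameter.\<close>

lemma power_sum_zero_coeffs:
  fixes x :: "nat \<Rightarrow> 'k::field_char_0"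
  assumes "\<And>c. (\<Sum>i<n. c ^ i * x i) = 0" "i < n"
  shows "x i = 0"
proof -
  let ?p = "\<Sum>i<n. monom (x i) i"
  have "poly ?p c = 0" for c
    using assms(1)[of c] by (simp add: poly_sum poly_monom mult.commute)
  then have "?p = 0" by (simp add: poly_all_0_iff_0[symmetric])
  then have "coeff ?p i = 0" by simp
  then show ?thesis using assms(2) by (simp add: coeff_sum if_distrib cong: if_cong)
qed

context complete_filtered_post_lie_algebra
begin

section \<open>Exponentials span the enveloping algebra\<close>

context
  fixes f :: "('p list \<Rightarrow>\<^sub>0 'k) \<Rightarrow> 'k" and m :: nat
  assumes lin: "linear_form f" and f: "\<And>u. u \<in> fil m \<Longrightarrow> f u = 0"
    and exp: "\<And>a. f (exp_trunc m a) = 0"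
begin

interpretation f: Vector_Spaces.linear pscale "(*)" f by (rule lin)

lemma annihilator_cong: "u - v \<in> env_ideal P {0} \<Longrightarrow> f u = f v"
  using f[OF env_ideal_fil] f.diff[of u v] by fastforce

text \<open>The value of \<open>f\<close> at the truncated exponential of \<open>c a\<close> is a
  polynomial in \<open>c\<close> with coefficients \<open>f (a\<^sup>n) / n!\<close>, and it
  vanishes identically.\<close>

lemma annihilator_power: "f (basis (replicate n a)) = 0"
proof (cases "n < m")
  case True
  have "f (basis (replicate n a)) / fact n = 0"
  proof (rule power_sum_zero_coeffs[OF _ True])
    fix c :: 'k
    have "f (basis (replicate n (scal P c a))) = c ^ n * f (basis (replicate n a))" for n
    proof -
      have "basis [scal P c a] ^ n - pscale c (basis [a]) ^ n \<in> fil m"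
        using fil_cong_power[OF env_ideal_fil[OF rels_in_ideal[OF rels_scale]]] .
      then have "f (basis [scal P c a] ^ n - pscale c (basis [a]) ^ n) = 0" by (rule f)
      moreover have "pscale c (u :: 'p list \<Rightarrow>\<^sub>0 'k) ^ n = pscale (c ^ n) (u ^ n)" for u
        by (induction n) (simp_all add: pscale_mult_left pscale_mult_right)
      ultimately show ?thesis by (simp add: f.diff f.scale basis_power)
    qed
    then show "(\<Sum>n<m. c ^ n * (f (basis (replicate n a)) / fact n)) = 0"
      using exp[of "scal P c a"] by (simp add: exp_trunc_replicate f.sum f.scale)
  qed
  then show ?thesis by simp
next
  case False
  then have "weight_ge (replicate n a) m" by (intro weight_ge_mono[OF weight_ge_length]) simp
  then show ?thesis by (intro f word_fil)
qed

lemma annihilator_add: "f (basis (u @ (x + y) # v)) = f (basis (u @ x # v)) + f (basis (u @ y # v))"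
proof -
  have "basis u * (basis [x + y] - basis [x] - basis [y]) * basis v \<in> env_ideal P {0}"
    by (intro env_ideal_mult_left env_ideal_mult_right rels_in_ideal rels_add)
  also have "basis u * (basis [x + y] - basis [x] - basis [y]) * basis v
      = basis (u @ (x + y) # v) - (basis (u @ x # v) + basis (u @ y # v))"
    by (simp only: basis_append basis_Cons[of _ v] algebra_simps)
  finally show ?thesis using annihilator_cong f.add by metis
qed

lemma annihilator_scale: "f (basis (u @ scal P c x # v)) = c * f (basis (u @ x # v))"
proof -
  have "basis u * (basis [scal P c x] - pscale c (basis [x])) * basis v \<in> env_ideal P {0}"
    by (intro env_ideal_mult_left env_ideal_mult_right rels_in_ideal rels_scale)
  also have "basis u * (basis [scal P c x] - pscale c (basis [x])) * basis v
      = basis (u @ scal P c x # v) - pscale c (basis (u @ x # v))"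
    by (simp only: basis_append basis_Cons[of _ v] left_diff_distrib right_diff_distrib mult.assoc
        pscale_mult_left pscale_mult_right)
  finally show ?thesis using annihilator_cong f.scale by metis
qed

text \<open>The outer induction makes \<open>f\<close> symmetric in the letters of words of length
  \<open>n\<close>. The inner one, on the length of \<open>u\<close>, shows that \<open>f\<close>
  kills every \<open>x\<^sup>k u\<close>: replace \<open>x\<close> by \<open>c y + x\<close> in
  \<open>x\<^sup>k\<^sup>+\<^sup>1 v\<close> and take the coefficient of \<open>c\<close>, which is
  \<open>k + 1\<close> times the value at \<open>y x\<^sup>k v\<close>.\<close>

lemma annihilator_word: "f (basis w) = 0"
proof (induction "length w" arbitrary: w rule: less_induct)
  case less
  define n where "n = length w"
  have IH: "f (basis v) = 0" if "length v < n" for v using less that by (simp add: n_def)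
  have swap: "f (basis (u @ x # y # v)) = f (basis (u @ y # x # v))" if "length u + length v + 2 = n" for u v x y
  proof -
    have "basis u * (basis [x] * basis [y] - basis [y] * basis [x] - basis [brk P x y]) * basis v \<in> env_ideal P {0}"
      by (intro env_ideal_mult_left env_ideal_mult_right rels_in_ideal rels_brk)
    also have "basis u * (basis [x] * basis [y] - basis [y] * basis [x] - basis [brk P x y]) * basis v
      = basis (u @ x # y # v) - (basis (u @ y # x # v) + basis (u @ brk P x y # v))"
      by (simp only: basis_append basis_Cons[of _ v] basis_Cons[of _ "_ # _"] algebra_simps)
    finally have "f (basis (u @ x # y # v)) = f (basis (u @ y # x # v)) + f (basis (u @ brk P x y # v))"
      using annihilator_cong f.add by metis
    then show ?thesis using IH[of "u @ brk P x y # v"] that by simp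
  qed
  have move: "f (basis (u @ x # v @ r)) = f (basis (u @ v @ x # r))" if "length u + length v + length r + 1 = n" for u v r x
    using that
  proof (induction v arbitrary: u)
    case (Cons y v)
    have "f (basis (u @ x # y # v @ r)) = f (basis (u @ y # x # v @ r))"
      using Cons.prems by (intro swap) simp
    also have "\<dots> = f (basis ((u @ [y]) @ x # v @ r))" by simp
    also have "\<dots> = f (basis ((u @ [y]) @ v @ x # r))"
      using Cons.prems by (intro Cons.IH) simp
    finally show ?case by simp
  qed simp
  \<comment> \<open>The word of units only records, factor by factor, whether \<open>y\<close> or
    \<open>x\<close> is chosen; \<open>unshuffle_replicate\<close> then supplies the binomial
    coefficients.\<close>
  have expand: "f (basis (replicate j (scal P c y + x) @ v))
      = unshuffle (replicate j ()) (\<lambda>a b. c ^ length a * f (basis (replicate (length a) y @ replicate (length b) x @ v)))"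
    if "j + length v = n" for j c x y v
    using that
  proof (induction j arbitrary: v)
    case (Suc j)
    let ?z = "scal P c y + x"
    let ?U = "\<lambda>v. unshuffle (replicate j ()) (\<lambda>a b. c ^ length a * f (basis (replicate (length a) y @ replicate (length b) x @ v)))"
    have "f (basis (replicate (Suc j) ?z @ v)) = c * f (basis (y # replicate j ?z @ v)) + f (basis (x # replicate j ?z @ v))"
      using annihilator_add[of "[]"] annihilator_scale[of "[]"] by simp
    also have "\<dots> = c * f (basis (replicate j ?z @ y # v)) + f (basis (replicate j ?z @ x # v))"
      using move[of "[]" "replicate j ?z" v] Suc.prems by simp
    also have "\<dots> = c * ?U (y # v) + ?U (x # v)"
      using Suc.IH[of "y # v"] Suc.IH[of "x # v"] Suc.prems by simp
    also have "c * ?U (y # v) = unshuffle (replicate j ()) (\<lambda>a b. c ^ length (() # a) *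
        f (basis (replicate (length (() # a)) y @ replicate (length b) x @ v)))"
      unfolding unshuffle_linear[OF fld.linear_scale_self]
    proof (rule unshuffle_cong)
      fix a b :: "unit list" assume "length a + length b = length (replicate j ())"
      then show "c * (c ^ length a * f (basis (replicate (length a) y @ replicate (length b) x @ y # v)))
        = c ^ length (() # a) * f (basis (replicate (length (() # a)) y @ replicate (length b) x @ v))"
        using move[of "[]" "replicate (length a) y @ replicate (length b) x" v y] Suc.prems by simp
    qed
    also have "?U (x # v) = unshuffle (replicate j ()) (\<lambda>a b. c ^ length a *
        f (basis (replicate (length a) y @ replicate (length (() # b)) x @ v)))"
      by (rule unshuffle_cong) (simp add: replicate_app_Cons_same)
    finally show ?case by simp
  qed simp
  have "f (basis (replicate k x @ u)) = 0" if "k + length u = n" for k x u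
    using that
  proof (induction "length u" arbitrary: k u x)
    case 0
    then show ?case by (simp add: annihilator_power)
  next
    case (Suc l)
    then obtain y v where u: "u = y # v" "length v = l" by (cases u) auto
    have j: "Suc k + length v = n" using Suc.prems u by simp
    let ?c = "\<lambda>i. of_nat (Suc k choose i) * f (basis (replicate i y @ replicate (Suc k - i) x @ v))"
    have "?c 1 = 0"
    proof (rule power_sum_zero_coeffs[where n = "Suc (Suc k)" and x = ?c and i = 1])
      fix c :: 'k
      have "0 = f (basis (replicate (Suc k) (scal P c y + x) @ v))"
        using Suc.hyps(1)[of v "Suc k"] u j by simp
      also have "\<dots> = (\<Sum>i\<le>Suc k. of_nat (Suc k choose i) * (c ^ i * f (basis (replicate i y @ replicate (Suc k - i) x @ v))))"
        unfolding expand[OF j] unshuffle_replicate by simp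
      also have "\<dots> = (\<Sum>i<Suc (Suc k). c ^ i * ?c i)"
        unfolding lessThan_Suc_atMost by (intro sum.cong refl) (simp only: mult.left_commute)
      finally show "(\<Sum>i<Suc (Suc k). c ^ i * ?c i) = 0" ..
    qed simp
    then have "f (basis ([] @ y # replicate k x @ v)) = 0"
      by (simp del: of_nat_Suc)
    then show ?case using move[of "[]" "replicate k x" v y] j u by simp
  qed
  from this[of 0 w] show ?case by (simp add: n_def)
qed

lemma exp_dense: "f u = 0"
proof -
  have "f u \<in> {0}"
    by (rule linear_in_span[OF lin span_range_basis]) (auto simp: annihilator_word)
  then show ?thesis by simp
qed

end

lemma exp_dense_bilinear:
  assumes "\<And>v. linear_form (\<lambda>u. B u v)" "\<And>u. linear_form (B u)"
    and "\<And>u v. u \<in> fil m \<Longrightarrow> B u v = 0" "\<And>u v. v \<in> fil m \<Longrightarrow> B u v = 0"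
    and "\<And>a b. B (exp_trunc m a) (exp_trunc m b) = 0"
  shows "B u v = 0"
proof (rule exp_dense[where f = "B u"])
  show "B u (exp_trunc m b) = 0" for b
    by (rule exp_dense[where f = "\<lambda>u. B u (exp_trunc m b)"]) (use assms in auto)
qed (use assms in auto)

section \<open>The symmetric algebra and the evaluation of \<open>\<psi>\<close>\<close>

lemma Q_dual_add: "q \<in> Q_dual P \<Longrightarrow> q' \<in> Q_dual P \<Longrightarrow> (\<lambda>x. q x + q' x) \<in> Q_dual P"
  unfolding Q_dual_def
proof safe
  fix p p' assume "Vector_Spaces.linear (scal P) (*) q" "Vector_Spaces.linear (scal P) (*) q'"
  then interpret q: Vector_Spaces.linear "scal P" "(*)" q + q': Vector_Spaces.linear "scal P" "(*)" q' .
  show "Vector_Spaces.linear (scal P) (*) (\<lambda>x. q x + q' x)"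
    by (rule linearI[OF scal_vector_space fld.vector_space_axioms]) (simp_all add: q.add q'.add q.scale q'.scale algebra_simps)
  assume p: "1 \<le> p" "\<forall>x\<in>Fil P p. q x = 0" "1 \<le> p'" "\<forall>x\<in>Fil P p'. q' x = 0"
  have "Fil P (max p p') \<subseteq> Fil P p" "Fil P (max p p') \<subseteq> Fil P p'"
    using Fil_mono[of p "max p p'"] Fil_mono[of p' "max p p'"] p by simp_all
  then show "\<exists>p\<ge>1. \<forall>x\<in>Fil P p. q x + q' x = 0"
    using p by (intro exI[of _ "max p p'"]) (auto simp: subset_iff)
qed

lemma Q_dual_scale: "q \<in> Q_dual P \<Longrightarrow> (\<lambda>x. c * q x) \<in> Q_dual P"
  unfolding Q_dual_def
proof safe
  fix p assume "Vector_Spaces.linear (scal P) (*) q"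
  then interpret q: Vector_Spaces.linear "scal P" "(*)" q .
  show "Vector_Spaces.linear (scal P) (*) (\<lambda>x. c * q x)"
    by (rule linearI[OF scal_vector_space fld.vector_space_axioms]) (simp_all add: q.add q.scale algebra_simps)
  assume p: "1 \<le> p" "\<forall>x\<in>Fil P p. q x = 0"
  then show "\<exists>p\<ge>1. \<forall>x\<in>Fil P p. c * q x = 0" by (intro exI[of _ p]) auto
qed

definition Q_poly :: "(('p \<Rightarrow> 'k) multiset \<Rightarrow>\<^sub>0 'k) set" where
  "Q_poly = {f. Poly_Mapping.keys f \<subseteq> {M. set_mset M \<subseteq> Q_dual P}}"

lemma subspace_Q_poly [simp]: "pm.subspace Q_poly"
  unfolding Q_poly_def by (rule subspace_keys)

lemma basis_Q_poly: "set_mset M \<subseteq> Q_dual P \<Longrightarrow> basis M \<in> Q_poly"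
  by (simp add: Q_poly_def)

lemma Q_poly_mult: "f \<in> Q_poly \<Longrightarrow> g \<in> Q_poly \<Longrightarrow> f * g \<in> Q_poly"
  unfolding Q_poly_def using keys_mult[of f g] by fastforce

lemma subspace_sym_ideal [simp]: "pm.subspace (sym_ideal P)"
  by (simp add: sym_ideal_def)

text \<open>Keeps the representatives chosen by \<open>rep\<close> among the polynomials in
  variables from \<open>Q\<close>.\<close>

lemma sym_ideal_Q_poly: "sym_ideal P \<subseteq> Q_poly"
  unfolding sym_ideal_def
proof (rule pm.span_minimal[OF _ subspace_Q_poly], safe)
  fix M :: "('p \<Rightarrow> 'k) multiset" and q q' :: "'p \<Rightarrow> 'k"
  assume M: "set_mset M \<subseteq> Q_dual P" and q: "q \<in> Q_dual P" "q' \<in> Q_dual P"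
  show "basis M * (basis {#\<lambda>x. q x + q' x#} - basis {#q#} - basis {#q'#}) \<in> Q_poly"
    by (intro Q_poly_mult pm.subspace_diff[OF subspace_Q_poly] basis_Q_poly) (use M q Q_dual_add in auto)
next
  fix M :: "('p \<Rightarrow> 'k) multiset" and q :: "'p \<Rightarrow> 'k" and c :: 'k
  assume M: "set_mset M \<subseteq> Q_dual P" and q: "q \<in> Q_dual P"
  show "basis M * (basis {#\<lambda>x. c * q x#} - pscale c (basis {#q#})) \<in> Q_poly"
    by (intro Q_poly_mult pm.subspace_diff[OF subspace_Q_poly] pm.subspace_scale[OF subspace_Q_poly] basis_Q_poly)
      (use M q Q_dual_scale in auto)
qed

text \<open>The multipliers in \<open>sym_ideal\<close> are monomials in variables from
  \<open>Q\<close>, so it is treated as an ideal of \<open>Q_poly\<close>, not of the whole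
  polynomial algebra.\<close>

lemma sym_ideal_mult:
  assumes f: "f \<in> Q_poly" and i: "i \<in> sym_ideal P"
  shows "f * i \<in> sym_ideal P"
proof -
  have "basis N * i \<in> sym_ideal P" if N: "set_mset N \<subseteq> Q_dual P" for N
  proof (rule linear_in_span[OF linear_mult_left i[unfolded sym_ideal_def] subspace_sym_ideal])
    let ?R = "{basis {#\<lambda>x. q x + q' x#} - basis {#q#} - basis {#q'#} | q q'. q \<in> Q_dual P \<and> q' \<in> Q_dual P} \<union>
     {basis {#\<lambda>x. c * q x#} - pscale c (basis {#q#}) | c q. q \<in> Q_dual P} :: (('p \<Rightarrow> 'k) multiset \<Rightarrow>\<^sub>0 'k) set"
    fix g assume "g \<in> {basis M * r | M r. set_mset M \<subseteq> Q_dual P \<and> r \<in> ?R}"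
    then obtain M r where g: "g = basis M * r" "set_mset M \<subseteq> Q_dual P" "r \<in> ?R" by blast
    have "basis (N + M) * r \<in> sym_ideal P"
      unfolding sym_ideal_def
    proof (rule pm.span_base, rule CollectI, rule exI[of _ "N + M"], rule exI[of _ r], intro conjI)
      show "set_mset (N + M) \<subseteq> Q_dual P" using g(2) N by simp
    qed (rule refl, rule g(3))
    then show "basis N * g \<in> sym_ideal P"
      by (simp only: g(1) mult.assoc[symmetric] basis_mult)
  qed
  then have *: "basis N \<in> {f. f * i \<in> sym_ideal P}" if "N \<in> Poly_Mapping.keys f" for N
    using that f by (auto simp: Q_poly_def)
  have "f \<in> {f. f * i \<in> sym_ideal P}"
  proof (rule in_subspace_if_basis_in)
    show "pm.subspace {f. f * i \<in> sym_ideal P}"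
      by (rule pm.subspaceI)
        (simp_all add: distrib_right pscale_mult_left pm.subspace_0 pm.subspace_add pm.subspace_scale)
  qed (rule *)
  then show ?thesis by simp
qed

abbreviation cls :: "(('p \<Rightarrow> 'k) multiset \<Rightarrow>\<^sub>0 'k) \<Rightarrow> (('p \<Rightarrow> 'k) multiset \<Rightarrow>\<^sub>0 'k) set" where
  "cls f \<equiv> f +o sym_ideal P"

lemma SymQ_carrier: "carrier (SymQ P) = cls ` Q_poly"
  by (auto simp: SymQ_def Q_poly_def)

lemma SymQ_rep: "X \<in> carrier (SymQ P) \<Longrightarrow> rep X \<in> Q_poly \<and> X = cls (rep X)"
proof -
  assume "X \<in> carrier (SymQ P)"
  then obtain f where f: "f \<in> Q_poly" "X = cls f" unfolding SymQ_carrier by blast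
  have "(rep X - f) + f \<in> Q_poly"
    unfolding f(2) using rep_coset_diff[OF subspace_sym_ideal, of f] sym_ideal_Q_poly f(1)
    by (intro pm.subspace_add[OF subspace_Q_poly]) auto
  then show ?thesis unfolding f(2) using rep_coset[OF subspace_sym_ideal, of f] by simp
qed

lemma SymQ_simps:
  assumes "f \<in> Q_poly" "g \<in> Q_poly"
  shows SymQ_add: "cls f \<oplus>\<^bsub>SymQ P\<^esub> cls g = cls (f + g)"
    and SymQ_mult: "cls f \<otimes>\<^bsub>SymQ P\<^esub> cls g = cls (f * g)"
    and SymQ_scale: "c \<odot>\<^bsub>SymQ P\<^esub> cls f = cls (pscale c f)"
proof -
  have f: "rep (cls f) - f \<in> sym_ideal P" and g: "rep (cls g) - g \<in> sym_ideal P"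
    by (simp_all add: rep_coset_diff)
  show "cls f \<oplus>\<^bsub>SymQ P\<^esub> cls g = cls (f + g)"
    using pm.subspace_add[OF subspace_sym_ideal f g] by (simp add: SymQ_def coset_eq_iff algebra_simps)
  show "c \<odot>\<^bsub>SymQ P\<^esub> cls f = cls (pscale c f)"
    using pm.subspace_scale[OF subspace_sym_ideal f, of c]
    by (simp add: SymQ_def coset_eq_iff pm.scale_right_diff_distrib)
  have "rep (cls g) \<in> Q_poly" using SymQ_rep[of "cls g"] assms(2) by (auto simp: SymQ_carrier)
  then have "rep (cls g) * (rep (cls f) - f) + f * (rep (cls g) - g) \<in> sym_ideal P"
    by (intro pm.subspace_add[OF subspace_sym_ideal] sym_ideal_mult f g assms)
  then show "cls f \<otimes>\<^bsub>SymQ P\<^esub> cls g = cls (f * g)"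
    by (simp add: SymQ_def coset_eq_iff algebra_simps)
qed

lemma SymQ_one: "\<one>\<^bsub>SymQ P\<^esub> = cls 1"
  by (simp add: SymQ_def)

lemma closed_SymQ: "closed_module (SymQ P)"
  unfolding closed_module_def SymQ_carrier
  by (auto simp: SymQ_add SymQ_scale[OF _ _] pm.subspace_add pm.subspace_scale intro!: imageI)

text \<open>\<open>W M\<close> represents modulo \<open>F\<^sup>M\<close> the grouplike element \<open>exp p\<close> of the completion.\<close>

definition represents_exp :: "(nat \<Rightarrow> 'p list \<Rightarrow>\<^sub>0 'k) \<Rightarrow> 'p \<Rightarrow> bool" where
  "represents_exp W p \<longleftrightarrow> (\<forall>m M. 1 \<le> m \<longrightarrow> 2 * m \<le> M \<longrightarrow> grouplike m (W M)) \<and>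
     (\<forall>M\<ge>2. log_trunc M (W M) - basis [p] \<in> fil M)"

text \<open>Evaluating \<open>\<psi> f\<close> at the represented grouplike element and
  \<open>f\<close> at \<open>p\<close> are both multiplicative in \<open>f\<close>, so generators
  suffice. For \<open>q \<in> Q\<close> write \<open>\<psi> q = e g\<close>: at the grouplike
  element this is the value of \<open>g\<close> at the logarithm \<open>[p]\<close>, which is
  \<open>q p\<close> by \<open>e_map_letter\<close>. How large \<open>M\<close> must be depends on
  \<open>f\<close>, hence the eventual statement.\<close>

lemma psi_represents_exp:
  assumes fin: "finite_dim_quotients P" and psi: "is_psi_bullet P \<psi>" and W: "represents_exp W p"
    and X: "X \<in> carrier (SymQ P)"
  shows "\<forall>\<^sub>F M in sequentially. \<psi> X (W M) = sym_eval X p"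
proof -
  have hom: "\<psi> \<in> ring_hom (SymQ P) (Uc P)"
    and scale: "\<And>c x. x \<in> carrier (SymQ P) \<Longrightarrow> \<psi> (c \<odot>\<^bsub>SymQ P\<^esub> x) = c \<odot>\<^bsub>Uc P\<^esub> \<psi> x"
    and gen: "\<And>q. q \<in> Q_dual P \<Longrightarrow> \<psi> (sym_gen P q) \<in> e_map P ` carrier (Uc P)"
      "\<And>q. q \<in> Q_dual P \<Longrightarrow> proj_Q (\<psi> (sym_gen P q)) = q"
    using psi unfolding is_psi_bullet_def alg_hom_def by auto
  have gl: "grouplike m (W M)" if "1 \<le> m" "2 * m \<le> M" for m M
    using W that unfolding represents_exp_def by blast
  have clsc: "cls f \<in> carrier (SymQ P)" if "f \<in> Q_poly" for f
    using that by (simp add: SymQ_carrier)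
  have psiUc: "\<psi> (cls f) \<in> carrier (Uc P)" if "f \<in> Q_poly" for f
    using hom clsc[OF that] by (rule ring_hom_closed)
  let ?ev = "\<lambda>f. lext (*) (\<lambda>M. \<Prod>q\<in>#M. q p) f :: 'k"
  let ?G = "{f \<in> Q_poly. \<forall>\<^sub>F M in sequentially. \<psi> (cls f) (W M) = ?ev f}"
  have one: "1 \<in> ?G"
  proof -
    have 1: "?ev 1 = 1" using fld.lext_basis[of "\<lambda>M. \<Prod>q\<in>#M. q p" "{#}"] by simp
    have "\<psi> (cls 1) (W M) = ?ev 1" if "2 \<le> M" for M
      using gl[of 1 M] that ring_hom_one[OF hom]
      by (simp add: SymQ_one Uc_simps grouplike_def 1)
    then show ?thesis using basis_Q_poly[of "{#}"] eventually_sequentially by auto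
  qed
  have letter: "basis {#q#} \<in> ?G" if q: "q \<in> Q_dual P" for q
  proof -
    let ?h = "\<psi> (cls (basis {#q#}))"
    obtain g where g: "g \<in> carrier (Uc P)" "?h = e_map P g"
      using gen(1)[OF q] unfolding sym_gen_def by blast
    have qx: "q x = g (basis [x])" for x
      using gen(2)[OF q] e_map_letter[OF fin g(1), of x] g(2) unfolding sym_gen_def proj_Q_def by metis
    obtain m0 where m0: "linear_form g" "\<forall>n\<ge>m0. \<forall>u\<in>fil n. g u = 0" using g(1) by (rule UcE)
    interpret g: Vector_Spaces.linear pscale "(*)" g by (rule m0)
    define m where "m = max 1 m0"
    have m: "1 \<le> m" "\<forall>u\<in>fil m. g u = 0" using m0(2)[THEN spec, of m] by (simp_all add: m_def)
    have "?h (W M) = ?ev (basis {#q#})" if M: "2 * m \<le> M" for M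
    proof -
      have gr: "grouplike m (W M)" using gl m(1) M .
      then have "W M - 1 \<in> fil 1"
        by (intro fil_1) (simp add: grouplike_def counit_def lookup_minus flip: basis_Nil)
      then have 1: "log_trunc M (W M) - log_trunc m (W M) \<in> fil m"
        by (rule log_trunc_le) (use M in linarith)
      have "log_trunc M (W M) - basis [p] \<in> fil M"
        using W M m(1) unfolding represents_exp_def by simp
      then have 2: "log_trunc M (W M) - basis [p] \<in> fil m" using fil_mono[of m M] M by auto
      have "g (log_trunc m (W M)) = g (log_trunc M (W M))" using m(2) 1 by (metis g.diff eq_iff_diff_eq_0)
      also have "\<dots> = g (basis [p])" using m(2) 2 by (metis g.diff eq_iff_diff_eq_0)
      finally show ?thesis
        unfolding g(2) e_map_grouplike[OF fin gr m(1) m0(1) m(2)] by (simp add: qx)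
    qed
    then show ?thesis
      using basis_Q_poly[of "{#q#}"] q by (auto simp: eventually_sequentially)
  qed
  \<comment> \<open>Evaluation is assumed multiplicative on the pair at hand; this is immediate for
    monomials, to which the rule is applied.\<close>
  have mult: "f * g \<in> ?G" if "f \<in> ?G" "g \<in> ?G" "?ev (f * g) = ?ev f * ?ev g" for f g
  proof -
    have Q: "f \<in> Q_poly" "g \<in> Q_poly" using that by auto
    obtain m where m: "linear_form (\<psi> (cls f))" "\<forall>n\<ge>m. \<forall>u\<in>fil n. \<psi> (cls f) u = 0"
      using psiUc[OF Q(1)] by (rule UcE)
    obtain n where n: "linear_form (\<psi> (cls g))" "\<forall>k\<ge>n. \<forall>u\<in>fil k. \<psi> (cls g) u = 0"
      using psiUc[OF Q(2)] by (rule UcE)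
    define k where "k = Suc (max m n)"
    have "\<forall>u\<in>fil k. \<psi> (cls f) u = 0" "\<forall>u\<in>fil k. \<psi> (cls g) u = 0"
      using m(2) n(2) unfolding k_def by (meson le_SucI max.cobounded1, meson le_SucI max.cobounded2)
    then have "\<psi> (cls (f * g)) (W M) = \<psi> (cls f) (W M) * \<psi> (cls g) (W M)" if "2 * k \<le> M" for M
      using gl[of k M] that m(1) n(1) ring_hom_mult[OF hom clsc[OF Q(1)] clsc[OF Q(2)]]
      unfolding grouplike_def SymQ_mult[OF Q] by (simp add: k_def)
    then have "\<forall>\<^sub>F M in sequentially. \<psi> (cls (f * g)) (W M) = \<psi> (cls f) (W M) * \<psi> (cls g) (W M)"
      unfolding eventually_sequentially by blast
    moreover have "\<forall>\<^sub>F M in sequentially. \<psi> (cls f) (W M) = ?ev f" "\<forall>\<^sub>F M in sequentially. \<psi> (cls g) (W M) = ?ev g"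
      using that by auto
    ultimately have "\<forall>\<^sub>F M in sequentially. \<psi> (cls (f * g)) (W M) = ?ev (f * g)"
      by eventually_elim (simp add: that(3))
    then show ?thesis using Q_poly_mult[OF Q] by simp
  qed
  have mono: "basis N \<in> ?G" if "set_mset N \<subseteq> Q_dual P" for N
    using that
  proof (induction N)
    case empty
    then show ?case using one by simp
  next
    case (add q N)
    have "basis (add_mset q N) = basis {#q#} * (basis N :: _ \<Rightarrow>\<^sub>0 'k)" by (simp add: basis_mult)
    moreover have "?ev (basis {#q#} * basis N) = ?ev (basis {#q#}) * ?ev (basis N)"
      by (simp only: basis_mult fld.lext_basis) simp
    ultimately show ?case using mult[OF letter[of q] add.IH] add.prems by simp
  qed
  have "rep X \<in> ?G"
  proof (rule in_subspace_if_basis_in)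
    show "basis N \<in> ?G" if "N \<in> Poly_Mapping.keys (rep X)" for N
      using mono[of N] SymQ_rep[OF X] that by (auto simp: Q_poly_def)
    show "pm.subspace ?G"
    proof (rule pm.subspaceI)
      have sc: "pscale c f \<in> ?G" if "f \<in> ?G" for c f
      proof -
        have Q: "f \<in> Q_poly" and ev: "\<forall>\<^sub>F M in sequentially. \<psi> (cls f) (W M) = ?ev f" using that by auto
        have "\<psi> (cls (pscale c f)) = (\<lambda>u. c * \<psi> (cls f) u)"
          using scale[OF clsc[OF Q], of c] by (simp add: SymQ_scale[OF Q Q] Uc_simps)
        then have "\<forall>\<^sub>F M in sequentially. \<psi> (cls (pscale c f)) (W M) = ?ev (pscale c f)"
          using ev by (auto simp: fld.lext_pscale elim: eventually_mono)
        then show ?thesis using Q by (simp add: pm.subspace_scale)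
      qed
      then show "pscale c f \<in> ?G" if "f \<in> ?G" for c f using that by blast
      show "0 \<in> ?G" using sc[OF one, of 0] by simp
      show "f + g \<in> ?G" if "f \<in> ?G" "g \<in> ?G" for f g
      proof -
        have Q: "f \<in> Q_poly" "g \<in> Q_poly" and ev: "\<forall>\<^sub>F M in sequentially. \<psi> (cls f) (W M) = ?ev f"
          "\<forall>\<^sub>F M in sequentially. \<psi> (cls g) (W M) = ?ev g" using that by auto
        have "\<psi> (cls (f + g)) = (\<lambda>u. \<psi> (cls f) u + \<psi> (cls g) u)"
          using ring_hom_add[OF hom clsc[OF Q(1)] clsc[OF Q(2)]] by (simp add: SymQ_add[OF Q] Uc_simps)
        moreover have "\<forall>\<^sub>F M in sequentially. \<psi> (cls f) (W M) + \<psi> (cls g) (W M) = ?ev (f + g)"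
          using ev by eventually_elim (simp add: fld.lext_add)
        ultimately show ?thesis using Q by (simp add: pm.subspace_add)
      qed
    qed
  qed
  then show ?thesis using SymQ_rep[OF X] unfolding sym_eval_def by simp
qed

lemma represents_exp_trunc: "represents_exp (\<lambda>M. exp_trunc M a) a"
  unfolding represents_exp_def by (auto intro: grouplike_exp_trunc log_exp_trunc)

lemma represents_exp_star:
  "is_sharp P sh \<Longrightarrow> represents_exp (\<lambda>M. env_star P (exp_trunc M a) (exp_trunc M b)) (sh a b)"
  unfolding represents_exp_def by (auto intro: grouplike_env_star sharp_log)

section \<open>Comparison of the two coproducts\<close>

lemma exp_trunc_mono: "m \<le> M \<Longrightarrow> exp_trunc M a - exp_trunc m a \<in> fil m"
proof -
  assume le: "m \<le> M"
  have "(exp_trunc M a :: 'p list \<Rightarrow>\<^sub>0 'k) = (\<Sum>n\<in>{..<M} - {..<m}. pscale (1 / fact n) (basis (replicate n a))) + exp_trunc m a"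
    unfolding exp_trunc_replicate using le by (intro sum.subset_diff) auto
  then have "exp_trunc M a - (exp_trunc m a :: 'p list \<Rightarrow>\<^sub>0 'k) = (\<Sum>n\<in>{..<M} - {..<m}. pscale (1 / fact n) (basis (replicate n a)))"
    by (simp only: add_diff_cancel)
  also have "\<dots> \<in> fil m"
    by (intro pm.subspace_sum[OF subspace_fil] pm.subspace_scale[OF subspace_fil] replicate_fil) auto
  finally show ?thesis .
qed

lemma Uc_eventually: "f \<in> carrier (Uc P) \<Longrightarrow> \<forall>\<^sub>F m in sequentially. \<forall>u\<in>fil m. f u = 0"
  using UcE[of f] unfolding eventually_sequentially by blast

theorem Delta_sharp_Delta_star:
  assumes fin: "finite_dim_quotients P" and sh: "is_sharp P sh"
    and Dsh: "is_Delta_sharp P sh \<Delta>sh" and psi: "is_psi_bullet P \<psi>" and f: "f \<in> carrier (SymQ P)"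
  shows "tensor_map (Uc P) (Uc P) \<psi> \<psi> (\<Delta>sh f) = Delta_star P (\<psi> f)"
proof -
  have psiUc: "\<psi> x \<in> carrier (Uc P)" if "x \<in> carrier (SymQ P)" for x
    using psi that unfolding is_psi_bullet_def alg_hom_def by (blast intro: ring_hom_closed)
  have "\<Delta>sh f \<in> carrier (tensor (SymQ P) (SymQ P))"
    using Dsh f unfolding is_Delta_sharp_def alg_hom_def by (blast intro: ring_hom_closed)
  note R = tensor_rep(1)[OF closed_SymQ closed_SymQ this]
  define R where "R = rep (\<Delta>sh f)"
  have R: "Poly_Mapping.keys R \<subseteq> carrier (SymQ P) \<times> carrier (SymQ P)"
    using R by (simp add: R_def)
  \<comment> \<open>The values on pairs \<open>u\<close>, \<open>v\<close> of the tensor represented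
    by \<open>t\<close>, that is, of the left-hand side.\<close>
  define B where "B u v = lext (*) (\<lambda>(g, h). \<psi> g u * \<psi> h v) R" for u v
  define t where "t = lext pscale (\<lambda>(g, h). basis (\<psi> g, \<psi> h)) R"
  have B_sum: "B u v = (\<Sum>x\<in>Poly_Mapping.keys R. Poly_Mapping.lookup R x * (\<psi> (fst x) u * \<psi> (snd x) v))" for u v
    by (simp add: B_def lext_def split_def)
  have psiR: "\<psi> (fst x) \<in> carrier (Uc P)" "\<psi> (snd x) \<in> carrier (Uc P)" if "x \<in> Poly_Mapping.keys R" for x
    using R that psiUc by auto
  have psi_lin: "\<psi> (fst x) (u + v) = \<psi> (fst x) u + \<psi> (fst x) v" "\<psi> (snd x) (u + v) = \<psi> (snd x) u + \<psi> (snd x) v"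
    "\<psi> (fst x) (pscale c u) = c * \<psi> (fst x) u" "\<psi> (snd x) (pscale c u) = c * \<psi> (snd x) u"
    if "x \<in> Poly_Mapping.keys R" for x u v c
    using Uc_linear[OF psiR(1)[OF that]] Uc_linear[OF psiR(2)[OF that]] by (simp_all add: Vector_Spaces.linear_iff)
  have linl: "linear_form (\<lambda>u. B u v)" for v
  proof (rule linear_formI)
    show "B (u + u') v = B u v + B u' v" for u u'
      unfolding B_sum sum.distrib[symmetric]
      by (rule sum.cong) (simp_all add: psi_lin algebra_simps)
    show "B (pscale c u) v = c * B u v" for c u
      unfolding B_sum sum_distrib_left
      by (rule sum.cong) (simp_all add: psi_lin algebra_simps)
  qed
  have linr: "linear_form (B u)" for u
  proof (rule linear_formI)
    show "B u (v + v') = B u v + B u v'" for v v'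
      unfolding B_sum sum.distrib[symmetric]
      by (rule sum.cong) (simp_all add: psi_lin algebra_simps)
    show "B u (pscale c v) = c * B u v" for c v
      unfolding B_sum sum_distrib_left
      by (rule sum.cong) (simp_all add: psi_lin algebra_simps)
  qed
  have "\<forall>\<^sub>F m in sequentially. \<forall>x\<in>Poly_Mapping.keys R. (\<forall>u\<in>fil m. \<psi> (fst x) u = 0) \<and> (\<forall>u\<in>fil m. \<psi> (snd x) u = 0)"
    by (intro eventually_ball_finite ballI eventually_conj Uc_eventually psiR) auto
  moreover have "\<forall>\<^sub>F m in sequentially. \<forall>u\<in>fil m. \<psi> f u = 0" by (intro Uc_eventually psiUc f)
  ultimately have "\<forall>\<^sub>F m in sequentially. (\<forall>x\<in>Poly_Mapping.keys R. (\<forall>u\<in>fil m. \<psi> (fst x) u = 0) \<and> (\<forall>u\<in>fil m. \<psi> (snd x) u = 0))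
      \<and> (\<forall>u\<in>fil m. \<psi> f u = 0)"
    by (rule eventually_conj)
  \<comment> \<open>A single \<open>m\<close> serves for the finitely many tensor factors and for
    \<open>\<psi> f\<close>. With \<open>fil_star\<close> the difference \<open>?D\<close> of the
    two sides then vanishes as soon as one argument lies in \<open>F\<^sup>m\<close>.\<close>
  then obtain m where m: "\<forall>x\<in>Poly_Mapping.keys R. (\<forall>u\<in>fil m. \<psi> (fst x) u = 0) \<and> (\<forall>u\<in>fil m. \<psi> (snd x) u = 0)"
    "\<forall>u\<in>fil m. \<psi> f u = 0"
    by (auto simp: eventually_sequentially)
  have B0: "B u v = 0" if "u \<in> fil m \<or> v \<in> fil m" for u v
    unfolding B_sum using that m(1) by (intro sum.neutral) auto
  interpret f: Vector_Spaces.linear pscale "(*)" "\<psi> f" using psiUc[OF f] by (rule Uc_linear)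
  let ?D = "\<lambda>u v. B u v - \<psi> f (env_star P u v)"
  have star0: "\<psi> f (env_star P u v) = 0" if "u \<in> fil m \<or> v \<in> fil m" for u v
    using that fil_star[of u m v 0] fil_star[of u 0 v m] fil_0 m(2) by auto
  have Dl: "linear_form (\<lambda>u. ?D u v)" for v
    using linl[of v] linear_comp[OF linear_env_star_left[of P v] f.linear_axioms]
    by (simp add: Vector_Spaces.linear_iff algebra_simps)
  have Dr: "linear_form (?D u)" for u
    using linr[of u] linear_comp[OF linear_env_star_right[of P u] f.linear_axioms]
    by (simp add: Vector_Spaces.linear_iff algebra_simps)
  have "?D u v = 0" for u v
  proof (rule exp_dense_bilinear[where B = ?D, OF Dl Dr])
    show "?D u v = 0" if "u \<in> fil m" for u v using B0 star0 that by simp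
    show "?D u v = 0" if "v \<in> fil m" for u v using B0 star0 that by simp
    fix a b
    note ev = psi_represents_exp[OF fin psi]
    have "\<forall>\<^sub>F M in sequentially. \<forall>x\<in>Poly_Mapping.keys R. \<psi> (fst x) (exp_trunc M a) = sym_eval (fst x) a
        \<and> \<psi> (snd x) (exp_trunc M b) = sym_eval (snd x) b"
      using R by (intro eventually_ball_finite ballI eventually_conj ev[OF represents_exp_trunc]) auto
    moreover have "\<forall>\<^sub>F M in sequentially. \<psi> f (env_star P (exp_trunc M a) (exp_trunc M b)) = sym_eval f (sh a b)"
      by (rule ev[OF represents_exp_star[OF sh] f])
    moreover have "\<forall>\<^sub>F M in sequentially. m \<le> M" by (rule eventually_ge_at_top)
    \<comment> \<open>Values at exponentials are known only for large truncation orders, whereas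
      \<open>exp_dense_bilinear\<close> asks for order \<open>m\<close>.\<close>
    ultimately have "\<forall>\<^sub>F M in sequentially. m \<le> M \<and> ?D (exp_trunc M a) (exp_trunc M b) = 0"
    proof eventually_elim
      case (elim M)
      have "B (exp_trunc M a) (exp_trunc M b) = tensor_form (\<lambda>g h. sym_eval g a * sym_eval h b) (\<Delta>sh f)"
        unfolding B_def tensor_form_def R_def[symmetric]
        by (rule fld.lext_cong) (use elim(1) in auto)
      also have "\<dots> = sym_eval f (sh a b)"
        using Dsh f unfolding is_Delta_sharp_def by blast
      finally show ?case using elim by simp
    qed
    then obtain M where M: "m \<le> M" "?D (exp_trunc M a) (exp_trunc M b) = 0"
      by (auto simp: eventually_sequentially)
    interpret l: Vector_Spaces.linear pscale "(*)" "\<lambda>u. ?D u v" for v by (rule Dl)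
    interpret r: Vector_Spaces.linear pscale "(*)" "?D u" for u by (rule Dr)
    have D0: "?D u v = 0" if "u \<in> fil m \<or> v \<in> fil m" for u v using B0 star0 that by simp
    \<comment> \<open>Lowering the order from \<open>M\<close> to \<open>m\<close> changes either
      argument by an element of \<open>F\<^sup>m\<close>, which \<open>?D\<close> does not
      see.\<close>
    have "?D (exp_trunc M a - exp_trunc m a) (exp_trunc M b) = 0"
      "?D (exp_trunc m a) (exp_trunc M b - exp_trunc m b) = 0"
      by (rule D0, simp add: exp_trunc_mono M(1))+
    then show "?D (exp_trunc m a) (exp_trunc m b) = 0"
      using M(2) unfolding l.diff r.diff by simp
  qed
  then have BD: "B u v = \<psi> f (env_star P u v)" for u v by simp
  have "t \<in> {t. Poly_Mapping.keys t \<subseteq> carrier (Uc P) \<times> carrier (Uc P)}"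
    unfolding t_def by (rule pm.lext_in_subspace[OF subspace_keys]) (use psiR in auto)
  then have tc: "t +o UcR \<in> carrier (tensor (Uc P) (Uc P))" by (intro tensor_carrierI) simp
  have form: "lext (*) (\<lambda>(g, h). g u * h v) (rep (t +o UcR)) = \<psi> f (env_star P u v)" for u v
  proof -
    have "lext (*) (\<lambda>(g, h). g u * h v) (rep (t +o UcR) - t) = 0"
      by (rule tensor_rel_form[OF rep_coset_diff[OF subspace_tensor_rel]])
        (simp_all add: Uc_simps algebra_simps)
    moreover have "lext (*) (\<lambda>(g, h). g u * h v) t = B u v"
      unfolding t_def B_def by (simp add: pm.linear_lext_comp[OF fld.linear_lext] split_def)
    ultimately show ?thesis by (simp add: fld.lext_diff BD)
  qed
  have "Delta_star P (\<psi> f) = t +o UcR"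
    unfolding Delta_star_def by (rule dual_coprod_eqI[OF tc]) (simp add: tensor_form_def form)
  then show ?thesis by (simp add: tensor_map_def t_def R_def)
qed

end

theorem proposition4p11:
  fixes P :: "('k::field_char_0, 'p::ab_group_add) filtered_post_lie"
  assumes "complete_filtered_post_lie_algebra P"
    and "finite_dim_quotients P"
    and "is_sharp P sh"
    and "is_Delta_sharp P sh \<Delta>sh"
    and "is_psi_bullet P \<psi>"
  shows "\<forall>f\<in>carrier (SymQ P).
    tensor_map (Uc P) (Uc P) \<psi> \<psi> (\<Delta>sh f) = Delta_star P (\<psi> f)"
  using complete_filtered_post_lie_algebra.Delta_sharp_Delta_star[OF assms] by blast

end
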